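(* Let $(E,e,T)$ be a conditional Riesz triple. (a) There exists a $T$-universal completion of $(E,e,T)$. (b) Let $(\tilde E_1,\tilde e_1,\tilde T_1)$ and $(\tilde E_2,\tilde e_2,\tilde T_2)$ be $T$-universal completions of $(E,e,T)$ with respective embeddings $i_1\colon E\to\tilde E_1$ and $i_2\colon E\to\tilde E_2$. Then there exists a Riesz isomorphism $\Phi\colon\tilde E_1\to\tilde E_2$ such that $i_2=\Phi\circ i_1$. In particular, the diagram formed by $\Phi,i_1,i_2,T,\tilde T_1,\tilde T_2$ commutes, i.e. $\Phi\circ i_1=i_2$, $\tilde T_1\circ i_1=i_1\circ T$, $\tilde T_2\circ i_2=i_2\circ T$ and $\Phi\circ\tilde T_1=\tilde T_2\circ\Phi$.
   Context: All Riesz spaces (vector lattices) are real. A weak order unit of a Riesz space $E$ is an element $e\in E_+$ such that the band generated by $e$ is $E$. A conditional Riesz triple is a triple $(E,e,T)$ where $E$ is a Dedekind complete Riesz space, $e$ is a weak order unit of $E$, and $T\colon E\to E$ is an order continuous positive linear projection with $T(e)=e$ whose range $R(T)$ is a Dedekind complete Riesz subspace of $E$, and $T$ is strictly positive, i.e. $f\in E_+\setminus\{0\}$ implies $Tf\in E_+\setminus\{0\}$. A Riesz subspace $D$ of a Riesz space $E$ is order dense if for every $f\in E_+\setminus\{0\}$ there is $g\in D_+\setminus\{0\}$ with $g\le f$. A Dedekind complete Riesz space is universally complete if every non-empty set of mutually disjoint elements has a supremum. The universal completion of an Archimedean Riesz space $E$ is the (unique up to Riesz isomorphism) universally complete Riesz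 space $E^u$ together with a bipositive linear map $j\colon E\to E^u$ (its embedding) such that $j[E]$ is an order dense Riesz subspace of $E^u$. (A linear map $j$ is bipositive if $j(x)\ge 0\iff x\ge 0$.) Let $(E,e,T)$ be a conditional Riesz triple and $E^u$ the universal completion of $E$ with embedding $j\colon E\to E^u$. $E$ is called $T$-universally complete (and then the triple $(E,e,T)$ is also called $T$-universally complete) if every non-empty upwards directed subset $A\subseteq E$ such that $j[T[A]]$ is bounded from above in $E^u$ has a supremum in $E$. A $T$-universal completion of $(E,e,T)$ is a conditional Riesz triple $(\tilde E,\tilde e,\tilde T)$ together with a bipositive linear map $i\colon E\to\tilde E$ (the embedding) such that: (i) $\tilde E$ is $\tilde T$-universally complete; (ii) $i[E]$ is an order dense Riesz subspace of $\tilde E$; (iii) $i(e)=\tilde e$; (iv) $\tilde T\circ i=i\circ T$. *)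

theory Defs
  imports Complex_Main "HOL-Algebra.Module" "HOL-Algebra.Lattice"
begin

definition real_ring :: "real ring"
  where "real_ring = \<lparr>carrier = UNIV, mult = (*), one = 1, zero = 0, add = (+)\<rparr>"

text \<open>
  A Riesz space is given by an explicit carrier, since the completions below have to be
  quantified over existentially. The fields \<open>mult\<close> and \<open>one\<close> inherited from rings
  play no role (as for every HOL-Algebra module).
\<close>

record 'a riesz = "(real, 'a) module" +
  rle :: "'a \<Rightarrow> 'a \<Rightarrow> bool" (infixl "\<preceq>\<index>" 50)

definition ord_of :: "'a riesz \<Rightarrow> 'a gorder"
  where "ord_of E = \<lparr>carrier = carrier E, eq = (=), le = rle E\<rparr>"

locale riesz_space = module real_ring E + order: lattice "ord_of E" for E :: "'a riesz" (structure) +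
  assumes add_mono: "\<lbrakk>x \<in> carrier E; y \<in> carrier E; z \<in> carrier E; x \<preceq> y\<rbrakk> \<Longrightarrow> x \<oplus> z \<preceq> y \<oplus> z"
    and smult_nonneg: "\<lbrakk>0 \<le> a; x \<in> carrier E; \<zero> \<preceq> x\<rbrakk> \<Longrightarrow> \<zero> \<preceq> a \<odot> x"

definition pos_cone :: "'a riesz \<Rightarrow> 'a set"
  where "pos_cone E = {x \<in> carrier E. \<zero>\<^bsub>E\<^esub> \<preceq>\<^bsub>E\<^esub> x}"

definition modulus :: "'a riesz \<Rightarrow> 'a \<Rightarrow> 'a"
  where "modulus E x = x \<squnion>\<^bsub>ord_of E\<^esub> (\<ominus>\<^bsub>E\<^esub> x)"

definition disjoint_elts :: "'a riesz \<Rightarrow> 'a \<Rightarrow> 'a \<Rightarrow> bool"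
  where "disjoint_elts E x y \<longleftrightarrow> modulus E x \<sqinter>\<^bsub>ord_of E\<^esub> modulus E y = \<zero>\<^bsub>E\<^esub>"

definition directed_up :: "'a riesz \<Rightarrow> 'a set \<Rightarrow> bool"
  where "directed_up E A \<longleftrightarrow> (\<forall>x\<in>A. \<forall>y\<in>A. \<exists>z\<in>A. x \<preceq>\<^bsub>E\<^esub> z \<and> y \<preceq>\<^bsub>E\<^esub> z)"

definition directed_down :: "'a riesz \<Rightarrow> 'a set \<Rightarrow> bool"
  where "directed_down E A \<longleftrightarrow> (\<forall>x\<in>A. \<forall>y\<in>A. \<exists>z\<in>A. z \<preceq>\<^bsub>E\<^esub> x \<and> z \<preceq>\<^bsub>E\<^esub> y)"

definition riesz_subspace :: "'a riesz \<Rightarrow> 'a set \<Rightarrow> bool"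
  where "riesz_subspace E D \<longleftrightarrow> submodule D real_ring E \<and>
    (\<forall>x\<in>D. \<forall>y\<in>D. x \<squnion>\<^bsub>ord_of E\<^esub> y \<in> D \<and> x \<sqinter>\<^bsub>ord_of E\<^esub> y \<in> D)"

definition riesz_ideal :: "'a riesz \<Rightarrow> 'a set \<Rightarrow> bool"
  where "riesz_ideal E I \<longleftrightarrow> submodule I real_ring E \<and>
    (\<forall>x\<in>carrier E. \<forall>y\<in>I. modulus E x \<preceq>\<^bsub>E\<^esub> modulus E y \<longrightarrow> x \<in> I)"

definition band :: "'a riesz \<Rightarrow> 'a set \<Rightarrow> bool"
  where "band E B \<longleftrightarrow> riesz_ideal E B \<and>
    (\<forall>A s. A \<subseteq> B \<and> A \<noteq> {} \<and> is_lub (ord_of E) s A \<longrightarrow> s \<in> B)"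

definition band_generated :: "'a riesz \<Rightarrow> 'a set \<Rightarrow> 'a set"
  where "band_generated E S = \<Inter>{B. band E B \<and> S \<subseteq> B}"

definition weak_order_unit :: "'a riesz \<Rightarrow> 'a \<Rightarrow> bool"
  where "weak_order_unit E e \<longleftrightarrow> e \<in> pos_cone E \<and> band_generated E {e} = carrier E"

definition dedekind_complete :: "'a riesz \<Rightarrow> bool"
  where "dedekind_complete E \<longleftrightarrow> riesz_space E \<and>
    (\<forall>A. A \<subseteq> carrier E \<and> A \<noteq> {} \<and> Upper (ord_of E) A \<noteq> {} \<longrightarrow> (\<exists>s. is_lub (ord_of E) s A))"

definition universally_complete :: "'a riesz \<Rightarrow> bool"
  where "universally_complete E \<longleftrightarrow> dedekind_complete E \<and>
    (\<forall>A. A \<subseteq> carrier E \<and> A \<noteq> {} \<and> (\<forall>x\<in>A. \<forall>y\<in>A. x \<noteq> y \<longrightarrow> disjoint_elts E x y) \<longrightarrow>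
      (\<exists>s. is_lub (ord_of E) s A))"

definition order_dense :: "'a riesz \<Rightarrow> 'a set \<Rightarrow> bool"
  where "order_dense E D \<longleftrightarrow>
    (\<forall>f \<in> pos_cone E - {\<zero>\<^bsub>E\<^esub>}. \<exists>g \<in> (D \<inter> pos_cone E) - {\<zero>\<^bsub>E\<^esub>}. g \<preceq>\<^bsub>E\<^esub> f)"

definition linear_map :: "'a riesz \<Rightarrow> 'b riesz \<Rightarrow> ('a \<Rightarrow> 'b) \<Rightarrow> bool"
  where "linear_map E F f \<longleftrightarrow> f \<in> carrier E \<rightarrow> carrier F \<and>
    (\<forall>x\<in>carrier E. \<forall>y\<in>carrier E. f (x \<oplus>\<^bsub>E\<^esub> y) = f x \<oplus>\<^bsub>F\<^esub> f y) \<and>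
    (\<forall>a. \<forall>x\<in>carrier E. f (a \<odot>\<^bsub>E\<^esub> x) = a \<odot>\<^bsub>F\<^esub> f x)"

definition bipositive :: "'a riesz \<Rightarrow> 'b riesz \<Rightarrow> ('a \<Rightarrow> 'b) \<Rightarrow> bool"
  where "bipositive E F f \<longleftrightarrow> (\<forall>x\<in>carrier E. \<zero>\<^bsub>F\<^esub> \<preceq>\<^bsub>F\<^esub> f x \<longleftrightarrow> \<zero>\<^bsub>E\<^esub> \<preceq>\<^bsub>E\<^esub> x)"

definition riesz_iso :: "'a riesz \<Rightarrow> 'b riesz \<Rightarrow> ('a \<Rightarrow> 'b) \<Rightarrow> bool"
  where "riesz_iso E F f \<longleftrightarrow> linear_map E F f \<and> bij_betw f (carrier E) (carrier F) \<and>
    join_pres (ord_of E) (ord_of F) f \<and> meet_pres (ord_of E) (ord_of F) f"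

text \<open>Only used for positive linear \<open>T\<close>, where it agrees with preservation of order
  limits of nets.\<close>

definition order_continuous :: "'a riesz \<Rightarrow> 'b riesz \<Rightarrow> ('a \<Rightarrow> 'b) \<Rightarrow> bool"
  where "order_continuous E F T \<longleftrightarrow>
    (\<forall>A. A \<subseteq> carrier E \<and> A \<noteq> {} \<and> directed_down E A \<and> is_glb (ord_of E) \<zero>\<^bsub>E\<^esub> A \<longrightarrow>
      is_glb (ord_of F) \<zero>\<^bsub>F\<^esub> (T ` A))"

definition conditional_riesz_triple :: "'a riesz \<Rightarrow> 'a \<Rightarrow> ('a \<Rightarrow> 'a) \<Rightarrow> bool"
  where "conditional_riesz_triple E e T \<longleftrightarrow>
    dedekind_complete E \<and> weak_order_unit E e \<and>
    linear_map E E T \<and> T \<in> pos_cone E \<rightarrow> pos_cone E \<and> order_continuous E E T \<and>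
    (\<forall>x\<in>carrier E. T (T x) = T x) \<and> T e = e \<and>
    riesz_subspace E (T ` carrier E) \<and> dedekind_complete (E\<lparr>carrier := T ` carrier E\<rparr>) \<and>
    T \<in> (pos_cone E - {\<zero>\<^bsub>E\<^esub>}) \<rightarrow> (pos_cone E - {\<zero>\<^bsub>E\<^esub>})"

definition universal_completion :: "'a riesz \<Rightarrow> 'b riesz \<Rightarrow> ('a \<Rightarrow> 'b) \<Rightarrow> bool"
  where "universal_completion E U j \<longleftrightarrow> riesz_space E \<and> universally_complete U \<and>
    linear_map E U j \<and> bipositive E U j \<and>
    riesz_subspace U (j ` carrier E) \<and> order_dense U (j ` carrier E)"

text \<open>
  The universal completion is unique up to an isomorphism that respects the embeddings, so
  the choice of \<open>U\<close> and \<open>j\<close> below is immaterial. Taking \<open>U\<close> over the type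
  \<open>'a set\<close> loses nothing: if \<open>j\<close> embeds \<open>E\<close> into a universal completion over any
  type, then by order density each positive \<open>v\<close> is the supremum of
  the \<open>j x\<close> with \<open>0 \<le> j x \<le> v\<close>, so mapping \<open>u\<close> to the set of all \<open>x\<close> in \<open>E\<close> with
  \<open>- u\<^sup>- \<le> j x \<le> u\<^sup>+\<close> is injective, and the structure can be transported
  along this map.
\<close>

definition T_universally_complete :: "'a riesz \<Rightarrow> ('a \<Rightarrow> 'a) \<Rightarrow> bool"
  where "T_universally_complete E T \<longleftrightarrow>
    (\<exists>(U :: 'a set riesz) j. universal_completion E U j \<and>
      (\<forall>A. A \<subseteq> carrier E \<and> A \<noteq> {} \<and> directed_up E A \<and> Upper (ord_of U) (j ` T ` A) \<noteq> {} \<longrightarrow>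
        (\<exists>s. is_lub (ord_of E) s A)))"

definition T_universal_completion ::
  "'a riesz \<Rightarrow> 'a \<Rightarrow> ('a \<Rightarrow> 'a) \<Rightarrow> 'b riesz \<Rightarrow> 'b \<Rightarrow> ('b \<Rightarrow> 'b) \<Rightarrow> ('a \<Rightarrow> 'b) \<Rightarrow> bool"
  where "T_universal_completion E e T E' e' T' i \<longleftrightarrow>
    conditional_riesz_triple E' e' T' \<and> linear_map E E' i \<and> bipositive E E' i \<and>
    T_universally_complete E' T' \<and>
    riesz_subspace E' (i ` carrier E) \<and> order_dense E' (i ` carrier E) \<and>
    i e = e' \<and>
    (\<forall>x\<in>carrier E. T' (i x) = i (T x))"

end

theory Submission
  imports Defs "HOL-Library.Lattice_Algebras"
begin

text \<open>
  Existence. In the universal completion of \<open>E\<close> let \<open>E'\<close> consist of the \<open>u\<close> for which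
  \<open>{T x | 0 \<le> x \<le> |u|}\<close> is bounded, and put \<open>T u = sup {T x | 0 \<le> x \<le> u}\<close> for \<open>u \<ge> 0\<close>. The key
  point is a boundedness criterion in a universally complete space with weak unit \<open>e\<close>: a set \<open>A\<close> of
  positive elements is bounded as soon as \<open>g = 0\<close> is the only \<open>g \<ge> 0\<close> with
  \<open>n g \<le> sup {a \<and> n e | a \<in> A}\<close> for all \<open>n\<close>. If \<open>T A\<close> is bounded, such a \<open>g\<close> satisfies \<open>n T g \<le> b\<close> for all
  \<open>n\<close>, hence \<open>T g = 0\<close>, and \<open>g = 0\<close> because \<open>T\<close> is strictly positive.

  Uniqueness. The same criterion shows that \<open>sup {i\<^sub>2 x | 0 \<le> i\<^sub>1 x \<le> v}\<close> exists for every \<open>v \<ge> 0\<close> in the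
  first completion, which defines \<open>\<Phi>\<close>. Order continuous positive maps that agree on the order dense
  ideal \<open>E\<close> are equal, so that \<open>\<Phi>\<close> is inverse to the map constructed in the other direction and
  commutes with the conditional expectations.
\<close>

hide_const (open) Lattice.sup Lattice.inf
declare neg_inf_eq_sup [simp del] neg_sup_eq_inf [simp del] diff_inf_eq_sup [simp del] diff_sup_eq_inf [simp del]

section \<open>Vector lattices\<close>

text \<open>Spaces come with explicit carriers, while lattice calculations are done in type classes.
  Each space is therefore represented as an order ideal of a type; this works because an order
  dense, Dedekind complete Riesz subspace is automatically an ideal, and in an ideal the suprema of
  nonempty families are those of the ambient type. The ambient type is far larger than E, so the
  universal completion of E is cut out of the completed type as the double disjoint complement of
  the image of E. The boundedness criterion uses truncations at n e because their suprema exist by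
  Dedekind completeness alone, before any bound of A is known. Lateral completeness only glues: e
  splits into disjoint components such that on the n-th one every a lies below n e, and a common
  bound of the n-fold components bounds A. For uniqueness the criterion is applied to the images
  under the second expectation, not to the elements themselves: a nonzero g is traced back to E,
  where all multiples of some nonzero element would lie below the first expectation of v. The
  completeness of the second space then turns the bound into a supremum.\<close>

class vector_lattice = ordered_real_vector + lattice_ab_group_add_abs

lemma pprt_diff: "x = pprt x - pprt (- x)" for x :: "'v::vector_lattice"
  by (metis prts pprt_neg diff_minus_eq_add)

lemma abs_pprt: "\<bar>x\<bar> = pprt x + pprt (- x)" for x :: "'v::vector_lattice"
  by (metis abs_prts pprt_neg diff_conv_add_uminus)

lemma pprt_le_abs: "pprt x \<le> \<bar>x\<bar>" for x :: "'v::vector_lattice"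
  by (simp add: abs_pprt)

lemma le_iff_pprt: "x \<le> y \<longleftrightarrow> pprt (x - y) = 0" for x :: "'v::vector_lattice"
  by (metis le_zero_iff_zero_pprt diff_le_0_iff_le)

lemma scaleR_le_cancel: "0 < c \<Longrightarrow> c *\<^sub>R x \<le> c *\<^sub>R y \<longleftrightarrow> x \<le> y" for x :: "'v::vector_lattice"
proof
  assume c: "0 < c" and le: "c *\<^sub>R x \<le> c *\<^sub>R y"
  have "inverse c *\<^sub>R c *\<^sub>R x \<le> inverse c *\<^sub>R c *\<^sub>R y"
    using c by (intro scaleR_left_mono[OF le]) simp
  moreover have "inverse c *\<^sub>R c *\<^sub>R z = z" for z :: 'v using c by simp
  ultimately show "x \<le> y" by metis
qed (simp add: scaleR_left_mono)

lemma scaleR_inf: "0 \<le> c \<Longrightarrow> c *\<^sub>R inf x y = inf (c *\<^sub>R x) (c *\<^sub>R y)" for x :: "'v::vector_lattice"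
proof (cases "c = 0")
  case False
  assume "0 \<le> c"
  with False have c: "0 < c" by simp
  show ?thesis
  proof (rule antisym)
    show "c *\<^sub>R inf x y \<le> inf (c *\<^sub>R x) (c *\<^sub>R y)"
      using c by (simp add: scaleR_left_mono)
    have "inverse c *\<^sub>R inf (c *\<^sub>R x) (c *\<^sub>R y) \<le> inverse c *\<^sub>R c *\<^sub>R x"
      "inverse c *\<^sub>R inf (c *\<^sub>R x) (c *\<^sub>R y) \<le> inverse c *\<^sub>R c *\<^sub>R y"
      using c by (intro scaleR_left_mono; simp)+
    then have "inverse c *\<^sub>R inf (c *\<^sub>R x) (c *\<^sub>R y) \<le> inf x y" using c by simp
    then have "c *\<^sub>R inverse c *\<^sub>R inf (c *\<^sub>R x) (c *\<^sub>R y) \<le> c *\<^sub>R inf x y"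
      using c by (intro scaleR_left_mono) auto
    then show "inf (c *\<^sub>R x) (c *\<^sub>R y) \<le> c *\<^sub>R inf x y" using c by simp
  qed
qed simp

lemma scaleR_sup: "0 \<le> c \<Longrightarrow> c *\<^sub>R sup x y = sup (c *\<^sub>R x) (c *\<^sub>R y)" for x :: "'v::vector_lattice"
  using scaleR_inf[of c "- x" "- y"]
  by (simp only: sup_eq_neg_inf[of x y] sup_eq_neg_inf[of "c *\<^sub>R x" "c *\<^sub>R y"] scaleR_minus_right)

lemma pprt_scaleR: "0 \<le> c \<Longrightarrow> pprt (c *\<^sub>R x) = c *\<^sub>R pprt x" for x :: "'v::vector_lattice"
  by (simp add: pprt_def scaleR_sup)

lemma abs_scaleR: "\<bar>c *\<^sub>R x\<bar> = \<bar>c\<bar> *\<^sub>R \<bar>x\<bar>" for x :: "'v::vector_lattice"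
proof (cases "0 \<le> c")
  case True
  then show ?thesis by (simp add: abs_lattice[of x] abs_lattice[of "c *\<^sub>R x"] scaleR_sup)
next
  case False
  then show ?thesis
    using scaleR_sup[of "- c" x "- x"]
    by (simp add: abs_lattice[of x] abs_lattice[of "c *\<^sub>R x"] sup_commute)
qed

lemma scaleR_le_self: "0 \<le> x \<Longrightarrow> c \<le> d \<Longrightarrow> c *\<^sub>R x \<le> d *\<^sub>R x" for x :: "'v::vector_lattice"
  by (rule scaleR_right_mono)

lemma nonneg_scaleR: "0 \<le> x \<Longrightarrow> 0 \<le> c \<Longrightarrow> 0 \<le> c *\<^sub>R x" for x :: "'v::vector_lattice"
  by (rule scaleR_nonneg_nonneg)

text \<open>With \<open>?z\<close> for the left-hand side, \<open>?z - inf b c\<close> is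
  \<open>sup (?z - b) (?z - c)\<close>, and both entries lie below \<open>a\<close> and below
  \<open>c\<close>. Additivity of disjointness rests on this.\<close>

lemma inf_add_le:
  fixes a b c :: "'v::vector_lattice"
  assumes "0 \<le> a" "0 \<le> b" "0 \<le> c"
  shows "inf (a + b) c \<le> inf a c + inf b c"
proof -
  let ?z = "inf (a + b) c"
  have "?z - inf b c = sup (?z - b) (?z - c)"
    by (simp only: diff_inf_eq_sup add_sup_distrib_left) (simp only: diff_conv_add_uminus)
  moreover have "?z - b \<le> a" by (simp add: diff_le_eq)
  moreover have "?z - b \<le> c"
    using add_increasing2[OF assms(2) inf_le2[of "a + b" c]] by (simp only: diff_le_eq)
  moreover have "?z - c \<le> 0" by simp
  ultimately have "?z - inf b c \<le> inf a c"
    using order_trans[OF _ assms(1)] order_trans[OF _ assms(3)] by (auto simp only: le_inf_iff le_sup_iff)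
  then show ?thesis by (simp only: diff_le_eq)
qed

text \<open>A Lipschitz estimate for the supremum. It lets the supremum act on nets that are only
  locally eventually constant, and on their classes modulo null nets.\<close>

lemma sup_diff_le:
  fixes a b a' b' :: "'v::vector_lattice"
  shows "\<bar>sup a b - sup a' b'\<bar> \<le> \<bar>a - a'\<bar> + \<bar>b - b'\<bar>"
proof -
  have *: "sup x y - sup x' y' \<le> \<bar>x - x'\<bar> + \<bar>y - y'\<bar>" for x y x' y' :: 'v
  proof -
    have "x \<le> x' + \<bar>x - x'\<bar>" "y \<le> y' + \<bar>y - y'\<bar>"
      using abs_ge_self[of "x - x'"] abs_ge_self[of "y - y'"] by (simp_all add: algebra_simps)
    moreover have "x' + \<bar>x - x'\<bar> \<le> sup x' y' + (\<bar>x - x'\<bar> + \<bar>y - y'\<bar>)"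
      by (intro add_mono) auto
    moreover have "y' + \<bar>y - y'\<bar> \<le> sup x' y' + (\<bar>x - x'\<bar> + \<bar>y - y'\<bar>)"
      by (intro add_mono) auto
    ultimately have "sup x y \<le> sup x' y' + (\<bar>x - x'\<bar> + \<bar>y - y'\<bar>)"
      by (meson le_sup_iff order_trans)
    then show ?thesis by (simp add: algebra_simps)
  qed
  show ?thesis
    using *[of a b a' b'] *[of a' b' a b]
    by (intro abs_leI) (simp_all add: abs_minus_commute)
qed

lemma pprt_diff_le: "\<bar>pprt x - pprt y\<bar> \<le> \<bar>x - y\<bar>" for x :: "'v::vector_lattice"
  using sup_diff_le[of x 0 y 0] by (simp add: pprt_def)

lemma pprt_add_le: "pprt (x + y) \<le> pprt x + pprt y" for x :: "'v::vector_lattice"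
  by (simp add: pprt_def add_mono le_supI1 sup.coboundedI1)

section \<open>Disjointness\<close>

definition perp :: "'v::vector_lattice \<Rightarrow> 'v \<Rightarrow> bool" (infix "\<perp>" 50)
  where "x \<perp> y \<longleftrightarrow> inf \<bar>x\<bar> \<bar>y\<bar> = 0"

lemma perp_sym: "x \<perp> y \<Longrightarrow> y \<perp> x"
  by (simp add: perp_def inf_commute)

lemma perp_0 [simp]: "x \<perp> 0" "0 \<perp> x"
  by (simp_all add: perp_def inf_absorb1 inf_absorb2)

lemma perp_self [simp]: "x \<perp> x \<longleftrightarrow> x = 0"
  by (simp add: perp_def)

lemma perp_abs [simp]: "\<bar>x\<bar> \<perp> y \<longleftrightarrow> x \<perp> y" "x \<perp> \<bar>y\<bar> \<longleftrightarrow> x \<perp> y"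
  by (simp_all add: perp_def)

lemma perp_minus [simp]: "- x \<perp> y \<longleftrightarrow> x \<perp> y" "x \<perp> - y \<longleftrightarrow> x \<perp> y"
  by (simp_all add: perp_def)

lemma perp_pos: "0 \<le> x \<Longrightarrow> 0 \<le> y \<Longrightarrow> x \<perp> y \<longleftrightarrow> inf x y = 0"
  by (simp add: perp_def)

lemma perp_solid:
  assumes "x \<perp> y" "\<bar>z\<bar> \<le> \<bar>y\<bar>" shows "x \<perp> z"
proof -
  have "inf \<bar>x\<bar> \<bar>z\<bar> \<le> inf \<bar>x\<bar> \<bar>y\<bar>" using assms by (intro inf_mono) auto
  with assms show ?thesis by (simp add: perp_def antisym)
qed

lemma perp_mono: "x \<perp> y \<Longrightarrow> 0 \<le> z \<Longrightarrow> z \<le> y \<Longrightarrow> x \<perp> z"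
  by (erule perp_solid) (simp add: abs_of_nonneg order_trans[of 0 z y])

lemma perp_mono2: "y \<perp> x \<Longrightarrow> 0 \<le> z \<Longrightarrow> z \<le> y \<Longrightarrow> z \<perp> x"
  using perp_mono perp_sym by blast

lemma perp_add:
  assumes "x \<perp> y" "x \<perp> z" shows "x \<perp> y + z"
proof -
  have "inf \<bar>x\<bar> (\<bar>y\<bar> + \<bar>z\<bar>) \<le> inf \<bar>y\<bar> \<bar>x\<bar> + inf \<bar>z\<bar> \<bar>x\<bar>"
    using inf_add_le[of "\<bar>y\<bar>" "\<bar>z\<bar>" "\<bar>x\<bar>"] by (simp add: inf_commute)
  then have "inf \<bar>x\<bar> (\<bar>y\<bar> + \<bar>z\<bar>) = 0"
    using assms by (simp add: perp_def inf_commute antisym)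
  then have "x \<perp> \<bar>y\<bar> + \<bar>z\<bar>" by (simp add: perp_def)
  then show ?thesis by (rule perp_solid) (simp add: abs_triangle_ineq)
qed

lemma perp_diff: "x \<perp> y \<Longrightarrow> x \<perp> z \<Longrightarrow> x \<perp> y - z"
  using perp_add[of x y "- z"] by simp

lemma perp_scaleR:
  assumes "x \<perp> y" shows "x \<perp> c *\<^sub>R y"
proof -
  \<comment> \<open>\<open>d\<close> dominates both 1 and the modulus of \<open>c\<close>; hence the
    infimum of the moduli of \<open>x\<close> and of the multiple of \<open>y\<close> is at most
    \<open>d\<close> times the infimum of the moduli of \<open>x\<close> and
    \<open>y\<close>.\<close>
  define d where "d = max 1 \<bar>c\<bar>"
  have d: "0 \<le> d" "1 \<le> d" "\<bar>c\<bar> \<le> d" by (auto simp: d_def)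
  have "\<bar>x\<bar> \<le> d *\<^sub>R \<bar>x\<bar>" using scaleR_le_self[of "\<bar>x\<bar>" 1 d] d by simp
  moreover have "\<bar>c\<bar> *\<^sub>R \<bar>y\<bar> \<le> d *\<^sub>R \<bar>y\<bar>" using d by (simp add: scaleR_le_self)
  ultimately have "inf \<bar>x\<bar> (\<bar>c\<bar> *\<^sub>R \<bar>y\<bar>) \<le> d *\<^sub>R inf \<bar>x\<bar> \<bar>y\<bar>"
    by (simp add: scaleR_inf d inf_mono del: inf.bounded_iff)
  then show ?thesis
    using assms by (simp add: perp_def abs_scaleR antisym nonneg_scaleR)
qed

lemma perp_pprt_neg: "pprt x \<perp> pprt (- x)"
proof -
  have "pprt (- x) = pprt x - x" using pprt_diff[of x] by (simp add: algebra_simps)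
  then have "inf (pprt x) (pprt (- x)) = pprt x + inf 0 (- x)"
    by (simp add: add_inf_distrib_left)
  also have "\<dots> = 0"
    using inf_eq_neg_sup[of 0 "- x"] by (simp add: pprt_def sup_commute)
  finally have "inf (pprt x) (pprt (- x)) = 0" .
  then show ?thesis by (simp add: perp_pos)
qed

lemma abs_pprt_eq [simp]: "\<bar>pprt x\<bar> = pprt x" for x :: "'v::vector_lattice"
  by (rule abs_of_nonneg) simp

lemma perp_pprt: "x \<perp> y \<Longrightarrow> x \<perp> pprt y"
  by (erule perp_solid) (simp add: pprt_le_abs)

text \<open>The usual way below to see that the excess of one element over another vanishes: the
  excess is disjoint from something that dominates it.\<close>

lemma perp_le_zero:
  assumes "x \<perp> y" "0 \<le> x" "x \<le> y" shows "x = 0"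
proof -
  have "\<bar>x\<bar> = x" "\<bar>y\<bar> = y"
    using assms(2,3) by (meson abs_of_nonneg order_trans)+
  then have "x \<perp> x" using assms(3) by (intro perp_solid[OF assms(1)]) metis
  then show ?thesis by (simp only: perp_self)
qed

section \<open>Suprema\<close>

text \<open>A relation and not an operation, since suprema exist only under side conditions;
  existence and value are argued separately.\<close>

definition lub :: "'p::order set \<Rightarrow> 'p \<Rightarrow> bool"
  where "lub A s \<longleftrightarrow> (\<forall>a\<in>A. a \<le> s) \<and> (\<forall>b. (\<forall>a\<in>A. a \<le> b) \<longrightarrow> s \<le> b)"

lemma lubI: "(\<And>a. a \<in> A \<Longrightarrow> a \<le> s) \<Longrightarrow> (\<And>b. (\<And>a. a \<in> A \<Longrightarrow> a \<le> b) \<Longrightarrow> s \<le> b) \<Longrightarrow> lub A s"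
  by (simp add: lub_def)

lemma lub_ge: "lub A s \<Longrightarrow> a \<in> A \<Longrightarrow> a \<le> s"
  by (simp add: lub_def)

lemma lub_le: "lub A s \<Longrightarrow> (\<And>a. a \<in> A \<Longrightarrow> a \<le> b) \<Longrightarrow> s \<le> b"
  by (simp add: lub_def)

lemma lub_unique: "lub A s \<Longrightarrow> lub A t \<Longrightarrow> s = t"
  by (rule antisym) (auto simp: lub_def)

lemma lub_The: "lub A s \<Longrightarrow> (THE t. lub A t) = s"
  by (blast intro: lub_unique)

lemma lub_nonneg: "lub A s \<Longrightarrow> A \<noteq> {} \<Longrightarrow> (\<And>a. a \<in> A \<Longrightarrow> 0 \<le> a) \<Longrightarrow> 0 \<le> s"
  for s :: "'v::vector_lattice"
  by (meson ex_in_conv lub_ge order_trans)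

lemma lub_mono: "lub A s \<Longrightarrow> lub B t \<Longrightarrow> (\<And>a. a \<in> A \<Longrightarrow> \<exists>b\<in>B. a \<le> b) \<Longrightarrow> s \<le> t"
  by (meson lub_def order_trans)

lemma lub_shift:
  fixes s :: "'v::vector_lattice"
  assumes "lub A s" shows "lub ((\<lambda>a. a + x) ` A) (s + x)"
proof (rule lubI)
  fix a assume "a \<in> (\<lambda>a. a + x) ` A"
  then show "a \<le> s + x" using lub_ge[OF assms] by auto
next
  fix b assume "\<And>a. a \<in> (\<lambda>a. a + x) ` A \<Longrightarrow> a \<le> b"
  then have "s \<le> b - x" by (intro lub_le[OF assms]) (auto simp: le_diff_eq)
  then show "s + x \<le> b" by (simp add: le_diff_eq)
qed

lemma lub_scaleR:
  fixes s :: "'v::vector_lattice"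
  assumes "lub A s" "0 < c" shows "lub ((*\<^sub>R) c ` A) (c *\<^sub>R s)"
proof (rule lubI)
  fix a assume "a \<in> (*\<^sub>R) c ` A"
  then show "a \<le> c *\<^sub>R s" using lub_ge[OF assms(1)] assms(2) by (auto simp: scaleR_le_cancel)
next
  fix b assume *: "\<And>a. a \<in> (*\<^sub>R) c ` A \<Longrightarrow> a \<le> b"
  have c: "c *\<^sub>R inverse c *\<^sub>R b = b" using assms by simp
  have "s \<le> inverse c *\<^sub>R b"
  proof (rule lub_le[OF assms(1)])
    fix a assume "a \<in> A"
    then have "c *\<^sub>R a \<le> c *\<^sub>R inverse c *\<^sub>R b" using * c by auto
    then show "a \<le> inverse c *\<^sub>R b" using assms(2) scaleR_le_cancel by blast
  qed
  then have "c *\<^sub>R s \<le> c *\<^sub>R inverse c *\<^sub>R b" using assms(2) scaleR_le_cancel by blast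
  then show "c *\<^sub>R s \<le> b" using c by simp
qed

text \<open>Infinite distributivity. In \<open>inf x a = x + a - sup x a\<close> the subtracted term
  only grows when \<open>a\<close> is replaced by \<open>s\<close>, so a bound \<open>b\<close> of
  the infima yields the bound \<open>b + sup x s - x\<close> of \<open>A\<close>.\<close>

lemma lub_inf:
  fixes s :: "'v::vector_lattice"
  assumes "lub A s" shows "lub (inf x ` A) (inf x s)"
proof (rule lubI)
  fix a assume "a \<in> inf x ` A"
  then show "a \<le> inf x s" using lub_ge[OF assms] by (auto intro: le_infI2)
next
  fix b assume *: "\<And>a. a \<in> inf x ` A \<Longrightarrow> a \<le> b"
  have eq: "inf x a = x + a - sup x a" for a
    using add_eq_inf_sup[of x a] by (simp add: algebra_simps)
  have "s \<le> b + sup x s - x"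
  proof (rule lub_le[OF assms])
    fix a assume a: "a \<in> A"
    then have "x + a - sup x a \<le> b" using * eq by auto
    moreover have "sup x a \<le> sup x s" using lub_ge[OF assms a] by (rule sup_mono[OF order_refl])
    ultimately have "x + a \<le> b + sup x s"
      by (meson add_mono diff_le_eq order_trans order_refl)
    then show "a \<le> b + sup x s - x" by (simp add: le_diff_eq add.commute)
  qed
  then show "inf x s \<le> b" by (simp add: eq algebra_simps)
qed

lemma lub_sup:
  fixes s :: "'v::vector_lattice"
  assumes "lub A s" "A \<noteq> {}" shows "lub (sup x ` A) (sup x s)"
proof (rule lubI)
  fix a assume "a \<in> sup x ` A"
  then show "a \<le> sup x s" using lub_ge[OF assms(1)] by (auto intro: sup_mono simp del: le_sup_iff)
next
  fix b assume *: "\<And>a. a \<in> sup x ` A \<Longrightarrow> a \<le> b"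
  have b: "x \<le> b \<and> a \<le> b" if "a \<in> A" for a
    using *[of "sup x a"] that by simp
  then have "s \<le> b" by (intro lub_le[OF assms(1)]) simp
  moreover have "x \<le> b" using assms(2) b by blast
  ultimately show "sup x s \<le> b" by simp
qed

lemma lub_perp:
  fixes s :: "'v::vector_lattice"
  assumes "lub A s" "A \<noteq> {}" "\<And>a. a \<in> A \<Longrightarrow> 0 \<le> a" "\<And>a. a \<in> A \<Longrightarrow> x \<perp> a"
  shows "x \<perp> s"
proof -
  have "0 \<le> s" using assms lub_nonneg by blast
  have "inf \<bar>x\<bar> s \<le> 0"
    by (rule lub_le[OF lub_inf[OF assms(1)]]) (use assms in \<open>auto simp: perp_def\<close>)
  then show ?thesis using \<open>0 \<le> s\<close> by (simp add: perp_def antisym)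
qed

text \<open>Disjointness of \<open>x\<close> from \<open>pprt (a - y)\<close> expresses that
  \<open>a \<le> y\<close> holds on the band of \<open>x\<close>; such local upper bounds pass to
  the supremum.\<close>

lemma lub_pprt_perp:
  fixes s :: "'v::vector_lattice"
  assumes "lub A s" "A \<noteq> {}" "\<And>a. a \<in> A \<Longrightarrow> x \<perp> pprt (a - y)"
  shows "x \<perp> pprt (s - y)"
proof -
  have "lub (sup 0 ` (\<lambda>a. a + - y) ` A) (sup 0 (s + - y))"
    using assms by (intro lub_sup lub_shift) auto
  then show ?thesis
    unfolding pprt_def sup_commute[of _ 0] add_uminus_conv_diff
    by (rule lub_perp) (use assms in \<open>auto simp: pprt_def sup_commute\<close>)
qed

lemma lub_plus:
  fixes s :: "'v::vector_lattice"
  assumes "lub A s" "lub B t" shows "lub {a + b |a b. a \<in> A \<and> b \<in> B} (s + t)"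
proof (rule lubI)
  fix c assume "c \<in> {a + b |a b. a \<in> A \<and> b \<in> B}"
  then show "c \<le> s + t" using lub_ge assms by (fastforce intro: add_mono)
next
  fix c assume *: "\<And>x. x \<in> {a + b |a b. a \<in> A \<and> b \<in> B} \<Longrightarrow> x \<le> c"
  have "s \<le> c - t"
  proof (rule lub_le[OF assms(1)])
    fix a assume a: "a \<in> A"
    have "t \<le> c - a"
    proof (rule lub_le[OF assms(2)])
      fix b assume "b \<in> B"
      then have "a + b \<le> c" using a by (intro *) blast
      then show "b \<le> c - a" by (simp only: le_diff_eq add.commute)
    qed
    then show "a \<le> c - t" by (simp only: le_diff_eq add.commute)
  qed
  then show "s + t \<le> c" by (simp add: le_diff_eq)
qed

section \<open>Dedekind completeness, the Archimedean property and band projections\<close>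

class dc_vector_lattice = vector_lattice +
  assumes dedekind_complete: "A \<noteq> {} \<Longrightarrow> (\<And>a. a \<in> A \<Longrightarrow> a \<le> b) \<Longrightarrow>
    \<exists>s. (\<forall>a\<in>A. a \<le> s) \<and> (\<forall>b. (\<forall>a\<in>A. a \<le> b) \<longrightarrow> s \<le> b)"

lemma lub_exists: "A \<noteq> {} \<Longrightarrow> (\<And>a. a \<in> A \<Longrightarrow> a \<le> b) \<Longrightarrow> \<exists>s. lub A s"
  for b :: "'v::dc_vector_lattice"
  unfolding lub_def by (rule dedekind_complete)

lemma archimedean:
  fixes g :: "'v::dc_vector_lattice"
  assumes "0 \<le> g" "\<And>n. real n *\<^sub>R g \<le> b" shows "g = 0"
proof -
  obtain s where s: "lub (range (\<lambda>n. real n *\<^sub>R g)) s"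
    using lub_exists[of "range (\<lambda>n. real n *\<^sub>R g)" b] assms(2) by blast
  \<comment> \<open>Along with \<open>s\<close>, also \<open>s - g\<close> bounds all multiples of
    \<open>g\<close>, because the next multiple is still below \<open>s\<close>.\<close>
  have "s \<le> s - g"
  proof (rule lub_le[OF s])
    fix a assume "a \<in> range (\<lambda>n. real n *\<^sub>R g)"
    then obtain n where a: "a = real n *\<^sub>R g" by auto
    have "real (Suc n) *\<^sub>R g \<le> s" by (rule lub_ge[OF s]) (rule rangeI)
    then show "a \<le> s - g" by (simp add: a algebra_simps)
  qed
  then show ?thesis using assms(1) by (simp add: antisym le_diff_eq)
qed

text \<open>\<open>p\<close> is the component of \<open>x\<close> in the band generated by
  \<open>h\<close>. The infimum \<open>?r\<close> of \<open>x - p\<close> and \<open>h\<close> can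
  be added to the \<open>n\<close>-th truncation without leaving the one of index
  \<open>Suc n\<close>, hence \<open>p \<le> p - ?r\<close>.\<close>

lemma band_projection_exists:
  fixes x :: "'v::dc_vector_lattice"
  assumes "0 \<le> x" "0 \<le> h"
  obtains p where "0 \<le> p" "p \<le> x" "lub (range (\<lambda>n. inf x (real n *\<^sub>R h))) p" "x - p \<perp> h"
proof -
  let ?A = "range (\<lambda>n. inf x (real n *\<^sub>R h))"
  have "\<exists>p. lub ?A p" by (rule lub_exists[of _ x]) auto
  then obtain p where p: "lub ?A p" ..
  have "inf x (real 0 *\<^sub>R h) \<le> p" by (rule lub_ge[OF p]) (rule rangeI)
  then have p0: "0 \<le> p" using assms by (simp add: inf_absorb2)
  have px: "p \<le> x" by (rule lub_le[OF p]) auto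
  let ?r = "inf (x - p) h"
  have "p \<le> p - ?r"
  proof (rule lub_le[OF p])
    fix a assume "a \<in> ?A"
    then obtain n where a: "a = inf x (real n *\<^sub>R h)" by auto
    have "a \<le> p" using a lub_ge[OF p] by auto
    then have "a + ?r \<le> p + (x - p)" by (intro add_mono) auto
    moreover have "a + ?r \<le> real n *\<^sub>R h + h" unfolding a by (intro add_mono) auto
    ultimately have "a + ?r \<le> inf x (real (Suc n) *\<^sub>R h)" by (simp add: algebra_simps)
    also have "\<dots> \<le> p" by (rule lub_ge[OF p]) (rule rangeI)
    finally show "a \<le> p - ?r" by (simp add: le_diff_eq)
  qed
  then have "?r \<le> 0" by simp
  then have "?r = 0" using px assms by (intro antisym) auto
  then have "x - p \<perp> h" using px assms by (simp add: perp_pos)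
  then show thesis using that p p0 px by blast
qed

section \<open>Ideals and extension of positive maps\<close>

definition order_ideal :: "'v::vector_lattice set \<Rightarrow> bool"
  where "order_ideal S \<longleftrightarrow> 0 \<in> S \<and> (\<forall>x\<in>S. \<forall>y\<in>S. x + y \<in> S) \<and> (\<forall>c. \<forall>x\<in>S. c *\<^sub>R x \<in> S) \<and>
    (\<forall>x. \<forall>y\<in>S. \<bar>x\<bar> \<le> \<bar>y\<bar> \<longrightarrow> x \<in> S)"

context
  fixes S :: "'v::vector_lattice set"
  assumes S: "order_ideal S"
begin

lemma ideal_0: "0 \<in> S" using S by (simp add: order_ideal_def)
lemma ideal_add: "x \<in> S \<Longrightarrow> y \<in> S \<Longrightarrow> x + y \<in> S" using S by (simp add: order_ideal_def)
lemma ideal_scaleR: "x \<in> S \<Longrightarrow> c *\<^sub>R x \<in> S" using S by (simp add: order_ideal_def)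
lemma ideal_solid: "y \<in> S \<Longrightarrow> \<bar>x\<bar> \<le> \<bar>y\<bar> \<Longrightarrow> x \<in> S" using S unfolding order_ideal_def by blast
lemma ideal_minus: "x \<in> S \<Longrightarrow> - x \<in> S" using ideal_scaleR[of x "-1"] by simp
lemma ideal_diff: "x \<in> S \<Longrightarrow> y \<in> S \<Longrightarrow> x - y \<in> S"
  using ideal_add[of x "- y"] ideal_minus[of y] by simp
lemma ideal_abs: "x \<in> S \<Longrightarrow> \<bar>x\<bar> \<in> S" by (erule ideal_solid) simp
lemma ideal_pprt: "x \<in> S \<Longrightarrow> pprt x \<in> S" by (erule ideal_solid) (simp add: pprt_le_abs)
lemma ideal_le:
  assumes "y \<in> S" "0 \<le> x" "x \<le> y" shows "x \<in> S"
proof (rule ideal_solid[OF assms(1)])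
  have "0 \<le> y" using assms(2,3) by (rule order_trans)
  then show "\<bar>x\<bar> \<le> \<bar>y\<bar>" using assms by simp
qed

lemma ideal_abs_iff: "\<bar>x\<bar> \<in> S \<longleftrightarrow> x \<in> S" using ideal_abs[of x] ideal_solid[of "\<bar>x\<bar>" x, simplified] by auto
lemma ideal_sup: assumes "x \<in> S" "y \<in> S" shows "sup x y \<in> S"
proof -
  have "sup x y = pprt (x - y) + y" by (simp only: pprt_def add_sup_distrib_right) simp
  then show ?thesis using assms by (simp add: ideal_add ideal_pprt ideal_diff)
qed

lemma ideal_between:
  assumes "x \<in> S" "y \<in> S" "x \<le> z" "z \<le> y" shows "z \<in> S"
proof -
  have "z - x \<in> S" by (rule ideal_le[OF ideal_diff[OF assms(2,1)]]) (use assms in auto)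
  from ideal_add[OF this assms(1)] show ?thesis by simp
qed

end

text \<open>Density is relative to \<open>S\<close>, because the spaces in question are ideals of a
  larger type.\<close>

definition order_dense_in :: "'v::vector_lattice set \<Rightarrow> 'v set \<Rightarrow> bool"
  where "order_dense_in D S \<longleftrightarrow> (\<forall>f\<in>S. 0 < f \<longrightarrow> (\<exists>g\<in>D. 0 < g \<and> g \<le> f))"

definition below :: "'v::vector_lattice set \<Rightarrow> 'v \<Rightarrow> 'v set"
  where "below D v = {x \<in> D. 0 \<le> x \<and> x \<le> v}"

definition dir :: "'p::order set \<Rightarrow> bool"
  where "dir A \<longleftrightarrow> A \<noteq> {} \<and> (\<forall>x\<in>A. \<forall>y\<in>A. \<exists>z\<in>A. x \<le> z \<and> y \<le> z)"

lemma lub_dir_nonneg: "lub A s \<Longrightarrow> dir A \<Longrightarrow> (\<And>a. a \<in> A \<Longrightarrow> 0 \<le> a) \<Longrightarrow> 0 \<le> s"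
  for s :: "'v::vector_lattice"
  unfolding dir_def by (elim conjE) (rule lub_nonneg)

lemma dir_image_mono:
  "dir A \<Longrightarrow> (\<And>x y. x \<in> A \<Longrightarrow> y \<in> A \<Longrightarrow> x \<le> y \<Longrightarrow> f x \<le> f y) \<Longrightarrow> dir (f ` A)"
  unfolding dir_def by (auto, meson)

text \<open>An upper bound \<open>b\<close> that is not above \<open>v\<close> leaves room for some
  \<open>d > 0\<close> in \<open>D\<close> below \<open>v - inf v b\<close>. All of
  \<open>below D v\<close> lies under \<open>inf v b\<close>, so adding \<open>d\<close> never
  leaves \<open>below D v\<close>; then every multiple of \<open>d\<close> is below
  \<open>v\<close>, against the Archimedean property.\<close>

lemma order_dense_lub:
  fixes v :: "'v::dc_vector_lattice"
  assumes D: "0 \<in> D" "\<And>x y. x \<in> D \<Longrightarrow> y \<in> D \<Longrightarrow> x + y \<in> D"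
    and S: "order_ideal S" and dense: "order_dense_in D S" and v: "v \<in> S" "0 \<le> v"
  shows "lub (below D v) v"
proof (rule lubI)
  fix b assume b: "\<And>x. x \<in> below D v \<Longrightarrow> x \<le> b"
  have "0 \<le> b" using b[of 0] D v by (simp add: below_def)
  let ?z = "inf v b"
  have xz: "x \<le> ?z" if "x \<in> below D v" for x using b[OF that] that by (simp add: below_def)
  have "\<not> 0 < v - ?z"
  proof
    assume pos: "0 < v - ?z"
    have "v - ?z \<in> S" using v \<open>0 \<le> b\<close> by (intro ideal_le[OF S v(1)]) auto
    then obtain d where d: "d \<in> D" "0 < d" "d \<le> v - ?z"
      using dense pos by (auto simp: order_dense_in_def)
    have "real n *\<^sub>R d \<in> below D v" for n
    proof (induction n)
      case 0 then show ?case using D v by (simp add: below_def)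
    next
      case (Suc n)
      have "real n *\<^sub>R d + d \<le> ?z + (v - ?z)" using xz[OF Suc] d(3) by (rule add_mono)
      moreover have "real (Suc n) *\<^sub>R d = real n *\<^sub>R d + d" by (simp add: algebra_simps)
      ultimately show ?case using Suc d D by (simp add: below_def)
    qed
    then have "d = 0" using d by (intro archimedean[of d v]) (auto simp: below_def)
    then show False using d by simp
  qed
  moreover have "0 \<le> v - ?z" by simp
  ultimately have "v - ?z = 0" by (simp only: order_le_less) auto
  then have "v = ?z" by simp
  then show "v \<le> b" by (metis inf.cobounded2)
qed (simp add: below_def)

lemma dir_below:
  assumes "0 \<in> D" "0 \<le> v" "\<And>x y. x \<in> D \<Longrightarrow> y \<in> D \<Longrightarrow> sup x y \<in> D"
  shows "dir (below D v)"
  unfolding dir_def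
proof (intro conjI ballI)
  show "below D v \<noteq> {}" using assms by (auto simp: below_def)
  fix x y assume "x \<in> below D v" "y \<in> below D v"
  then show "\<exists>z\<in>below D v. x \<le> z \<and> y \<le> z"
    using assms by (intro bexI[of _ "sup x y"]) (auto simp: below_def intro: le_supI1)
qed

text \<open>For \<open>0 \<le> x \<le> y\<close> with \<open>y\<close> in \<open>D\<close>, the
  supremum \<open>s\<close> of \<open>below D x\<close> formed inside \<open>D\<close> must be
  \<open>x\<close>: otherwise some \<open>d > 0\<close> of \<open>D\<close> fits under
  \<open>s - x\<close>, and \<open>s - d\<close> is a smaller upper bound in \<open>D\<close>. This
  turns images of Dedekind complete spaces into ideals of the ambient type.\<close>

lemma order_dense_complete_ideal:
  fixes D :: "'v::dc_vector_lattice set"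
  assumes D: "0 \<in> D" "\<And>x y. x \<in> D \<Longrightarrow> y \<in> D \<Longrightarrow> x + y \<in> D" "\<And>c x. x \<in> D \<Longrightarrow> c *\<^sub>R x \<in> D"
      "\<And>x. x \<in> D \<Longrightarrow> \<bar>x\<bar> \<in> D"
    and S: "order_ideal S" "D \<subseteq> S" and dense: "order_dense_in D S"
    and dc: "\<And>A b. A \<subseteq> D \<Longrightarrow> A \<noteq> {} \<Longrightarrow> b \<in> D \<Longrightarrow> (\<And>a. a \<in> A \<Longrightarrow> a \<le> b) \<Longrightarrow>
      \<exists>s\<in>D. (\<forall>a\<in>A. a \<le> s) \<and> (\<forall>c\<in>D. (\<forall>a\<in>A. a \<le> c) \<longrightarrow> s \<le> c)"
  shows "order_ideal D"
proof -
  have sub: "x - y \<in> D" if "x \<in> D" "y \<in> D" for x y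
    using D(2)[OF that(1) D(3)[OF that(2), of "-1"]] by simp
  have key: "x \<in> D" if x: "0 \<le> x" "x \<le> y" and y: "y \<in> D" for x y
  proof -
    have xS: "x \<in> S" using ideal_le[OF S(1)] S(2) x y by blast
    have lx: "lub (below D x) x" by (rule order_dense_lub[OF D(1,2) S(1) dense xS x(1)])
    have "\<exists>s\<in>D. (\<forall>a\<in>below D x. a \<le> s) \<and> (\<forall>c\<in>D. (\<forall>a\<in>below D x. a \<le> c) \<longrightarrow> s \<le> c)"
      using D(1) x y by (intro dc[of _ y]) (auto simp: below_def)
    then obtain s where s: "s \<in> D" "\<forall>a\<in>below D x. a \<le> s"
      "\<And>c. c \<in> D \<Longrightarrow> (\<forall>a\<in>below D x. a \<le> c) \<Longrightarrow> s \<le> c" by blast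
    have xs: "x \<le> s" using s(2) by (intro lub_le[OF lx]) blast
    have "s = x"
    proof (rule ccontr)
      assume "s \<noteq> x"
      then have "0 < s - x" using xs by simp
      moreover have "s - x \<in> S" using s xS S by (meson ideal_diff subsetD)
      ultimately obtain d where d: "d \<in> D" "0 < d" "d \<le> s - x"
        using dense by (auto simp: order_dense_in_def)
      have "s \<le> s - d"
      proof (rule s(3))
        show "s - d \<in> D" using s d sub by blast
        have "x \<le> s - d" using d(3) by (simp add: le_diff_eq add.commute)
        then show "\<forall>a\<in>below D x. a \<le> s - d" by (auto simp: below_def intro: order_trans)
      qed
      then show False using d(2) by simp
    qed
    then show ?thesis using s by simp
  qed
  show ?thesis
    unfolding order_ideal_def
  proof (intro conjI ballI allI impI)
    fix x y assume y: "y \<in> D" and le: "\<bar>x\<bar> \<le> \<bar>y\<bar>"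
    have "pprt x \<le> \<bar>y\<bar>" "pprt (- x) \<le> \<bar>y\<bar>"
      using order_trans[OF pprt_le_abs[of x] le] order_trans[OF pprt_le_abs[of "- x"]] le by auto
    then have "pprt x \<in> D" "pprt (- x) \<in> D" using key D(4)[OF y] zero_le_pprt by blast+
    then show "x \<in> D" using sub pprt_diff[of x] by metis
  qed (use D in auto)
qed

section \<open>Positive maps on an ideal and their extension to a larger one\<close>

definition positive_on :: "'v::vector_lattice set \<Rightarrow> ('v \<Rightarrow> 'w::vector_lattice) \<Rightarrow> bool"
  where "positive_on F t \<longleftrightarrow> (\<forall>x\<in>F. \<forall>y\<in>F. t (x + y) = t x + t y) \<and>
    (\<forall>c. \<forall>x\<in>F. t (c *\<^sub>R x) = c *\<^sub>R t x) \<and> (\<forall>x\<in>F. 0 \<le> x \<longrightarrow> 0 \<le> t x)"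

lemma positive_onD:
  assumes "positive_on F t"
  shows "x \<in> F \<Longrightarrow> y \<in> F \<Longrightarrow> t (x + y) = t x + t y" "x \<in> F \<Longrightarrow> t (c *\<^sub>R x) = c *\<^sub>R t x"
    "x \<in> F \<Longrightarrow> 0 \<le> x \<Longrightarrow> 0 \<le> t x"
  using assms by (simp_all add: positive_on_def)

lemma positive_on_diff:
  assumes "order_ideal F" "positive_on F t" "x \<in> F" "y \<in> F" shows "t (x - y) = t x - t y"
  using positive_onD(1)[OF assms(2,3) ideal_minus[OF assms(1,4)]]
    positive_onD(2)[OF assms(2,4), of "-1"] by simp

lemma positive_on_0: "positive_on F t \<Longrightarrow> x \<in> F \<Longrightarrow> t 0 = 0"
  using positive_onD(2)[of F t x 0] by simp

lemma positive_on_mono: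
  assumes "order_ideal F" "positive_on F t" "x \<in> F" "y \<in> F" "x \<le> y" shows "t x \<le> t y"
  using positive_onD(3)[OF assms(2) ideal_diff[OF assms(1,4,3)]]
    positive_on_diff[OF assms(1,2,4,3)] assms(5) by simp

text \<open>Order continuity, in terms of upward directed families of positive elements.\<close>

definition normal_on :: "'v::vector_lattice set \<Rightarrow> ('v \<Rightarrow> 'w::vector_lattice) \<Rightarrow> bool"
  where "normal_on F t \<longleftrightarrow> (\<forall>A s. A \<subseteq> F \<and> dir A \<and> (\<forall>a\<in>A. 0 \<le> a) \<and> s \<in> F \<and> lub A s \<longrightarrow> lub (t ` A) (t s))"

lemma normal_onD:
  "normal_on F t \<Longrightarrow> A \<subseteq> F \<Longrightarrow> dir A \<Longrightarrow> (\<And>a. a \<in> A \<Longrightarrow> 0 \<le> a) \<Longrightarrow> s \<in> F \<Longrightarrow> lub A s \<Longrightarrow> lub (t ` A) (t s)"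
  unfolding normal_on_def by blast

text \<open>The extension takes at \<open>v \<ge> 0\<close> the supremum of the values of
  \<open>t\<close> below \<open>v\<close>. It serves twice: for the conditional expectation on the
  completion, and for the map between two completions that continues the identification of the two
  copies of \<open>E\<close>.\<close>

locale positive_extension =
  fixes F S :: "'v::dc_vector_lattice set" and t :: "'v \<Rightarrow> 'w::dc_vector_lattice"
  assumes F: "order_ideal F" and S: "order_ideal S" and FS: "F \<subseteq> S" and t: "positive_on F t"
    and bounded: "\<And>v. v \<in> S \<Longrightarrow> 0 \<le> v \<Longrightarrow> \<exists>b. \<forall>x\<in>below F v. t x \<le> b"
begin

definition ext :: "'v \<Rightarrow> 'w"
  where "ext v = (THE s. lub (t ` below F v) s)"

definition extl :: "'v \<Rightarrow> 'w"
  where "extl v = ext (pprt v) - ext (pprt (- v))"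

lemma zero_below: "0 \<le> v \<Longrightarrow> 0 \<in> below F v"
  using ideal_0[OF F] by (simp add: below_def)

lemma t_0: "t 0 = 0"
  using positive_on_0[OF t ideal_0[OF F]] .

lemma ext_lub:
  assumes "v \<in> S" "0 \<le> v" shows "lub (t ` below F v) (ext v)"
proof -
  obtain b where "\<forall>x\<in>below F v. t x \<le> b" using bounded assms by blast
  then have "\<exists>s. lub (t ` below F v) s"
    using zero_below[OF assms(2)] by (intro lub_exists[of _ b]) auto
  then show ?thesis unfolding ext_def by (metis lub_The)
qed

lemma ext_ge: "v \<in> S \<Longrightarrow> x \<in> F \<Longrightarrow> 0 \<le> x \<Longrightarrow> x \<le> v \<Longrightarrow> t x \<le> ext v"
  using ext_lub[of v] lub_ge[of "t ` below F v" "ext v" "t x"] order_trans[of 0 x v]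
  by (auto simp: below_def)

lemma ext_nonneg: "v \<in> S \<Longrightarrow> 0 \<le> v \<Longrightarrow> 0 \<le> ext v"
  using ext_ge[of v 0] ideal_0[OF F] t_0 by simp

lemma ext_eq:
  assumes "v \<in> F" "0 \<le> v" shows "ext v = t v"
proof (rule lub_unique[OF ext_lub])
  show "lub (t ` below F v) (t v)"
  proof (rule lubI)
    fix a assume "a \<in> t ` below F v"
    then show "a \<le> t v" using assms positive_on_mono[OF F t] by (auto simp: below_def)
  next
    fix b assume "\<And>a. a \<in> t ` below F v \<Longrightarrow> a \<le> b"
    then show "t v \<le> b" using assms by (simp add: below_def)
  qed
qed (use assms FS in auto)

lemma ext_mono:
  assumes "v \<in> S" "w \<in> S" "0 \<le> v" "v \<le> w" shows "ext v \<le> ext w"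
proof (rule lub_le[OF ext_lub[OF assms(1,3)]])
  fix a assume "a \<in> t ` below F v"
  then show "a \<le> ext w" using assms ext_ge[of w] by (auto simp: below_def intro: order_trans)
qed

text \<open>Riesz decomposition: an element \<open>x\<close> of \<open>F\<close> below
  \<open>v + w\<close> splits into \<open>inf x v\<close> and a rest below \<open>w\<close>, and
  both parts stay in \<open>F\<close> because \<open>F\<close> is solid.\<close>

lemma ext_add:
  assumes v: "v \<in> S" "0 \<le> v" and w: "w \<in> S" "0 \<le> w"
  shows "ext (v + w) = ext v + ext w"
proof (rule antisym)
  have vw: "v + w \<in> S" "0 \<le> v + w" using v w ideal_add[OF S] by auto
  show "ext (v + w) \<le> ext v + ext w"
  proof (rule lub_le[OF ext_lub[OF vw]])
    fix a assume "a \<in> t ` below F (v + w)"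
    then obtain x where x: "a = t x" "x \<in> F" "0 \<le> x" "x \<le> v + w" by (auto simp: below_def)
    let ?y = "inf x v"
    have y: "?y \<in> F" "0 \<le> ?y" "?y \<le> v" using x v by (auto intro: ideal_le[OF F x(2)])
    have xy: "x - ?y \<in> F" "0 \<le> x - ?y" using y ideal_diff[OF F x(2)] by auto
    have "x - ?y = sup 0 (x - v)"
      by (simp add: diff_inf_eq_sup add_sup_distrib_left)
    also have "\<dots> \<le> w" using x w by (simp add: diff_le_eq add.commute)
    finally have xyw: "x - ?y \<le> w" .
    have "t ?y + t (x - ?y) \<le> ext v + ext w"
      using y xy xyw v w by (intro add_mono ext_ge) auto
    moreover have "t x = t ?y + t (x - ?y)"
      using positive_onD(1)[OF t y(1) xy(1)] by simp
    ultimately show "a \<le> ext v + ext w" using x by simp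
  qed
  show "ext v + ext w \<le> ext (v + w)"
  proof (rule lub_le[OF lub_plus[OF ext_lub[OF v] ext_lub[OF w]]])
    fix c assume "c \<in> {a + b |a b. a \<in> t ` below F v \<and> b \<in> t ` below F w}"
    then obtain x y where c: "c = t x + t y" and x: "x \<in> F" "0 \<le> x" "x \<le> v"
      and y: "y \<in> F" "0 \<le> y" "y \<le> w" by (auto simp: below_def)
    have "c = t (x + y)" using c positive_onD(1)[OF t x(1) y(1)] by simp
    also have "\<dots> \<le> ext (v + w)"
      using x y by (intro ext_ge vw ideal_add[OF F] add_mono) auto
    finally show "c \<le> ext (v + w)" .
  qed
qed

lemma below_scaleR:
  assumes c: "0 < c" shows "below F (c *\<^sub>R v) = (*\<^sub>R) c ` below F v"
proof (intro Set.set_eqI iffI)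
  fix x assume "x \<in> below F (c *\<^sub>R v)"
  then have x: "x \<in> F" "0 \<le> x" "x \<le> c *\<^sub>R v" by (auto simp: below_def)
  have eq: "x = c *\<^sub>R inverse c *\<^sub>R x" using c by simp
  then have "c *\<^sub>R inverse c *\<^sub>R x \<le> c *\<^sub>R v" using x by simp
  then have "inverse c *\<^sub>R x \<le> v" using c scaleR_le_cancel by blast
  moreover have "0 \<le> inverse c *\<^sub>R x" using c x by (intro nonneg_scaleR) auto
  ultimately have "inverse c *\<^sub>R x \<in> below F v" using x ideal_scaleR[OF F] by (auto simp: below_def)
  then show "x \<in> (*\<^sub>R) c ` below F v" using eq by blast
qed (use c in \<open>auto simp: below_def ideal_scaleR[OF F] scaleR_left_mono intro: nonneg_scaleR\<close>)

lemma ext_scaleR: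
  assumes v: "v \<in> S" "0 \<le> v" and "0 \<le> c" shows "ext (c *\<^sub>R v) = c *\<^sub>R ext v"
proof (cases "c = 0")
  case True
  then show ?thesis using ext_eq[OF ideal_0[OF F]] t_0 by simp
next
  case False
  then have c: "0 < c" using assms by simp
  have "t ` below F (c *\<^sub>R v) = (*\<^sub>R) c ` t ` below F v"
    unfolding below_scaleR[OF c] image_image
    by (rule image_cong) (auto simp: below_def positive_onD(2)[OF t])
  then have "lub (t ` below F (c *\<^sub>R v)) (c *\<^sub>R ext v)"
    using lub_scaleR[OF ext_lub[OF v] c] by simp
  then show ?thesis using ext_lub[of "c *\<^sub>R v"] ideal_scaleR[OF S v(1)] nonneg_scaleR[OF v(2) assms(3)]
    by (blast intro: lub_unique)
qed

lemma extl_pos: "v \<in> S \<Longrightarrow> 0 \<le> v \<Longrightarrow> extl v = ext v"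
  using ext_eq[OF ideal_0[OF F]] t_0 by (simp add: extl_def)

text \<open>The value does not depend on how an element is written as a difference of positive ones,
  since \<open>?p + b = a + ?n\<close> on the cone. Linearity of \<open>extl\<close> thereby becomes
  a computation with \<open>ext\<close>.\<close>

lemma extl_diff:
  assumes a: "a \<in> S" "0 \<le> a" and b: "b \<in> S" "0 \<le> b"
  shows "extl (a - b) = ext a - ext b"
proof -
  let ?p = "pprt (a - b)" and ?n = "pprt (b - a)"
  have pn: "?p \<in> S" "?n \<in> S" using a b ideal_pprt[OF S] ideal_diff[OF S] by auto
  have "?p + b = a + ?n" using pprt_diff[of "a - b"] by (simp add: algebra_simps)
  then have "ext ?p + ext b = ext a + ext ?n"
    using ext_add[OF pn(1) zero_le_pprt b] ext_add[OF a pn(2) zero_le_pprt] by simp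
  then show ?thesis by (simp add: extl_def algebra_simps)
qed

lemma extl_positive_on: "positive_on S extl"
  unfolding positive_on_def
proof (intro conjI ballI allI impI)
  fix x y assume x: "x \<in> S" and y: "y \<in> S"
  note [simp] = ideal_pprt[OF S] ideal_minus[OF S] ideal_add[OF S]
  have "x + y = (pprt x - pprt (- x)) + (pprt y - pprt (- y))"
    by (simp only: pprt_diff[symmetric])
  also have "\<dots> = (pprt x + pprt y) - (pprt (- x) + pprt (- y))"
    by (simp only: add_diff_add)
  finally have "extl (x + y) = extl ((pprt x + pprt y) - (pprt (- x) + pprt (- y)))"
    by (rule arg_cong)
  also have "\<dots> = ext (pprt x + pprt y) - ext (pprt (- x) + pprt (- y))"
    using x y by (intro extl_diff) auto
  also have "\<dots> = extl x + extl y"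
    using x y by (simp add: ext_add extl_def)
  finally show "extl (x + y) = extl x + extl y" .
next
  fix c x assume x: "x \<in> S"
  note [simp] = ideal_pprt[OF S] ideal_minus[OF S] ideal_scaleR[OF S]
  have nonneg: "extl (d *\<^sub>R a - d *\<^sub>R b) = d *\<^sub>R ext a - d *\<^sub>R ext b"
    if "0 \<le> d" "a \<in> S" "0 \<le> a" "b \<in> S" "0 \<le> b" for d a b
    using that by (subst extl_diff) (auto simp: ext_scaleR nonneg_scaleR)
  have xd: "x = pprt x - pprt (- x)" by (rule pprt_diff)
  show "extl (c *\<^sub>R x) = c *\<^sub>R extl x"
  proof (cases "0 \<le> c")
    case True
    have "extl (c *\<^sub>R x) = extl (c *\<^sub>R pprt x - c *\<^sub>R pprt (- x))"
      by (subst xd) (simp add: scaleR_diff_right)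
    then show ?thesis using nonneg[OF True, of "pprt x" "pprt (- x)"] x
      by (simp add: extl_def scaleR_diff_right)
  next
    case False
    have "extl (c *\<^sub>R x) = extl ((- c) *\<^sub>R pprt (- x) - (- c) *\<^sub>R pprt x)"
      by (subst xd) (simp add: scaleR_diff_right)
    then show ?thesis using nonneg[of "- c" "pprt (- x)" "pprt x"] x False
      by (simp add: extl_def scaleR_diff_right)
  qed
next
  fix x assume "x \<in> S" "0 \<le> x"
  then show "0 \<le> extl x" using extl_pos ext_nonneg by simp
qed

lemma extl_eq:
  assumes "v \<in> F" shows "extl v = t v"
proof -
  have *: "pprt v \<in> F" "pprt (- v) \<in> F" using assms ideal_pprt[OF F] ideal_minus[OF F] by auto
  then have "extl v = t (pprt v) - t (pprt (- v))" by (simp add: extl_def ext_eq)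
  also have "\<dots> = t (pprt v - pprt (- v))" using positive_on_diff[OF F t *] by simp
  finally show ?thesis using pprt_diff[of v] by metis
qed

text \<open>An element \<open>x\<close> of \<open>F\<close> below \<open>s\<close> is exhausted by
  the truncations \<open>inf x a\<close>, which lie in \<open>F\<close>. There the order continuity
  of \<open>t\<close> applies, and \<open>t (inf x a) \<le> ext a\<close>.\<close>

lemma ext_normal:
  assumes n: "normal_on F t" and A: "A \<subseteq> S" "dir A" "\<And>a. a \<in> A \<Longrightarrow> 0 \<le> a"
    and s: "s \<in> S" "lub A s"
  shows "lub (ext ` A) (ext s)"
proof (rule lubI)
  have s0: "0 \<le> s" using A s by (meson lub_dir_nonneg)
  fix a assume "a \<in> ext ` A"
  then show "a \<le> ext s" using A s lub_ge by (auto intro!: ext_mono)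
next
  have s0: "0 \<le> s" using A s by (meson lub_dir_nonneg)
  fix b assume b: "\<And>a. a \<in> ext ` A \<Longrightarrow> a \<le> b"
  show "ext s \<le> b"
  proof (rule lub_le[OF ext_lub[OF s(1) s0]])
    fix y assume "y \<in> t ` below F s"
    then obtain x where x: "y = t x" "x \<in> F" "0 \<le> x" "x \<le> s" by (auto simp: below_def)
    have inF: "inf x a \<in> F" if "a \<in> A" for a
      using A(3)[OF that] x by (intro ideal_le[OF F x(2)]) auto
    have "lub (inf x ` A) (inf x s)" by (rule lub_inf[OF s(2)])
    then have lx: "lub (inf x ` A) x" using x by (simp add: inf_absorb1)
    have "lub (t ` inf x ` A) (t x)"
    proof (rule normal_onD[OF n _ _ _ x(2) lx])
      show "inf x ` A \<subseteq> F" using inF by auto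
      show "dir (inf x ` A)" using A(2) by (rule dir_image_mono) (auto intro: le_infI2)
      show "0 \<le> a" if "a \<in> inf x ` A" for a using that A(3) x by auto
    qed
    then show "y \<le> b" unfolding x(1)
    proof (rule lub_le)
      fix z assume "z \<in> t ` inf x ` A"
      then obtain a where a: "a \<in> A" "z = t (inf x a)" by auto
      have "z \<le> ext a" unfolding a(2) using a A x inF by (intro ext_ge) auto
      also have "\<dots> \<le> b" using b a by auto
      finally show "z \<le> b" .
    qed
  qed
qed

lemma extl_normal:
  assumes "normal_on F t" shows "normal_on S extl"
  unfolding normal_on_def
proof (intro allI impI, elim conjE)
  fix A s assume A: "A \<subseteq> S" "dir A" "\<forall>a\<in>A. 0 \<le> a" and s: "s \<in> S" "lub A s"
  have s0: "0 \<le> s" using A s by (meson lub_dir_nonneg)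
  have "extl ` A = ext ` A" using A by (intro image_cong) (auto simp: extl_pos)
  then show "lub (extl ` A) (extl s)"
    using ext_normal[OF assms A(1,2) _ s] A(3) extl_pos[OF s(1) s0] by simp
qed

end

section \<open>Laterally complete ideals\<close>

text \<open>A bound in \<open>W\<close> suffices: in an ideal of a Dedekind complete type, the
  supremum of a nonempty bounded family of positive elements exists and lies below the bound, hence
  in \<open>W\<close>.\<close>

definition laterally_complete :: "'v::vector_lattice set \<Rightarrow> bool"
  where "laterally_complete W \<longleftrightarrow> (\<forall>A. A \<subseteq> W \<and> (\<forall>a\<in>A. 0 \<le> a) \<and> (\<forall>x\<in>A. \<forall>y\<in>A. x \<noteq> y \<longrightarrow> x \<perp> y)
    \<longrightarrow> (\<exists>b\<in>W. \<forall>a\<in>A. a \<le> b))"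

text \<open>The disjointness form of a weak order unit, which in the Dedekind complete case agrees
  with the form through the generated band.\<close>

definition weak_unit_in :: "'v::vector_lattice set \<Rightarrow> 'v \<Rightarrow> bool"
  where "weak_unit_in W e \<longleftrightarrow> e \<in> W \<and> 0 \<le> e \<and> (\<forall>x\<in>W. x \<perp> e \<longrightarrow> x = 0)"

lemma lub_perp_sub:
  fixes p :: "'v::vector_lattice"
  assumes "lub (range (\<lambda>k. inf x (real k *\<^sub>R h))) p" "0 \<le> x" "0 \<le> h" "y \<perp> h"
  shows "y \<perp> p"
proof (rule lub_perp[OF assms(1)])
  fix a assume "a \<in> range (\<lambda>k. inf x (real k *\<^sub>R h))"
  then obtain k where a: "a = inf x (real k *\<^sub>R h)" by auto
  have kh: "0 \<le> real k *\<^sub>R h" using assms(3) by (intro nonneg_scaleR) auto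
  show "0 \<le> a" using a assms(2) kh by simp
  show "y \<perp> a" unfolding a by (rule perp_mono[OF perp_scaleR[OF assms(4), of "real k"]]) (use assms(2) kh in auto)
qed simp

text \<open>\<open>s n\<close> is the supremum of the truncations at \<open>n e\<close>, and
  \<open>q n = n e - s n\<close> is what they miss. On the component \<open>c n\<close> of
  \<open>e\<close> in the band of \<open>q n\<close>, all of \<open>A\<close> lies below
  \<open>n e\<close>. The increments \<open>d n\<close> of the \<open>c n\<close> are disjoint, so
  the elements \<open>n d n\<close> have a common bound \<open>z\<close>, and \<open>z\<close>
  bounds \<open>A\<close> on every \<open>c n\<close>. The part of the excess of \<open>a\<close>
  over \<open>z\<close> that is below \<open>e\<close> is then disjoint from all \<open>q n\<close>;
  there the truncations are as large as possible, and \<open>tame\<close> forces this part to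
  vanish.\<close>

lemma laterally_complete_bounded:
  fixes W :: "'v::dc_vector_lattice set"
  assumes W: "order_ideal W" "laterally_complete W" and e: "weak_unit_in W e"
    and A: "A \<subseteq> W" "A \<noteq> {}" "\<And>a. a \<in> A \<Longrightarrow> 0 \<le> a"
    and tame: "\<And>g. g \<in> W \<Longrightarrow> 0 \<le> g \<Longrightarrow>
      (\<And>n b. (\<And>a. a \<in> A \<Longrightarrow> inf a (real n *\<^sub>R e) \<le> b) \<Longrightarrow> real n *\<^sub>R g \<le> b) \<Longrightarrow> g = 0"
  shows "\<exists>b\<in>W. \<forall>a\<in>A. a \<le> b"
proof -
  have eW: "e \<in> W" and e0: "0 \<le> e" and eu: "\<And>x. x \<in> W \<Longrightarrow> x \<perp> e \<Longrightarrow> x = 0"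
    using e by (auto simp: weak_unit_in_def)
  have "\<exists>s. lub ((\<lambda>a. inf a (real n *\<^sub>R e)) ` A) s" for n :: nat
    using A(2) by (intro lub_exists[of _ "real n *\<^sub>R e"]) auto
  then obtain s where s: "\<And>n::nat. lub ((\<lambda>a. inf a (real n *\<^sub>R e)) ` A) (s n)" by metis
  have ne0: "0 \<le> real n *\<^sub>R e" for n :: nat using e0 by (intro nonneg_scaleR) auto
  have s_ge: "inf a (real n *\<^sub>R e) \<le> s n" if "a \<in> A" for a n
    using that by (intro lub_ge[OF s]) auto
  have s_le: "s n \<le> real n *\<^sub>R e" for n by (rule lub_le[OF s]) auto
  have s0: "0 \<le> s n" for n
    using A(2,3) ne0[of n] by (intro lub_nonneg[OF s]) auto
  define q where "q n = real n *\<^sub>R e - s n" for n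
  have q0: "0 \<le> q n" for n using s_le by (simp add: q_def)
  have q_Suc: "q n \<le> q (Suc n)" for n
  proof -
    have "s (Suc n) \<le> s n + e"
    proof (rule lub_le[OF s], elim imageE)
      fix x a assume a: "a \<in> A" and x: "x = inf a (real (Suc n) *\<^sub>R e)"
      have "x \<le> inf (a + e) (real n *\<^sub>R e + e)"
        unfolding x using e0 by (intro inf_mono) (auto simp: algebra_simps)
      also have "\<dots> = inf a (real n *\<^sub>R e) + e" by (simp only: add_inf_distrib_right)
      also have "\<dots> \<le> s n + e" using s_ge[OF a] by simp
      finally show "x \<le> s n + e" .
    qed
    then show ?thesis by (simp add: q_def algebra_simps)
  qed
  have "\<exists>p. 0 \<le> p \<and> p \<le> e \<and> lub (range (\<lambda>k. inf e (real k *\<^sub>R q n))) p \<and> e - p \<perp> q n" for n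
    using band_projection_exists[OF e0 q0] by metis
  then obtain c where c: "\<And>n. 0 \<le> c n" "\<And>n. c n \<le> e"
    "\<And>n. lub (range (\<lambda>k. inf e (real k *\<^sub>R q n))) (c n)" "\<And>n. e - c n \<perp> q n" by metis
  have c_perp: "x \<perp> q n \<Longrightarrow> x \<perp> c n" for x n
    by (rule lub_perp_sub[OF c(3) e0 q0])
  have c_Suc: "c n \<le> c (Suc n)" for n
  proof (rule lub_mono[OF c(3) c(3)])
    fix a assume "a \<in> range (\<lambda>k. inf e (real k *\<^sub>R q n))"
    then obtain k where "a = inf e (real k *\<^sub>R q n)" by auto
    moreover have "real k *\<^sub>R q n \<le> real k *\<^sub>R q (Suc n)" by (simp add: q_Suc scaleR_left_mono)
    ultimately have "a \<le> inf e (real k *\<^sub>R q (Suc n))" using inf_mono[OF order_refl] by blast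
    then show "\<exists>b\<in>range (\<lambda>k. inf e (real k *\<^sub>R q (Suc n))). a \<le> b" by blast
  qed
  have c_mono: "m \<le> n \<Longrightarrow> c m \<le> c n" for m n by (rule lift_Suc_mono_le[of c, OF c_Suc])
  \<comment> \<open>The shifted sequence, with value 0 at index 0, makes \<open>d 0 = c 0\<close>,
    so the \<open>c n\<close> are the partial sums of the \<open>d n\<close>.\<close>
  define c' where "c' n = (case n of 0 \<Rightarrow> 0 | Suc m \<Rightarrow> c m)" for n
  have c'0: "0 \<le> c' n" for n using c(1) by (simp add: c'_def split: nat.split)
  have c'_le: "c' n \<le> c n" for n using c(1) c_Suc by (simp add: c'_def split: nat.split)
  have c_perp': "e - c n \<perp> c n" for n using c(4) by (rule c_perp)
  have c'_perp: "e - c' n \<perp> c' n" for n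
    using c_perp' by (simp add: c'_def split: nat.split)
  define d where "d n = c n - c' n" for n
  have d0: "0 \<le> d n" for n using c'_le by (simp add: d_def)
  have d_le: "d n \<le> c n" for n using c'0 by (simp add: d_def)
  have d_le_e: "d n \<le> e" for n using d_le c(2) order_trans by blast
  have dW: "d n \<in> W" for n by (rule ideal_le[OF W(1) eW d0 d_le_e])
  have d_perp_c': "d n \<perp> c' n" for n
    using c(2) by (intro perp_mono2[OF c'_perp d0]) (simp add: d_def)
  have d_perp: "d n \<perp> d m" if mn: "m < n" for m n
  proof -
    obtain k where k: "n = Suc k" using mn by (cases n) auto
    have "d m \<le> c' n" using order_trans[OF d_le c_mono[of m k]] mn by (simp add: k c'_def)
    then show ?thesis by (rule perp_mono[OF d_perp_c' d0])
  qed
  have d_perp2: "d n \<perp> d m" if "m \<noteq> n" for m n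
    using d_perp that perp_sym by (metis nat_neq_iff)
  have d_perp_ed: "d n \<perp> e - d n" for n
  proof -
    have "d n \<perp> e - c n" by (rule perp_sym, rule perp_mono[OF c_perp' d0 d_le])
    from perp_add[OF this d_perp_c'] show ?thesis by (simp add: d_def algebra_simps)
  qed
  \<comment> \<open>The bound wanted on the component \<open>d n\<close> is \<open>n e\<close>,
    which coincides there with \<open>n d n\<close>. Unequal members of the family have unequal
    indices and are disjoint.\<close>
  let ?D = "range (\<lambda>n. real n *\<^sub>R d n)"
  have "\<exists>b\<in>W. \<forall>a\<in>?D. a \<le> b"
  proof (rule W(2)[unfolded laterally_complete_def, rule_format], intro conjI)
    show "?D \<subseteq> W" using ideal_scaleR[OF W(1) dW] by auto
    show "\<forall>a\<in>?D. 0 \<le> a" using d0 by (auto intro: nonneg_scaleR)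
    show "\<forall>x\<in>?D. \<forall>y\<in>?D. x \<noteq> y \<longrightarrow> x \<perp> y"
    proof (intro ballI impI)
      fix x y assume "x \<in> ?D" "y \<in> ?D" "x \<noteq> y"
      then obtain n m where x: "x = real n *\<^sub>R d n" and y: "y = real m *\<^sub>R d m" and "m \<noteq> n" by auto
      then show "x \<perp> y" unfolding x y using d_perp2 perp_scaleR perp_sym by metis
    qed
  qed
  then obtain z where z: "z \<in> W" "\<And>n. real n *\<^sub>R d n \<le> z" by blast
  have "a \<le> z" if a: "a \<in> A" for a
  proof -
    let ?y = "pprt (a - z)"
    have aW: "a \<in> W" using a A by blast
    have yW: "?y \<in> W" using aW z by (intro ideal_pprt[OF W(1)] ideal_diff[OF W(1)])
    have y_d: "?y \<perp> d n" for n
    proof -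
      have q_le: "q n \<le> pprt (real n *\<^sub>R e - a)"
      proof -
        have "q n \<le> real n *\<^sub>R e - inf a (real n *\<^sub>R e)" using s_ge[OF a] by (simp add: q_def)
        also have "\<dots> = pprt (real n *\<^sub>R e - a)"
          by (simp only: diff_inf_eq_sup add_sup_distrib_left pprt_def) simp
        finally show ?thesis .
      qed
      have "pprt (a - real n *\<^sub>R e) \<perp> pprt (real n *\<^sub>R e - a)"
        using perp_pprt_neg[of "a - real n *\<^sub>R e"] by simp
      then have "pprt (a - real n *\<^sub>R e) \<perp> q n" by (rule perp_mono[OF _ q0 q_le])
      then have "pprt (a - real n *\<^sub>R e) \<perp> c n" by (rule c_perp)
      then have 1: "d n \<perp> pprt (a - real n *\<^sub>R e)"
        using perp_mono[OF _ d0 d_le] perp_sym by blast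
      have 2: "d n \<perp> real n *\<^sub>R (e - d n)" by (rule perp_scaleR[OF d_perp_ed])
      \<comment> \<open>As \<open>n d n \<le> z\<close>, the excess over \<open>z\<close> is at most
        that over \<open>n d n\<close>, which splits into the excess over \<open>n e\<close> and
        \<open>n (e - d n)\<close>; \<open>d n\<close> is disjoint from the positive parts of
        both.\<close>
      have "?y \<le> pprt ((a - real n *\<^sub>R e) + real n *\<^sub>R (e - d n))"
        using z(2)[of n] by (intro pprt_mono) (simp add: algebra_simps)
      also have "\<dots> \<le> pprt (a - real n *\<^sub>R e) + pprt (real n *\<^sub>R (e - d n))" by (rule pprt_add_le)
      finally show ?thesis
        using perp_mono[OF perp_add[OF 1 perp_pprt[OF 2]] zero_le_pprt] perp_sym by blast
    qed
    have y_c: "?y \<perp> c n" for n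
    proof (induction n)
      case 0 show ?case using y_d[of 0] by (simp add: d_def c'_def)
    next
      case (Suc n)
      have "c (Suc n) = d (Suc n) + c n" by (simp add: d_def c'_def)
      then show ?case using perp_add[OF y_d Suc] by simp
    qed
    let ?g = "inf ?y e"
    have g: "0 \<le> ?g" "?g \<le> e" "?g \<le> ?y" using e0 by auto
    have gW: "?g \<in> W" by (rule ideal_le[OF W(1) eW g(1,2)])
    have g_q: "?g \<perp> q n" for n
    proof -
      \<comment> \<open>Index 1 of the family whose supremum is \<open>c n\<close>. Hence
        \<open>?g\<close>, which is below \<open>e\<close> and disjoint from \<open>c n\<close>, is
        disjoint from \<open>q n\<close>.\<close>
      have le: "inf e (q n) \<le> c n" using lub_ge[OF c(3)[of n], OF rangeI[of _ 1]] by simp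
      have "?g \<perp> c n" by (rule perp_mono2[OF y_c g(1,3)])
      then have "?g \<perp> inf e (q n)" by (rule perp_mono) (use e0 q0 le in auto)
      then have "inf ?g (inf e (q n)) = 0" using perp_pos[OF g(1)] e0 q0 by simp
      moreover have "inf ?g (inf e (q n)) = inf ?g (q n)"
        by (simp add: inf_absorb1 inf_assoc[symmetric])
      ultimately show ?thesis using perp_pos[OF g(1) q0] by simp
    qed
    have "?g = 0"
    proof (rule tame[OF gW g(1)])
      fix n b assume b: "\<And>a. a \<in> A \<Longrightarrow> inf a (real n *\<^sub>R e) \<le> b"
      have "s n \<le> b" by (rule lub_le[OF s]) (use b in auto)
      have "real n *\<^sub>R ?g \<le> real n *\<^sub>R e" using g(2) by (intro scaleR_left_mono) auto
      \<comment> \<open>The excess of \<open>n ?g\<close> over \<open>s n\<close> lies below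
        \<open>q n\<close> and so is disjoint from \<open>?g\<close>; it also lies below
        \<open>n ?g\<close>, hence it vanishes.\<close>
      then have "pprt (real n *\<^sub>R ?g - s n) \<le> pprt (q n)"
        by (intro pprt_mono) (simp add: q_def)
      then have "pprt (real n *\<^sub>R ?g - s n) \<le> q n" using q0 by simp
      then have perp: "?g \<perp> pprt (real n *\<^sub>R ?g - s n)" by (rule perp_mono[OF g_q zero_le_pprt])
      have "0 \<le> real n *\<^sub>R ?g" using g(1) by (intro nonneg_scaleR) auto
      then have "pprt (real n *\<^sub>R ?g - s n) \<le> real n *\<^sub>R ?g" using s0[of n] by (simp add: pprt_def)
      then have "pprt (real n *\<^sub>R ?g - s n) = 0"
        by (rule perp_le_zero[OF perp_scaleR[OF perp_sym[OF perp]] zero_le_pprt])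
      then have "real n *\<^sub>R ?g \<le> s n" by (simp only: le_iff_pprt)
      then show "real n *\<^sub>R ?g \<le> b" using \<open>s n \<le> b\<close> by (rule order_trans)
    qed
    then have "?y \<perp> e" using e0 by (simp add: perp_pos)
    then have "?y = 0" by (rule eu[OF yW])
    then show "a \<le> z" by (simp only: le_iff_pprt)
  qed
  with z(1) show ?thesis by (intro bexI[of _ z] ballI)
qed

section \<open>Conditional triples on ideals and uniqueness of the completion\<close>

definition conditional_on :: "'v::vector_lattice set \<Rightarrow> 'v \<Rightarrow> ('v \<Rightarrow> 'v) \<Rightarrow> bool"
  where "conditional_on S e T \<longleftrightarrow> order_ideal S \<and> weak_unit_in S e \<and> T ` S \<subseteq> S \<and> positive_on S T \<and>
    normal_on S T \<and> (\<forall>x\<in>S. T (T x) = T x) \<and> T e = e \<and> (\<forall>x\<in>S. 0 < x \<longrightarrow> 0 < T x)"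

text \<open>\<open>W\<close> stands for the universal completion of \<open>S\<close>. Only positive
  families are tested; a general directed family is reduced to this case by subtracting one of its
  members.\<close>

definition complete_in :: "'v::vector_lattice set \<Rightarrow> ('v \<Rightarrow> 'v) \<Rightarrow> 'v set \<Rightarrow> bool"
  where "complete_in S T W \<longleftrightarrow> (\<forall>A. A \<subseteq> S \<and> dir A \<and> (\<forall>a\<in>A. 0 \<le> a) \<and> (\<exists>b\<in>W. \<forall>a\<in>A. T a \<le> b)
    \<longrightarrow> (\<exists>s\<in>S. lub A s))"

text \<open>Every positive element is the supremum of the directed set of elements of
  \<open>F\<close> below it, so order continuity determines the value from those on
  \<open>F\<close>.\<close>

lemma positive_normal_unique:
  fixes f :: "'v::dc_vector_lattice \<Rightarrow> 'w::vector_lattice"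
  assumes S: "order_ideal S" and F: "order_ideal F" "F \<subseteq> S" "order_dense_in F S"
    and f: "positive_on S f" "normal_on S f" and g: "positive_on S g" "normal_on S g"
    and eq: "\<And>x. x \<in> F \<Longrightarrow> f x = g x" and v: "v \<in> S"
  shows "f v = g v"
proof -
  have pos: "f u = g u" if u: "u \<in> S" "0 \<le> u" for u
  proof -
    have l: "lub (below F u) u"
      by (rule order_dense_lub[OF ideal_0[OF F(1)] ideal_add[OF F(1)] S F(3) u])
    have d: "dir (below F u)" by (rule dir_below[OF ideal_0[OF F(1)] u(2) ideal_sup[OF F(1)]])
    have sub: "below F u \<subseteq> S" "\<And>a. a \<in> below F u \<Longrightarrow> 0 \<le> a" using F(2) by (auto simp: below_def)
    have "f ` below F u = g ` below F u" using eq by (intro image_cong) (auto simp: below_def)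
    then show ?thesis
      using normal_onD[OF f(2) sub(1) d sub(2) u(1) l] normal_onD[OF g(2) sub(1) d sub(2) u(1) l]
      by (simp add: lub_unique)
  qed
  have p: "pprt v \<in> S" "pprt (- v) \<in> S" using v ideal_pprt[OF S] ideal_minus[OF S] by auto
  have "f (pprt v - pprt (- v)) = g (pprt v - pprt (- v))"
    using pos[OF p(1)] pos[OF p(2)] by (simp add: positive_on_diff[OF S f(1) p] positive_on_diff[OF S g(1) p])
  then show ?thesis by (simp only: pprt_diff[symmetric])
qed

lemma positive_on_compose:
  assumes "positive_on S f" "f ` S \<subseteq> S'" "positive_on S' g"
  shows "positive_on S (\<lambda>x. g (f x))"
  using assms unfolding positive_on_def by (simp add: image_subset_iff)

lemma normal_on_compose:
  assumes S: "order_ideal S" and f: "positive_on S f" "normal_on S f" "f ` S \<subseteq> S'" and g: "normal_on S' g"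
  shows "normal_on S (\<lambda>x. g (f x))"
  unfolding normal_on_def
proof (intro allI impI, elim conjE)
  fix A s assume A: "A \<subseteq> S" "dir A" "\<forall>a\<in>A. 0 \<le> a" and s: "s \<in> S" "lub A s"
  have "lub (f ` A) (f s)" using normal_onD[OF f(2) A(1,2) _ s] A(3) by blast
  moreover have "f ` A \<subseteq> S'" "f s \<in> S'" using A s f(3) by auto
  moreover have "dir (f ` A)"
    using A by (intro dir_image_mono) (auto intro: positive_on_mono[OF S f(1)])
  moreover have "0 \<le> a" if "a \<in> f ` A" for a using that A positive_onD(3)[OF f(1)] by auto
  ultimately have "lub (g ` f ` A) (g (f s))" by (intro normal_onD[OF g])
  then show "lub ((\<lambda>x. g (f x)) ` A) (g (f s))" by (simp add: image_image)
qed

lemma order_dense_trans: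
  "order_dense_in D S \<Longrightarrow> order_dense_in F D \<Longrightarrow> order_dense_in F S"
  unfolding order_dense_in_def by (meson order_trans)

text \<open>A nonzero element of \<open>W\<close> disjoint from \<open>e\<close> would dominate a
  nonzero element of \<open>S\<close>, still disjoint from \<open>e\<close>.\<close>

lemma weak_unit_dense:
  assumes "order_ideal S" "order_ideal W" "S \<subseteq> W" "order_dense_in S W" "weak_unit_in S e"
  shows "weak_unit_in W e"
  unfolding weak_unit_in_def
proof (intro conjI ballI impI)
  show "e \<in> W" "0 \<le> e" using assms by (auto simp: weak_unit_in_def)
  fix x assume x: "x \<in> W" "x \<perp> e"
  show "x = 0"
  proof (rule ccontr)
    assume "x \<noteq> 0"
    then have "0 < \<bar>x\<bar>" by simp
    then obtain g where g: "g \<in> S" "0 < g" "g \<le> \<bar>x\<bar>"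
      using assms(4) ideal_abs[OF assms(2) x(1)] unfolding order_dense_in_def by blast
    have "\<bar>x\<bar> \<perp> e" using x(2) by simp
    then have "g \<perp> e" by (rule perp_mono2) (use g in auto)
    then show False using g assms(5) by (auto simp: weak_unit_in_def)
  qed
qed

text \<open>\<open>F1\<close> and \<open>F2\<close> are the copies of \<open>E\<close> in two
  completions \<open>S1\<close> and \<open>S2\<close>, identified by \<open>\<psi>\<close> and its
  inverse \<open>\<chi>\<close>. The situation is one-sided: completeness is assumed for the target,
  inside its universal completion \<open>W2\<close>.\<close>

locale completion_map =
  fixes F1 S1 :: "'v::dc_vector_lattice set" and e1 T1
    and F2 S2 W2 :: "'w::dc_vector_lattice set" and e2 T2
    and \<psi> :: "'v \<Rightarrow> 'w" and \<chi> :: "'w \<Rightarrow> 'v"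
  assumes c1: "conditional_on S1 e1 T1" and F1: "order_ideal F1" "F1 \<subseteq> S1" "order_dense_in F1 S1"
    and T1F: "T1 ` F1 \<subseteq> F1"
    and c2: "conditional_on S2 e2 T2" and F2: "order_ideal F2" "F2 \<subseteq> S2" "order_dense_in F2 S2"
    and W2: "order_ideal W2" "laterally_complete W2" "S2 \<subseteq> W2" "order_dense_in S2 W2"
    and complete2: "complete_in S2 T2 W2"
    and \<psi>: "positive_on F1 \<psi>" "\<psi> ` F1 \<subseteq> F2" and \<chi>: "positive_on F2 \<chi>" "\<chi> ` F2 \<subseteq> F1"
    and \<chi>\<psi>: "\<And>x. x \<in> F1 \<Longrightarrow> \<chi> (\<psi> x) = x" and \<psi>\<chi>: "\<And>y. y \<in> F2 \<Longrightarrow> \<psi> (\<chi> y) = y"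
    and T\<psi>: "\<And>x. x \<in> F1 \<Longrightarrow> T2 (\<psi> x) = \<psi> (T1 x)"
begin

lemma S1: "order_ideal S1" and S2: "order_ideal S2"
  using c1 c2 by (auto simp: conditional_on_def)

text \<open>An order isomorphism keeps suprema, but a bound \<open>b\<close> may lie outside
  \<open>F2\<close>. It is replaced by \<open>inf (\<psi> s) b\<close>, which lies in
  \<open>F2\<close> because it is between 0 and \<open>\<psi> s\<close>.\<close>

lemma \<psi>_normal: "normal_on F1 \<psi>"
  unfolding normal_on_def
proof (intro allI impI, elim conjE)
  fix A s assume A: "A \<subseteq> F1" "dir A" "\<forall>a\<in>A. 0 \<le> a" and s: "s \<in> F1" "lub A s"
  have \<psi>F: "\<psi> a \<in> F2" if "a \<in> F1" for a using that \<psi>(2) by auto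
  obtain a0 where a0: "a0 \<in> A" using A(2) by (auto simp: dir_def)
  show "lub (\<psi> ` A) (\<psi> s)"
  proof (rule lubI)
    fix y assume "y \<in> \<psi> ` A"
    then show "y \<le> \<psi> s" using A s lub_ge by (auto intro!: positive_on_mono[OF F1(1) \<psi>(1)])
  next
    fix b assume b: "\<And>y. y \<in> \<psi> ` A \<Longrightarrow> y \<le> b"
    let ?z = "inf (\<psi> s) b"
    have az: "\<psi> a \<le> ?z" if "a \<in> A" for a
      using b that A s lub_ge[OF s(2) that] by (auto intro!: positive_on_mono[OF F1(1) \<psi>(1)])
    have "0 \<le> \<psi> a0" using A a0 positive_onD(3)[OF \<psi>(1)] by auto
    then have "0 \<le> ?z" using az[OF a0] by (rule order_trans)
    then have z: "?z \<in> F2" by (intro ideal_le[OF F2(1) \<psi>F[OF s(1)]]) auto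
    have "s \<le> \<chi> ?z"
    proof (rule lub_le[OF s(2)])
      fix a assume a: "a \<in> A"
      then have "a \<in> F1" using A by blast
      then show "a \<le> \<chi> ?z"
        using positive_on_mono[OF F2(1) \<chi>(1) \<psi>F z az[OF a]] by (simp add: \<chi>\<psi>)
    qed
    then have "\<psi> s \<le> \<psi> (\<chi> ?z)"
      using z \<chi>(2) s by (intro positive_on_mono[OF F1(1) \<psi>(1)]) auto
    then show "\<psi> s \<le> b" using \<psi>\<chi>[OF z] by simp
  qed
qed

text \<open>Completeness of the target asks only for a bound of the elements
  \<open>T2 (\<psi> y)\<close>, and the boundedness criterion supplies one. A nonzero
  \<open>g\<close> as in the criterion dominates some \<open>f > 0\<close> in \<open>F2\<close>; all
  multiples of \<open>\<chi> f\<close> lie below \<open>T1 v\<close>, because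
  \<open>T2 (\<psi> y) = \<psi> (T1 y)\<close> and \<open>T1 y \<le> T1 v\<close>. So
  \<open>\<chi> f = 0\<close>, a contradiction.\<close>

lemma \<psi>_below_lub:
  assumes v: "v \<in> S1" "0 \<le> v" shows "\<exists>s\<in>S2. lub (\<psi> ` below F1 v) s"
proof -
  let ?A = "T2 ` \<psi> ` below F1 v"
  have \<psi>F: "\<psi> a \<in> F2" if "a \<in> F1" for a using that \<psi>(2) by auto
  have T2pos: "positive_on S2 T2" using c2 by (auto simp: conditional_on_def)
  have T1pos: "positive_on S1 T1" using c1 by (auto simp: conditional_on_def)
  have T2S: "T2 x \<in> S2" if "x \<in> S2" for x using that c2 by (auto simp: conditional_on_def)
  have \<psi>nonneg: "0 \<le> \<psi> x" if "x \<in> F1" "0 \<le> x" for x using that positive_onD(3)[OF \<psi>(1)] by auto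
  have ne: "0 \<in> below F1 v" using v ideal_0[OF F1(1)] by (simp add: below_def)
  have unit: "weak_unit_in W2 e2"
    using weak_unit_dense[OF S2 W2(1,3,4)] c2 by (auto simp: conditional_on_def)
  have "\<exists>b\<in>W2. \<forall>a\<in>?A. a \<le> b"
  proof (rule laterally_complete_bounded[OF W2(1,2) unit])
    show "?A \<subseteq> W2" using F2(2) \<psi>F T2S W2(3) by (auto simp: below_def)
    show "?A \<noteq> {}" using ne by auto
    show "0 \<le> a" if "a \<in> ?A" for a
      using that F2(2) \<psi>F \<psi>nonneg positive_onD(3)[OF T2pos] by (auto simp: below_def)
    fix g assume g: "g \<in> W2" "0 \<le> g"
      "\<And>n b. (\<And>a. a \<in> ?A \<Longrightarrow> inf a (real n *\<^sub>R e2) \<le> b) \<Longrightarrow> real n *\<^sub>R g \<le> b"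
    show "g = 0"
    proof (rule ccontr)
      assume "g \<noteq> 0"
      then have "0 < g" using g(2) by simp
      then obtain f where f: "f \<in> F2" "0 < f" "f \<le> g"
        using order_dense_trans[OF W2(4) F2(3)] g(1) unfolding order_dense_in_def by blast
      let ?x = "\<chi> f"
      have x: "?x \<in> F1" "0 \<le> ?x" using f \<chi> positive_onD(3)[OF \<chi>(1)] by auto
      have "real n *\<^sub>R ?x \<le> T1 v" for n
      proof -
        have n0: "0 \<le> real n *\<^sub>R f" using f by (intro nonneg_scaleR) auto
        have n1: "0 \<le> real n *\<^sub>R ?x" using x by (intro nonneg_scaleR) auto
        have T1v: "0 \<le> T1 v" using v positive_onD(3)[OF T1pos] by auto
        have nf: "real n *\<^sub>R f \<in> F2" using f ideal_scaleR[OF F2(1)] by auto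
        \<comment> \<open>\<open>T1 v\<close> need not lie in \<open>F1\<close>, where alone
          \<open>\<psi>\<close> is controlled; its infimum with a multiple of \<open>?x\<close>
          does.\<close>
        let ?p = "inf (real n *\<^sub>R ?x) (T1 v)"
        have p: "?p \<in> F1" using n1 T1v by (intro ideal_le[OF F1(1) ideal_scaleR[OF F1(1) x(1), of "real n"]]) auto
        have bd: "inf (real n *\<^sub>R f) a \<le> \<psi> ?p" if a: "a \<in> ?A" for a
        proof -
          obtain y where y: "y \<in> F1" "0 \<le> y" "y \<le> v" "a = \<psi> (T1 y)"
            using a T\<psi> by (auto simp: below_def)
          have Ty: "T1 y \<in> F1" "0 \<le> T1 y" "T1 y \<le> T1 v"
            using y T1F F1(2) v positive_onD(3)[OF T1pos] positive_on_mono[OF S1 T1pos] by auto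
          let ?z = "inf (real n *\<^sub>R f) a"
          have z: "?z \<in> F2" using \<psi>nonneg[OF Ty(1,2)] y n0 by (intro ideal_le[OF F2(1) nf]) auto
          have "\<chi> ?z \<le> \<chi> a" using y \<psi>F Ty by (intro positive_on_mono[OF F2(1) \<chi>(1) z]) auto
          then have "\<chi> ?z \<le> T1 v" using y \<chi>\<psi> Ty by (auto intro: order_trans)
          moreover have "\<chi> ?z \<le> \<chi> (real n *\<^sub>R f)" by (intro positive_on_mono[OF F2(1) \<chi>(1) z nf]) simp
          ultimately have "\<chi> ?z \<le> ?p" using positive_onD(2)[OF \<chi>(1) f(1)] by simp
          then have "\<psi> (\<chi> ?z) \<le> \<psi> ?p" using z \<chi>(2) by (intro positive_on_mono[OF F1(1) \<psi>(1) _ p]) auto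
          then show ?thesis using \<psi>\<chi>[OF z] by simp
        qed
        have "\<exists>s. lub ((\<lambda>a. inf a (real n *\<^sub>R e2)) ` ?A) s"
          using ne by (intro lub_exists[of _ "real n *\<^sub>R e2"]) auto
        then obtain s where s: "lub ((\<lambda>a. inf a (real n *\<^sub>R e2)) ` ?A) s" ..
        \<comment> \<open>Since \<open>n f\<close> lies below the supremum \<open>s\<close> of the
          truncations, it is the supremum of its own infima with them, and each of these is at most
          \<open>\<psi> ?p\<close>.\<close>
        have "real n *\<^sub>R f \<le> real n *\<^sub>R g" using f by (intro scaleR_left_mono) auto
        also have "\<dots> \<le> s" using lub_ge[OF s] by (intro g(3)) blast
        finally have "inf (real n *\<^sub>R f) s = real n *\<^sub>R f" by (rule inf_absorb1)
        moreover have "inf (real n *\<^sub>R f) s \<le> \<psi> ?p"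
        proof (rule lub_le[OF lub_inf[OF s]])
          fix u assume "u \<in> inf (real n *\<^sub>R f) ` (\<lambda>a. inf a (real n *\<^sub>R e2)) ` ?A"
          then obtain a where a: "a \<in> ?A" "u = inf (real n *\<^sub>R f) (inf a (real n *\<^sub>R e2))" by blast
          have "u \<le> inf (real n *\<^sub>R f) a" unfolding a(2) by (rule inf_mono) auto
          then show "u \<le> \<psi> ?p" using bd[OF a(1)] by (rule order_trans)
        qed
        ultimately have "real n *\<^sub>R f \<le> \<psi> ?p" by simp
        then have "\<chi> (real n *\<^sub>R f) \<le> \<chi> (\<psi> ?p)"
          using \<psi>F[OF p] by (intro positive_on_mono[OF F2(1) \<chi>(1) nf])
        then show ?thesis using positive_onD(2)[OF \<chi>(1) f(1)] \<chi>\<psi>[OF p] by simp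
      qed
      then have "?x = 0" by (rule archimedean[OF x(2)])
      then have "\<psi> ?x = 0" using positive_on_0[OF \<psi>(1) x(1)] by simp
      then show False using \<psi>\<chi>[OF f(1)] f(2) by simp
    qed
  qed
  then obtain b where b: "b \<in> W2" "\<forall>a\<in>\<psi> ` below F1 v. T2 a \<le> b" by auto
  have "dir (below F1 v)" by (rule dir_below[OF ideal_0[OF F1(1)] v(2) ideal_sup[OF F1(1)]])
  then have "dir (\<psi> ` below F1 v)"
    by (rule dir_image_mono) (auto simp: below_def intro: positive_on_mono[OF F1(1) \<psi>(1)])
  moreover have "\<psi> ` below F1 v \<subseteq> S2" using \<psi>F F2(2) by (auto simp: below_def)
  moreover have "\<forall>a\<in>\<psi> ` below F1 v. 0 \<le> a" using \<psi>nonneg by (auto simp: below_def)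
  ultimately show ?thesis using complete2 b unfolding complete_in_def by blast
qed

sublocale positive_extension F1 S1 \<psi>
proof
  fix v assume "v \<in> S1" "0 \<le> v"
  then obtain s where "lub (\<psi> ` below F1 v) s" using \<psi>_below_lub by blast
  then show "\<exists>b. \<forall>x\<in>below F1 v. \<psi> x \<le> b" by (auto simp: lub_def)
qed (use F1 S1 \<psi> in auto)

lemma extl_range: "extl ` S1 \<subseteq> S2"
proof -
  have "ext v \<in> S2" if "v \<in> S1" "0 \<le> v" for v
    using \<psi>_below_lub[OF that] ext_lub[OF that] lub_unique by blast
  then show ?thesis
    using ideal_pprt[OF S1] ideal_minus[OF S1] by (auto simp: extl_def intro!: ideal_diff[OF S2])
qed

text \<open>Both sides are positive and order continuous on \<open>S1\<close> and agree on the dense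
  ideal \<open>F1\<close>.\<close>

lemma extl_T:
  assumes v: "v \<in> S1" shows "extl (T1 v) = T2 (extl v)"
proof -
  note d1 = c1[unfolded conditional_on_def] and d2 = c2[unfolded conditional_on_def]
  have T1: "T1 ` S1 \<subseteq> S1" "positive_on S1 T1" "normal_on S1 T1" using d1 by blast+
  have T2: "T2 ` S2 \<subseteq> S2" "positive_on S2 T2" "normal_on S2 T2" using d2 by blast+
  have n: "normal_on S1 extl" by (rule extl_normal[OF \<psi>_normal])
  show ?thesis
  proof (rule positive_normal_unique[OF S1 F1 _ _ _ _ _ v])
    show "positive_on S1 (\<lambda>x. extl (T1 x))" by (rule positive_on_compose[OF T1(2,1) extl_positive_on])
    show "normal_on S1 (\<lambda>x. extl (T1 x))" by (rule normal_on_compose[OF S1 T1(2,3,1) n])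
    show "positive_on S1 (\<lambda>x. T2 (extl x))" by (rule positive_on_compose[OF extl_positive_on extl_range T2(2)])
    show "normal_on S1 (\<lambda>x. T2 (extl x))" by (rule normal_on_compose[OF S1 extl_positive_on n extl_range T2(3)])
    show "extl (T1 x) = T2 (extl x)" if "x \<in> F1" for x
      using that T1F T\<psi> extl_eq by (auto simp: image_subset_iff)
  qed
qed

end

locale completion_pair =
  A: completion_map F1 S1 e1 T1 F2 S2 W2 e2 T2 \<psi> \<chi> + B: completion_map F2 S2 e2 T2 F1 S1 W1 e1 T1 \<chi> \<psi>
  for F1 S1 W1 :: "'v::dc_vector_lattice set" and e1 T1
    and F2 S2 W2 :: "'w::dc_vector_lattice set" and e2 T2 \<psi> \<chi>
begin

lemma extl_inverse:
  assumes v: "v \<in> S1" shows "B.extl (A.extl v) = v"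
proof (rule positive_normal_unique[OF A.S1 A.F1 _ _ _ _ _ v])
  have nA: "normal_on S1 A.extl" by (rule A.extl_normal[OF A.\<psi>_normal])
  have nB: "normal_on S2 B.extl" by (rule B.extl_normal[OF B.\<psi>_normal])
  show "positive_on S1 (\<lambda>x. B.extl (A.extl x))"
    by (rule positive_on_compose[OF A.extl_positive_on A.extl_range B.extl_positive_on])
  show "normal_on S1 (\<lambda>x. B.extl (A.extl x))"
    by (rule normal_on_compose[OF A.S1 A.extl_positive_on nA A.extl_range nB])
  show "positive_on S1 (\<lambda>x. x)" by (simp add: positive_on_def)
  show "normal_on S1 (\<lambda>x. x)" by (simp add: normal_on_def)
  show "B.extl (A.extl x) = x" if "x \<in> F1" for x
    using that A.\<psi>(2) A.\<chi>\<psi> A.extl_eq B.extl_eq by (auto simp: image_subset_iff)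
qed

end

section \<open>The universal completion of a Dedekind complete vector lattice\<close>

text \<open>
  Elements of the universal completion are represented by nets in the lattice, indexed by the
  lattice itself, that are locally eventually constant: every positive element dominates a positive
  one on whose band the net is eventually constant. Nets that are locally eventually zero are
  identified with zero. A positive element
  of the completion is represented by the net of its truncations at the positive part of the index \<open>m\<close>.
\<close>

definition null_net :: "('v::dc_vector_lattice \<Rightarrow> 'v) \<Rightarrow> bool"
  where "null_net x \<longleftrightarrow> (\<forall>g>0. \<exists>n h. 0 < h \<and> h \<le> g \<and> (\<forall>m\<ge>n. h \<perp> x m))"

definition const_net :: "('v::dc_vector_lattice \<Rightarrow> 'v) \<Rightarrow> bool"
  where "const_net x \<longleftrightarrow> (\<forall>g>0. \<exists>n h. 0 < h \<and> h \<le> g \<and> (\<forall>m\<ge>n. h \<perp> x m - x n))"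

lemma null_netE:
  assumes "null_net x" "0 < g"
  obtains n h where "0 < h" "h \<le> g" "\<And>m. n \<le> m \<Longrightarrow> h \<perp> x m"
  using assms unfolding null_net_def by blast

lemma const_netE:
  assumes "const_net x" "0 < g"
  obtains n h where "0 < h" "h \<le> g" "\<And>m. n \<le> m \<Longrightarrow> h \<perp> x m - x n"
  using assms unfolding const_net_def by blast

lemma null_net_0: "null_net (\<lambda>_. 0)"
  unfolding null_net_def by (auto intro: exI[of _ "_::'v"])

lemma const_net_const: "const_net (\<lambda>_. a)"
  unfolding const_net_def by auto

text \<open>\<open>h\<close> is shrunk to an \<open>h'\<close> that serves the second net as well,
  and the two indices are joined. Closure under sums and compatibility with the supremum reduce to
  such a domination.\<close>

lemma null_net_dominated2:
  assumes x: "null_net x" and y: "null_net y" and le: "\<And>m. \<bar>z m\<bar> \<le> \<bar>x m\<bar> + \<bar>y m\<bar>"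
  shows "null_net z"
  unfolding null_net_def
proof (intro allI impI)
  fix g :: 'a assume "0 < g"
  then obtain n h where h: "0 < h" "h \<le> g" "\<And>m. n \<le> m \<Longrightarrow> h \<perp> x m" using null_netE[OF x] by metis
  obtain n' h' where h': "0 < h'" "h' \<le> h" "\<And>m. n' \<le> m \<Longrightarrow> h' \<perp> y m" using null_netE[OF y h(1)] by metis
  have "h' \<perp> z m" if m: "sup n n' \<le> m" for m
  proof (rule perp_solid)
    have "h' \<perp> x m" using perp_mono2[OF h(3)] h' m by simp
    then show "h' \<perp> \<bar>x m\<bar> + \<bar>y m\<bar>" using h'(3) m by (intro perp_add) auto
    show "\<bar>z m\<bar> \<le> \<bar>\<bar>x m\<bar> + \<bar>y m\<bar>\<bar>" using le[of m] by (simp add: add_nonneg_nonneg)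
  qed
  moreover have "h' \<le> g" using h h' by (meson order_trans)
  ultimately show "\<exists>n h. 0 < h \<and> h \<le> g \<and> (\<forall>m\<ge>n. h \<perp> z m)" using h'(1) by blast
qed

lemma null_net_dominated: "null_net x \<Longrightarrow> (\<And>m. \<bar>z m\<bar> \<le> \<bar>x m\<bar>) \<Longrightarrow> null_net z"
  by (rule null_net_dominated2[OF _ null_net_0]) auto

lemma null_net_add:
  assumes "null_net x" "null_net y" shows "null_net (\<lambda>m. x m + y m)"
  by (rule null_net_dominated2[OF assms]) (rule abs_triangle_ineq)

lemma null_net_scaleR: "null_net x \<Longrightarrow> null_net (\<lambda>m. c *\<^sub>R x m)"
  unfolding null_net_def by (meson perp_scaleR)

text \<open>Beyond the joined index \<open>?k\<close> the increments of both nets are differences of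
  increments from their own indices \<open>n\<close> and \<open>n'\<close>, so \<open>h'\<close> is
  disjoint from them.\<close>

lemma const_net_dominated2:
  assumes x: "const_net x" and y: "const_net y"
    and le: "\<And>m n. \<bar>z m - z n\<bar> \<le> \<bar>x m - x n\<bar> + \<bar>y m - y n\<bar>"
  shows "const_net z"
  unfolding const_net_def
proof (intro allI impI)
  fix g :: 'a assume "0 < g"
  then obtain n h where h: "0 < h" "h \<le> g" "\<And>m. n \<le> m \<Longrightarrow> h \<perp> x m - x n"
    using const_netE[OF x] by metis
  obtain n' h' where h': "0 < h'" "h' \<le> h" "\<And>m. n' \<le> m \<Longrightarrow> h' \<perp> y m - y n'"
    using const_netE[OF y h(1)] by metis
  have hx: "h' \<perp> x m - x n" if "n \<le> m" for m using perp_mono2[OF h(3)[OF that]] h' by simp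
  let ?k = "sup n n'"
  have "h' \<perp> z m - z ?k" if m: "?k \<le> m" for m
  proof (rule perp_solid)
    have "h' \<perp> (x m - x n) - (x ?k - x n)" using m by (intro perp_diff hx) auto
    moreover have "h' \<perp> (y m - y n') - (y ?k - y n')" using m by (intro perp_diff h'(3)) auto
    ultimately show "h' \<perp> \<bar>x m - x ?k\<bar> + \<bar>y m - y ?k\<bar>" by (intro perp_add) auto
    show "\<bar>z m - z ?k\<bar> \<le> \<bar>\<bar>x m - x ?k\<bar> + \<bar>y m - y ?k\<bar>\<bar>" using le[of m ?k] by (simp add: add_nonneg_nonneg)
  qed
  moreover have "h' \<le> g" using h h' by (meson order_trans)
  ultimately show "\<exists>n h. 0 < h \<and> h \<le> g \<and> (\<forall>m\<ge>n. h \<perp> z m - z n)" using h'(1) by blast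
qed

lemma const_net_add:
  assumes "const_net x" "const_net y" shows "const_net (\<lambda>m. x m + y m)"
  by (rule const_net_dominated2[OF assms]) (metis abs_triangle_ineq add_diff_add)

lemma const_net_scaleR: "const_net x \<Longrightarrow> const_net (\<lambda>m. c *\<^sub>R x m)"
  unfolding const_net_def by (metis perp_scaleR scaleR_diff_right)

lemma const_net_sup:
  assumes "const_net x" "const_net y" shows "const_net (\<lambda>m. sup (x m) (y m))"
  by (rule const_net_dominated2[OF assms]) (rule sup_diff_le)

text \<open>A partial equivalence: only locally eventually constant nets are related to anything, so
  the quotient consists of their classes.\<close>

definition net_eq :: "('v::dc_vector_lattice \<Rightarrow> 'v) \<Rightarrow> ('v \<Rightarrow> 'v) \<Rightarrow> bool"
  where "net_eq x y \<longleftrightarrow> const_net x \<and> const_net y \<and> null_net (\<lambda>m. x m - y m)"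

definition net_le :: "('v::dc_vector_lattice \<Rightarrow> 'v) \<Rightarrow> ('v \<Rightarrow> 'v) \<Rightarrow> bool"
  where "net_le x y \<longleftrightarrow> null_net (\<lambda>m. pprt (x m - y m))"

lemma null_net_minus: "null_net (\<lambda>m. x m - y m) \<Longrightarrow> null_net (\<lambda>m. y m - x m)"
  by (erule null_net_dominated) (simp add: abs_minus_commute)

lemma null_net_trans: "null_net (\<lambda>m. x m - y m) \<Longrightarrow> null_net (\<lambda>m. y m - z m) \<Longrightarrow> null_net (\<lambda>m. x m - z m)"
  using null_net_add[of "\<lambda>m. x m - y m" "\<lambda>m. y m - z m"] by simp

lemma net_le_trans:
  assumes "net_le x y" "net_le y z" shows "net_le x z"
  unfolding net_le_def
proof (rule null_net_dominated2[OF assms[unfolded net_le_def]])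
  fix m
  have "pprt ((x m - y m) + (y m - z m)) \<le> pprt (x m - y m) + pprt (y m - z m)" by (rule pprt_add_le)
  then show "\<bar>pprt (x m - z m)\<bar> \<le> \<bar>pprt (x m - y m)\<bar> + \<bar>pprt (y m - z m)\<bar>" by simp
qed

lemma net_eq_iff_le: "const_net x \<Longrightarrow> const_net y \<Longrightarrow> net_eq x y \<longleftrightarrow> net_le x y \<and> net_le y x"
proof
  assume "net_eq x y"
  then show "net_le x y \<and> net_le y x"
    unfolding net_eq_def net_le_def
    by (auto elim!: null_net_dominated simp: pprt_le_abs)
      (metis abs_minus_commute pprt_le_abs)
next
  assume c: "const_net x" "const_net y" and le: "net_le x y \<and> net_le y x"
  have "null_net (\<lambda>m. x m - y m)"
  proof (rule null_net_dominated2[OF le[THEN conjunct1, unfolded net_le_def] le[THEN conjunct2, unfolded net_le_def]])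
    fix m show "\<bar>x m - y m\<bar> \<le> \<bar>pprt (x m - y m)\<bar> + \<bar>pprt (y m - x m)\<bar>"
      using abs_pprt[of "x m - y m"] by simp
  qed
  then show "net_eq x y" using c by (simp add: net_eq_def)
qed

quotient_type (overloaded) 'v uc = "'v::dc_vector_lattice \<Rightarrow> 'v" / partial: net_eq
  morphisms rep_net net_class
proof (rule part_equivpI)
  show "\<exists>x::'v \<Rightarrow> 'v. net_eq x x"
    using const_net_const null_net_0 by (auto simp: net_eq_def)
  show "symp (net_eq :: ('v \<Rightarrow> 'v) \<Rightarrow> _)"
    by (rule sympI) (auto simp: net_eq_def intro: null_net_minus)
  show "transp (net_eq :: ('v \<Rightarrow> 'v) \<Rightarrow> _)"
    by (rule transpI) (auto simp: net_eq_def intro: null_net_trans)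
qed

lemma net_eq_refl: "net_eq x x \<longleftrightarrow> const_net x"
  by (simp add: net_eq_def null_net_0)

lemma net_eq_le: "net_eq x y \<Longrightarrow> net_le x y \<and> net_le y x"
  using net_eq_iff_le by (auto simp: net_eq_def)

section \<open>The vector lattice of classes of nets\<close>

instantiation uc :: (dc_vector_lattice) vector_lattice
begin

lift_definition zero_uc :: "'a uc" is "\<lambda>_. 0" by (simp add: net_eq_refl const_net_const)

lift_definition plus_uc :: "'a uc \<Rightarrow> 'a uc \<Rightarrow> 'a uc" is "\<lambda>x y m. x m + y m"
proof -
  fix x x' y y' :: "'a \<Rightarrow> 'a"
  assume "net_eq x x'" "net_eq y y'"
  then show "net_eq (\<lambda>m. x m + y m) (\<lambda>m. x' m + y' m)"
    using null_net_add[of "\<lambda>m. x m - x' m" "\<lambda>m. y m - y' m"]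
    by (simp add: net_eq_def const_net_add add_diff_add)
qed

lift_definition scaleR_uc :: "real \<Rightarrow> 'a uc \<Rightarrow> 'a uc" is "\<lambda>c x m. c *\<^sub>R x m"
  using null_net_scaleR by (fastforce simp: net_eq_def const_net_scaleR scaleR_diff_right[symmetric])

text \<open>Negation, difference, infimum and modulus are derived from operations already lifted,
  which spares separate proofs that they respect the equivalence of nets.\<close>

definition uminus_uc :: "'a uc \<Rightarrow> 'a uc" where "uminus_uc x = (-1) *\<^sub>R x"
definition minus_uc :: "'a uc \<Rightarrow> 'a uc \<Rightarrow> 'a uc" where "minus_uc x y = x + (-1) *\<^sub>R y"

lift_definition sup_uc :: "'a uc \<Rightarrow> 'a uc \<Rightarrow> 'a uc" is "\<lambda>x y m. sup (x m) (y m)"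
proof -
  fix x x' y y' :: "'a \<Rightarrow> 'a"
  assume *: "net_eq x x'" "net_eq y y'"
  then have "null_net (\<lambda>m. sup (x m) (y m) - sup (x' m) (y' m))"
    unfolding net_eq_def by (blast intro: null_net_dominated2 sup_diff_le)
  then show "net_eq (\<lambda>m. sup (x m) (y m)) (\<lambda>m. sup (x' m) (y' m))"
    using * by (simp add: net_eq_def const_net_sup)
qed

definition inf_uc :: "'a uc \<Rightarrow> 'a uc \<Rightarrow> 'a uc" where "inf_uc x y = - sup (- x) (- y)"
definition abs_uc :: "'a uc \<Rightarrow> 'a uc" where "abs_uc x = sup x (- x)"

lift_definition less_eq_uc :: "'a uc \<Rightarrow> 'a uc \<Rightarrow> bool" is net_le
  by (meson net_eq_le net_le_trans)

definition less_uc :: "'a uc \<Rightarrow> 'a uc \<Rightarrow> bool" where "less_uc x y \<longleftrightarrow> x \<le> y \<and> \<not> y \<le> x"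

instance
proof
  fix x y z :: "'a uc" and a b :: real
  note d = uminus_uc_def minus_uc_def
  show "x + y + z = x + (y + z)" by transfer (simp add: net_eq_refl add.assoc const_net_add)
  show "x + y = y + x" by transfer (simp add: net_eq_refl add.commute const_net_add)
  show "0 + x = x" by transfer (simp add: net_eq_refl)
  show "- x + x = 0" unfolding d by transfer (simp add: net_eq_refl const_net_const)
  show "x - y = x + - y" by (simp add: d)
  show "a *\<^sub>R (x + y) = a *\<^sub>R x + a *\<^sub>R y"
    by transfer (simp add: net_eq_refl const_net_add const_net_scaleR scaleR_add_right)
  show "(a + b) *\<^sub>R x = a *\<^sub>R x + b *\<^sub>R x"
    by transfer (simp add: net_eq_refl const_net_add const_net_scaleR scaleR_add_left)
  show "a *\<^sub>R b *\<^sub>R x = (a * b) *\<^sub>R x" by transfer (simp add: net_eq_refl const_net_scaleR)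
  show "1 *\<^sub>R x = x" by transfer (simp add: net_eq_refl)
  show "(x < y) = (x \<le> y \<and> \<not> y \<le> x)" by (simp add: less_uc_def)
  show refl: "x \<le> x" for x :: "'a uc" by transfer (simp add: net_le_def null_net_0)
  show trans: "x \<le> y \<Longrightarrow> y \<le> z \<Longrightarrow> x \<le> z" for x y z :: "'a uc" by transfer (rule net_le_trans)
  show antisym: "x \<le> y \<Longrightarrow> y \<le> x \<Longrightarrow> x = y" for x y :: "'a uc"
    by transfer (simp add: net_eq_refl net_eq_iff_le)
  show add: "x \<le> y \<Longrightarrow> z + x \<le> z + y" for x y z :: "'a uc" by transfer (simp add: net_le_def)
  have scale: "x \<le> y \<Longrightarrow> 0 \<le> a \<Longrightarrow> a *\<^sub>R x \<le> a *\<^sub>R y" for x y :: "'a uc" and a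
    by transfer (simp add: net_le_def scaleR_diff_right[symmetric] pprt_scaleR null_net_scaleR)
  then show "x \<le> y \<Longrightarrow> 0 \<le> a \<Longrightarrow> a *\<^sub>R x \<le> a *\<^sub>R y" .
  show "a \<le> b \<Longrightarrow> 0 \<le> x \<Longrightarrow> a *\<^sub>R x \<le> b *\<^sub>R x"
  proof transfer
    fix a b :: real and x :: "'a \<Rightarrow> 'a" assume *: "a \<le> b" "net_le (\<lambda>_. 0) x"
    have "pprt (a *\<^sub>R x m - b *\<^sub>R x m) = (b - a) *\<^sub>R pprt (0 - x m)" for m
      using *(1) by (subst pprt_scaleR[symmetric]) (auto simp: algebra_simps)
    then show "net_le (\<lambda>m. a *\<^sub>R x m) (\<lambda>m. b *\<^sub>R x m)"
      using *(2) null_net_scaleR unfolding net_le_def by auto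
  qed
  have sup1: "x \<le> sup x y" for x y :: "'a uc"
    by transfer (simp add: net_le_def null_net_0)
  have sup2: "y \<le> sup x y" for x y :: "'a uc"
    by transfer (simp add: net_le_def null_net_0)
  have sup3: "y \<le> x \<Longrightarrow> z \<le> x \<Longrightarrow> sup y z \<le> x" for x y z :: "'a uc"
  proof transfer
    fix x y z :: "'a \<Rightarrow> 'a" assume "net_le y x" "net_le z x"
    then show "net_le (\<lambda>m. sup (y m) (z m)) x"
      unfolding net_le_def
    proof (rule null_net_dominated2)
      fix m
      have "pprt (sup (y m) (z m) - x m) = sup (pprt (y m - x m)) (pprt (z m - x m))"
        unfolding pprt_def by (simp only: diff_conv_add_uminus add_sup_distrib_right) (simp add: sup_aci)
      also have "\<dots> \<le> pprt (y m - x m) + pprt (z m - x m)" by simp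
      finally show "\<bar>pprt (sup (y m) (z m) - x m)\<bar> \<le> \<bar>pprt (y m - x m)\<bar> + \<bar>pprt (z m - x m)\<bar>" by simp
    qed
  qed
  show "x \<le> sup x y" "y \<le> sup x y" by (rule sup1, rule sup2)
  show "y \<le> x \<Longrightarrow> z \<le> x \<Longrightarrow> sup y z \<le> x" by (rule sup3)
  have neg: "- y \<le> - x \<longleftrightarrow> x \<le> y" for x y :: "'a uc"
    unfolding d by transfer (simp add: net_le_def)
  have negneg: "- (- x) = x" for x :: "'a uc"
    unfolding d by transfer (simp add: net_eq_refl)
  show "inf x y \<le> x" "inf x y \<le> y"
    using neg[of x "inf x y"] neg[of y "inf x y"] sup1[of "- x" "- y"] sup2[of "- y" "- x"]
    by (simp_all add: inf_uc_def negneg)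
  show "x \<le> y \<Longrightarrow> x \<le> z \<Longrightarrow> x \<le> inf y z"
    using neg[of "inf y z" x] sup3[of "- y" "- x" "- z"] by (simp add: inf_uc_def negneg neg)
  show "\<bar>x\<bar> = sup x (- x)" by (simp add: abs_uc_def)
qed

end

lemma const_net_diff: "const_net x \<Longrightarrow> const_net y \<Longrightarrow> const_net (\<lambda>m. x m - y m)"
  using const_net_add[OF _ const_net_scaleR[of y "-1"], of x] by simp

lemma const_net_abs: "const_net x \<Longrightarrow> const_net (\<lambda>m. \<bar>x m\<bar>)"
  using const_net_sup[OF _ const_net_scaleR[of x "-1"], of x] by (simp add: abs_lattice)

lemma class_add: "const_net x \<Longrightarrow> const_net y \<Longrightarrow> net_class x + net_class y = net_class (\<lambda>m. x m + y m)"
  by (simp add: plus_uc.abs_eq net_eq_refl)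

lemma class_scaleR: "const_net x \<Longrightarrow> c *\<^sub>R net_class x = net_class (\<lambda>m. c *\<^sub>R x m)"
  by (simp add: scaleR_uc.abs_eq net_eq_refl)

lemma class_minus: "const_net x \<Longrightarrow> - net_class x = net_class (\<lambda>m. - x m)"
  using class_scaleR[of x "-1"] by simp

lemma class_diff: "const_net x \<Longrightarrow> const_net y \<Longrightarrow> net_class x - net_class y = net_class (\<lambda>m. x m - y m)"
  using class_add[OF _ const_net_scaleR[of y "-1"], of x]
  by (simp add: class_minus[symmetric])

lemma class_sup: "const_net x \<Longrightarrow> const_net y \<Longrightarrow> sup (net_class x) (net_class y) = net_class (\<lambda>m. sup (x m) (y m))"
  by (simp add: sup_uc.abs_eq net_eq_refl)

lemma class_abs: "const_net x \<Longrightarrow> \<bar>net_class x\<bar> = net_class (\<lambda>m. \<bar>x m\<bar>)"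
  using class_sup[OF _ const_net_scaleR[of x "-1"], of x]
  by (simp add: abs_lattice[of "net_class x"] abs_lattice[of "x _"] class_minus)

lemma class_inf:
  assumes "const_net x" "const_net y"
  shows "inf (net_class x) (net_class y) = net_class (\<lambda>m. inf (x m) (y m))"
proof -
  have *: "const_net (\<lambda>m. - x m)" "const_net (\<lambda>m. - y m)"
    using const_net_scaleR[of x "-1"] const_net_scaleR[of y "-1"] assms by simp_all
  show ?thesis
    unfolding inf_eq_neg_sup[of "net_class x"] inf_eq_neg_sup[of "x _"]
    by (simp add: class_minus assms class_sup * const_net_sup)
qed

lemma class_zero: "net_class (\<lambda>_. 0) = 0"
  by (simp add: zero_uc_def)

lemma class_eq_0: "const_net x \<Longrightarrow> net_class x = 0 \<longleftrightarrow> null_net x"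
  using Quotient_rel[OF Quotient_uc, of x "\<lambda>_. 0"]
  by (auto simp: class_zero[symmetric] net_eq_def const_net_const null_net_0)

lemma uc_cases: obtains x where "const_net x" "u = net_class x"
  using Quotient_abs_rep[OF Quotient_uc, of u] Quotient_rep_reflp[OF Quotient_uc, of u]
  by (auto simp: net_eq_refl)

section \<open>Embedding by constant nets and local comparison with lattice elements\<close>

lift_definition emb :: "'v::dc_vector_lattice \<Rightarrow> 'v uc" is "\<lambda>a _. a"
  by (simp add: net_eq_refl const_net_const)

lemma emb_class: "emb a = net_class (\<lambda>_. a)"
  by (simp add: emb_def)

lemma emb_add: "emb (a + b) = emb a + emb b"
  by (simp add: emb_class class_add const_net_const)

lemma emb_scaleR: "emb (c *\<^sub>R a) = c *\<^sub>R emb a"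
  by (simp add: emb_class class_scaleR const_net_const)

lemma emb_minus: "emb (- a) = - emb a"
  using emb_scaleR[of "-1" a] by simp

lemma emb_diff: "emb (a - b) = emb a - emb b"
  using emb_add[of a "- b"] by (simp add: emb_minus)

lemma emb_sup: "emb (sup a b) = sup (emb a) (emb b)"
  by (simp add: emb_class class_sup const_net_const)

lemma emb_inf: "emb (inf a b) = inf (emb a) (emb b)"
  by (simp add: emb_class class_inf const_net_const)

lemma emb_abs: "emb \<bar>a\<bar> = \<bar>emb a\<bar>"
  by (simp add: emb_class class_abs const_net_const)

lemma emb_0: "emb 0 = 0"
  by (simp add: emb_class class_zero)

lemma emb_pprt: "emb (pprt a) = pprt (emb a)"
  by (simp add: pprt_def emb_sup emb_0)

lemma null_net_const_iff: "null_net (\<lambda>_. c) \<longleftrightarrow> c = 0" for c :: "'v::dc_vector_lattice"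
proof
  assume n: "null_net (\<lambda>_. c)"
  show "c = 0"
  proof (rule ccontr)
    assume "c \<noteq> 0"
    then have "0 < \<bar>c\<bar>" by simp
    then obtain n :: 'v and h where h: "0 < h" "h \<le> \<bar>c\<bar>" "\<And>m. n \<le> m \<Longrightarrow> h \<perp> c"
      using null_netE[OF n] by metis
    have "h \<perp> \<bar>c\<bar>" using h(3)[of n] by simp
    then have "h = 0" by (rule perp_le_zero) (use h in auto)
    then show False using h by simp
  qed
qed (simp add: null_net_0)

lemma emb_eq_0_iff: "emb a = 0 \<longleftrightarrow> a = 0"
  by (simp add: emb_class class_eq_0 const_net_const null_net_const_iff)

lemma emb_eq_iff: "emb a = emb b \<longleftrightarrow> a = b"
  using emb_eq_0_iff[of "a - b"] by (simp add: emb_diff)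

lemma emb_le_iff: "emb a \<le> emb b \<longleftrightarrow> a \<le> b"
  by (simp only: le_iff_pprt emb_diff[symmetric] emb_pprt[symmetric] emb_eq_0_iff)

lemma emb_nonneg_iff: "0 \<le> emb a \<longleftrightarrow> 0 \<le> a"
  using emb_le_iff[of 0 a] by (simp add: emb_0)

lemma emb_pos_iff: "0 < emb a \<longleftrightarrow> 0 < a"
  by (simp add: order_less_le emb_nonneg_iff emb_eq_0_iff eq_commute[of 0])

lemma emb_perp_iff: "emb a \<perp> emb b \<longleftrightarrow> a \<perp> b"
  by (simp only: perp_def emb_abs[symmetric] emb_inf[symmetric] emb_eq_0_iff)

lemma null_net_eventually: "(\<And>m. n \<le> m \<Longrightarrow> x m = 0) \<Longrightarrow> null_net x"
  unfolding null_net_def by (metis order_refl perp_0(1))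

lemma emb_perp_class: "const_net y \<Longrightarrow> emb h \<perp> net_class y \<longleftrightarrow> null_net (\<lambda>m. inf \<bar>h\<bar> \<bar>y m\<bar>)"
proof -
  assume y: "const_net y"
  note c = const_net_abs[OF const_net_const[of h]] const_net_abs[OF y]
  have "const_net (\<lambda>m. inf \<bar>h\<bar> \<bar>y m\<bar>)"
    using const_net_scaleR[OF const_net_sup[OF const_net_scaleR[OF c(1), of "-1"] const_net_scaleR[OF c(2), of "-1"]], of "-1"]
    by (simp add: inf_eq_neg_sup)
  then show ?thesis
    by (simp add: perp_def emb_class class_abs class_inf c y const_net_const class_eq_0)
qed

lemma class_local:
  assumes x: "const_net x" and "0 < g"
  shows "\<exists>h n. 0 < h \<and> h \<le> g \<and> emb h \<perp> net_class x - emb (x n)"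
proof -
  obtain n h where h: "0 < h" "h \<le> g" "\<And>m. n \<le> m \<Longrightarrow> h \<perp> x m - x n"
    using const_netE[OF x \<open>0 < g\<close>] by metis
  have "emb h \<perp> net_class (\<lambda>m. x m - x n)"
    unfolding emb_perp_class[OF const_net_diff[OF x const_net_const]]
    using h(3) by (intro null_net_eventually[of n]) (simp add: perp_def)
  then have "emb h \<perp> net_class x - emb (x n)"
    by (simp add: emb_class class_diff x const_net_const)
  then show ?thesis using h by blast
qed

text \<open>The working principle for the quotient: below any \<open>g\<close> there is an
  \<open>h\<close> on whose band \<open>u\<close> coincides with a lattice element, namely with a
  value of a representing net at an index from which on the net is constant there.\<close>

lemma uc_local:
  assumes "0 < g" shows "\<exists>h X. 0 < h \<and> h \<le> g \<and> emb h \<perp> u - emb X"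
proof -
  obtain x where x: "const_net x" "u = net_class x" by (rule uc_cases)
  show ?thesis using class_local[OF x(1) assms] unfolding x(2) by (elim exE) (intro exI)
qed

lemma emb_perp_sub: "emb h \<perp> u \<Longrightarrow> 0 < h' \<Longrightarrow> h' \<le> h \<Longrightarrow> emb h' \<perp> u"
  by (erule perp_mono2) (auto simp: emb_nonneg_iff emb_le_iff)

text \<open>On the band of some \<open>h'\<close> the net is constant from \<open>n\<close> on. If
  \<open>h'\<close> met \<open>x n\<close>, some \<open>k' > 0\<close> below both would be disjoint
  from a later value \<open>x ?m\<close>, since \<open>inf \<bar>h\<bar> \<bar>x m\<bar>\<close> is
  null. Being also disjoint from \<open>x ?m - x n\<close>, it would be disjoint from
  \<open>x n\<close>, whose modulus dominates it.\<close>

lemma uc_zeroI: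
  assumes *: "\<And>g. 0 < g \<Longrightarrow> \<exists>h. 0 < h \<and> h \<le> g \<and> emb h \<perp> u" shows "u = 0"
proof -
  obtain x where x: "const_net x" "u = net_class x" by (rule uc_cases)
  have "null_net x"
    unfolding null_net_def
  proof (intro allI impI)
    fix g :: 'a assume "0 < g"
    then obtain h where h: "0 < h" "h \<le> g" "emb h \<perp> u" using * by blast
    obtain n h' where h': "0 < h'" "h' \<le> h" "\<And>m. n \<le> m \<Longrightarrow> h' \<perp> x m - x n"
      using const_netE[OF x(1) h(1)] by metis
    have xn: "h' \<perp> x n"
    proof (rule ccontr)
      assume "\<not> h' \<perp> x n"
      then have k: "0 < inf h' \<bar>x n\<bar>" using h'(1) by (auto simp: perp_def order_less_le)
      have "null_net (\<lambda>m. inf \<bar>h\<bar> \<bar>x m\<bar>)" using h(3) x emb_perp_class by blast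
      then obtain n' k' where k': "0 < k'" "k' \<le> inf h' \<bar>x n\<bar>" "\<And>m. n' \<le> m \<Longrightarrow> k' \<perp> inf \<bar>h\<bar> \<bar>x m\<bar>"
        using null_netE[OF _ k] by metis
      let ?m = "sup n n'"
      have "inf k' (inf h \<bar>x ?m\<bar>) = 0" using k'(3)[of ?m] k'(1) h(1) by (simp add: perp_def)
      moreover have "inf k' h = k'" using k' h' by (intro inf_absorb1) (auto intro: order_trans)
      ultimately have "inf k' \<bar>x ?m\<bar> = 0" by (simp add: inf_assoc[symmetric])
      then have 1: "k' \<perp> x ?m" using k'(1) by (simp add: perp_def)
      have "k' \<perp> x ?m - x n" by (rule perp_mono2[OF h'(3)]) (use k' in auto)
      from perp_diff[OF 1 this] have "k' \<perp> \<bar>x n\<bar>" by simp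
      then have "k' = 0" by (rule perp_le_zero) (use k' in auto)
      then show False using k' by simp
    qed
    have "h' \<perp> x m" if "n \<le> m" for m using perp_add[OF h'(3)[OF that] xn] by simp
    moreover have "h' \<le> g" using h'(2) h(2) by (rule order_trans)
    ultimately show "\<exists>n h. 0 < h \<and> h \<le> g \<and> (\<forall>m\<ge>n. h \<perp> x m)"
      using h'(1) by (intro exI[of _ n] exI[of _ h']) simp
  qed
  then show ?thesis using x class_eq_0 by blast
qed

text \<open>There is a \<open>g\<close> such that \<open>u\<close> is not disjoint from any
  \<open>h > 0\<close> below it; one such \<open>h\<close> has \<open>u\<close> equal to
  \<open>emb X\<close> on its band. Then \<open>inf h \<bar>X\<bar>\<close> is nonzero and lies
  below \<open>u\<close>.\<close>

lemma uc_dense: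
  assumes "0 < u" shows "\<exists>g. 0 < g \<and> emb g \<le> u"
proof -
  obtain g where g: "0 < g" "\<And>h. 0 < h \<Longrightarrow> h \<le> g \<Longrightarrow> \<not> emb h \<perp> u"
    using uc_zeroI[of u] assms by auto
  obtain h X where h: "0 < h" "h \<le> g" "emb h \<perp> u - emb X" using uc_local[OF g(1)] by metis
  have "\<not> h \<perp> X"
  proof
    assume "h \<perp> X"
    then have "emb h \<perp> (u - emb X) + emb X" using h(3) by (intro perp_add) (simp_all add: emb_perp_iff)
    then show False using g(2)[OF h(1,2)] by simp
  qed
  then have k: "0 < inf h \<bar>X\<bar>" using h(1) by (auto simp: perp_def order_less_le)
  \<comment> \<open>The excess over \<open>u\<close>. It is disjoint from \<open>emb h\<close>,
    where \<open>u\<close> and \<open>emb X\<close> agree, and yet lies below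
    \<open>emb h\<close>.\<close>
  let ?w = "pprt (emb (inf h \<bar>X\<bar>) - u)"
  have "emb (inf h \<bar>X\<bar>) - u \<le> \<bar>emb X\<bar> - \<bar>u\<bar>"
    using assms by (simp add: emb_inf emb_abs abs_of_pos)
  also have "\<dots> \<le> \<bar>emb X - u\<bar>" by (rule abs_triangle_ineq2)
  finally have "?w \<le> pprt \<bar>u - emb X\<bar>" by (intro pprt_mono) (simp add: abs_minus_commute)
  then have "\<bar>?w\<bar> \<le> \<bar>u - emb X\<bar>" by simp
  with h(3) have "emb h \<perp> ?w" by (rule perp_solid)
  moreover have "?w \<le> emb h"
  proof -
    have "emb (inf h \<bar>X\<bar>) - u \<le> emb h" using assms by (simp add: emb_inf diff_le_eq le_infI1 add_increasing2)
    then have "?w \<le> pprt (emb h)" by (rule pprt_mono)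
    then show ?thesis using h(1) by (simp add: emb_nonneg_iff)
  qed
  ultimately have "?w = 0" using perp_le_zero[OF perp_sym zero_le_pprt] by blast
  then have "emb (inf h \<bar>X\<bar>) \<le> u" by (simp only: le_iff_pprt)
  then show ?thesis using k by blast
qed

text \<open>The condition under which suprema exist in the quotient. The minorants of bounded
  families and those of disjoint families both satisfy it, so Dedekind and lateral completeness come
  from one existence result.\<close>

definition locally_bounded :: "'v::dc_vector_lattice set \<Rightarrow> bool"
  where "locally_bounded A \<longleftrightarrow>
    (\<forall>g>0. \<exists>h Y. 0 < h \<and> h \<le> g \<and> 0 \<le> Y \<and> (\<forall>x\<in>A. h \<perp> pprt (x - Y)))"

lemma pprt_local_le:
  assumes "emb h \<perp> b - emb X" "emb x \<le> b" shows "h \<perp> pprt (x - X)"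
proof -
  have "pprt (emb x - emb X) \<le> pprt (b - emb X)" using assms(2) by (intro pprt_mono) simp
  with perp_pprt[OF assms(1)] have "emb h \<perp> pprt (emb x - emb X)" by (rule perp_mono[OF _ zero_le_pprt])
  then show ?thesis by (simp only: emb_perp_iff emb_pprt[symmetric] emb_diff[symmetric])
qed

text \<open>On the band of \<open>h\<close> the classes \<open>s\<close> and \<open>b\<close> may be
  exchanged for the lattice elements \<open>X\<close> and \<open>Y\<close>, so a comparison of these
  is a local comparison of the classes.\<close>

lemma pprt_diff_trans:
  assumes "emb h \<perp> s - emb X" "emb h \<perp> b - emb Y" "h \<perp> pprt (X - Y)"
  shows "emb h \<perp> pprt (s - b)"
proof -
  have "emb h \<perp> pprt (s - emb X)" using assms(1) by (rule perp_pprt)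
  moreover have "emb h \<perp> pprt (emb X - emb Y)"
    using assms(3) by (simp only: emb_perp_iff emb_pprt[symmetric] emb_diff[symmetric])
  moreover have "emb h \<perp> pprt (- (b - emb Y))" using assms(2) by (intro perp_pprt) (simp only: perp_minus)
  ultimately have "emb h \<perp> pprt (s - emb X) + pprt (emb X - emb Y) + pprt (- (b - emb Y))"
    by (intro perp_add)
  moreover have "pprt (s - b) \<le> pprt (s - emb X) + pprt (emb X - emb Y) + pprt (- (b - emb Y))"
  proof -
    have "pprt (s - b) \<le> pprt (s - emb X) + pprt (emb X - b)"
      using pprt_add_le[of "s - emb X" "emb X - b"] by simp
    also have "pprt (emb X - b) \<le> pprt (emb X - emb Y) + pprt (- (b - emb Y))"
      using pprt_add_le[of "emb X - emb Y" "emb Y - b"] by simp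
    finally show ?thesis by (simp add: add.assoc)
  qed
  ultimately show ?thesis by (rule perp_mono[OF _ zero_le_pprt])
qed

lemma uc_leI:
  assumes "\<And>g. 0 < g \<Longrightarrow> \<exists>h. 0 < h \<and> h \<le> g \<and> emb h \<perp> pprt (s - b)" shows "s \<le> b"
proof -
  have "pprt (s - b) = 0" using assms by (rule uc_zeroI)
  then show ?thesis by (simp only: le_iff_pprt)
qed

text \<open>The net of the suprema \<open>s m\<close> of the truncations
  \<open>inf x (pprt m)\<close> represents the supremum. On the band of an \<open>h\<close> where
  \<open>Y\<close> bounds \<open>A\<close> it is constant from the index \<open>Y\<close> on,
  because truncating at \<open>m \<ge> Y\<close> changes nothing there.\<close>

lemma emb_lub_exists:
  fixes A :: "'v::dc_vector_lattice set"
  assumes A: "A \<noteq> {}" "\<And>x. x \<in> A \<Longrightarrow> 0 \<le> x" and bdd: "locally_bounded A"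
  shows "\<exists>s. lub (emb ` A) s"
proof -
  have "\<exists>s. lub ((\<lambda>x. inf x (pprt m)) ` A) s" for m :: 'v
    using A(1) by (intro lub_exists[of _ "pprt m"]) auto
  then obtain s where s: "\<And>m. lub ((\<lambda>x. inf x (pprt m)) ` A) (s m)" by metis
  have cs: "const_net s"
    unfolding const_net_def
  proof (intro allI impI)
    fix g :: 'v assume "0 < g"
    then obtain h Y where h: "0 < h" "h \<le> g" "0 \<le> Y" "\<And>x. x \<in> A \<Longrightarrow> h \<perp> pprt (x - Y)"
      using bdd unfolding locally_bounded_def by blast
    have "h \<perp> s m - s Y" if m: "Y \<le> m" for m
    proof -
      have "0 \<le> m" using h(3) m by (rule order_trans)
      then have pm: "pprt m = m" "pprt Y = Y" using h(3) by auto
      have "h \<perp> pprt (s m - Y)"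
      proof (rule lub_pprt_perp[OF s])
        fix a assume "a \<in> (\<lambda>x. inf x (pprt m)) ` A"
        then obtain x where x: "x \<in> A" "a = inf x (pprt m)" by auto
        have "pprt (a - Y) \<le> pprt (x - Y)" unfolding x(2) by (intro pprt_mono diff_right_mono) simp
        with h(4)[OF x(1)] show "h \<perp> pprt (a - Y)" by (rule perp_mono[OF _ zero_le_pprt])
      qed (use A in auto)
      \<comment> \<open>Truncation commutes with suprema, so the increment \<open>s m - s Y\<close>
        is exactly the excess of \<open>s m\<close> over \<open>Y\<close>.\<close>
      moreover have "s Y = inf Y (s m)"
      proof (rule lub_unique[OF s])
        have "(\<lambda>x. inf x (pprt Y)) ` A = inf Y ` (\<lambda>x. inf x (pprt m)) ` A"
          unfolding image_image pm using m
          by (intro image_cong refl) (metis inf_absorb1 inf_assoc inf_commute)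
        then show "lub ((\<lambda>x. inf x (pprt Y)) ` A) (inf Y (s m))" using lub_inf[OF s] by simp
      qed
      moreover have "s m - inf Y (s m) = pprt (s m - Y)"
        by (simp only: diff_inf_eq_sup add_sup_distrib_left pprt_def) simp
      ultimately show ?thesis by simp
    qed
    then show "\<exists>n h. 0 < h \<and> h \<le> g \<and> (\<forall>m\<ge>n. h \<perp> s m - s n)" using h by blast
  qed
  have "lub (emb ` A) (net_class s)"
  proof (rule lubI)
    fix u assume "u \<in> emb ` A"
    then obtain x where x: "x \<in> A" "u = emb x" by auto
    have "x \<le> s m" if "x \<le> m" for m
    proof -
      have "m \<le> pprt m" by (simp add: pprt_def)
      with that have "x \<le> pprt m" by (rule order_trans)
      then have "x = inf x (pprt m)" by (simp add: inf_absorb1)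
      also have "\<dots> \<le> s m" using x by (intro lub_ge[OF s]) auto
      finally show ?thesis .
    qed
    then have "null_net (\<lambda>m. pprt (x - s m))"
      by (intro null_net_eventually[of x]) simp
    then have "net_le (\<lambda>_. x) s" by (simp add: net_le_def)
    then show "u \<le> net_class s"
      by (simp add: x emb_class less_eq_uc.abs_eq net_eq_refl const_net_const cs)
  next
    fix b assume b: "\<And>u. u \<in> emb ` A \<Longrightarrow> u \<le> b"
    show "net_class s \<le> b"
    proof (rule uc_leI)
      fix g :: 'v assume "0 < g"
      then obtain h n where h: "0 < h" "h \<le> g" "emb h \<perp> net_class s - emb (s n)"
        using class_local[OF cs] by metis
      \<comment> \<open>On the band of \<open>h'\<close> the class of \<open>s\<close> is
        \<open>s n\<close> and the bound \<open>b\<close> is \<open>X\<close>; there every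
        \<open>x\<close> in \<open>A\<close> lies below \<open>X\<close>, hence so does
        \<open>s n\<close>.\<close>
      obtain h' X where h': "0 < h'" "h' \<le> h" "emb h' \<perp> b - emb X" using uc_local[OF h(1)] by metis
      have "h' \<perp> pprt (s n - X)"
      proof (rule lub_pprt_perp[OF s])
        fix a assume "a \<in> (\<lambda>x. inf x (pprt n)) ` A"
        then obtain x where x: "x \<in> A" "a = inf x (pprt n)" by auto
        have "h' \<perp> pprt (x - X)" using b x by (intro pprt_local_le[OF h'(3)]) auto
        moreover have "pprt (a - X) \<le> pprt (x - X)" unfolding x(2) by (intro pprt_mono diff_right_mono) simp
        ultimately show "h' \<perp> pprt (a - X)" by (rule perp_mono[OF _ zero_le_pprt])
      qed (use A in auto)
      then have "emb h' \<perp> pprt (net_class s - b)"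
        by (rule pprt_diff_trans[OF emb_perp_sub[OF h(3) h'(1,2)] h'(3)])
      moreover have "h' \<le> g" using h h' by (meson order_trans)
      ultimately show "\<exists>h. 0 < h \<and> h \<le> g \<and> emb h \<perp> pprt (net_class s - b)" using h'(1) by blast
    qed
  qed
  then show ?thesis ..
qed

definition minorants :: "'v::dc_vector_lattice uc set \<Rightarrow> 'v set"
  where "minorants A = {x. 0 \<le> x \<and> (\<exists>a\<in>A. emb x \<le> a)}"

text \<open>Density would give this through \<open>order_dense_lub\<close>, but that needs the
  Dedekind completeness of the quotient, whose proof relies on the present lemma. Locally
  \<open>a\<close> is \<open>pprt X\<close>; the truncations of \<open>pprt X\<close> at multiples
  of \<open>h\<close> are embedded minorants of \<open>a\<close>, and their supremum is the
  component of \<open>pprt X\<close> in the band of \<open>h\<close>.\<close>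

lemma uc_le_minorants:
  assumes a: "0 \<le> a" and s: "\<And>x. 0 \<le> x \<Longrightarrow> emb x \<le> a \<Longrightarrow> emb x \<le> s"
  shows "a \<le> s"
proof (rule uc_leI)
  fix g :: 'a assume "0 < g"
  then obtain h X where h: "0 < h" "h \<le> g" "emb h \<perp> a - emb X" using uc_local by metis
  obtain h' Z where h': "0 < h'" "h' \<le> h" "emb h' \<perp> s - emb Z" using uc_local[OF h(1)] by metis
  have hX: "emb h \<perp> a - emb (pprt X)"
  proof (rule perp_solid[OF h(3)])
    show "\<bar>a - emb (pprt X)\<bar> \<le> \<bar>a - emb X\<bar>"
      using pprt_diff_le[of a "emb X"] a by (simp add: emb_pprt)
  qed
  have h0: "0 \<le> h" using h by simp
  obtain p where p: "lub (range (\<lambda>n. inf (pprt X) (real n *\<^sub>R h))) p" "pprt X - p \<perp> h"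
    using band_projection_exists[OF zero_le_pprt h0] by metis
  have "emb (inf (pprt X) (real n *\<^sub>R h)) \<le> s" for n
  proof (rule s)
    let ?q = "inf (pprt X) (real n *\<^sub>R h)"
    have q0: "0 \<le> ?q" using h0 by (auto intro: nonneg_scaleR)
    then show "0 \<le> ?q" .
    \<comment> \<open>\<open>pprt X\<close> and \<open>a\<close> agree on the band of
      \<open>h\<close>, so the excess of the truncation over \<open>a\<close> is disjoint from
      \<open>h\<close>; but it lies below a multiple of \<open>h\<close>.\<close>
    let ?w = "pprt (emb ?q - a)"
    have "?w \<le> pprt (emb (pprt X) - a)"
      by (intro pprt_mono diff_right_mono) (simp add: emb_le_iff)
    moreover have "pprt (emb (pprt X) - a) \<perp> emb h"
    proof (rule perp_sym, rule perp_pprt)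
      have "emb h \<perp> - (a - emb (pprt X))" using hX by (simp only: perp_minus)
      then show "emb h \<perp> emb (pprt X) - a" by simp
    qed
    ultimately have "?w \<perp> emb h" using perp_mono2[OF _ zero_le_pprt] by blast
    then have "?w \<perp> real n *\<^sub>R emb h" by (rule perp_scaleR)
    moreover have "?w \<le> real n *\<^sub>R emb h"
    proof -
      have "emb ?q \<le> emb (real n *\<^sub>R h)" by (simp add: emb_le_iff)
      then have "emb ?q - a \<le> real n *\<^sub>R emb h" using a by (simp add: emb_scaleR diff_le_eq add_increasing2)
      then have "?w \<le> pprt (real n *\<^sub>R emb h)" by (rule pprt_mono)
      then show ?thesis using h0 by (simp add: nonneg_scaleR emb_nonneg_iff)
    qed
    ultimately have "?w = 0" by (intro perp_le_zero zero_le_pprt)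
    then show "emb ?q \<le> a" by (simp only: le_iff_pprt)
  qed
  then have "h' \<perp> pprt (inf (pprt X) (real n *\<^sub>R h) - Z)" for n by (rule pprt_local_le[OF h'(3)])
  then have "h' \<perp> pprt (p - Z)" by (intro lub_pprt_perp[OF p(1)]) auto
  moreover have "h' \<perp> pprt X - p" by (rule perp_sym, rule perp_mono[OF p(2)]) (use h' in auto)
  ultimately have "h' \<perp> pprt (pprt X - p) + pprt (p - Z)" using perp_add perp_pprt by blast
  moreover have "pprt (pprt X - Z) \<le> pprt (pprt X - p) + pprt (p - Z)"
    using pprt_add_le[of "pprt X - p" "p - Z"] by simp
  ultimately have "h' \<perp> pprt (pprt X - Z)" by (rule perp_mono[OF _ zero_le_pprt])
  then have "emb h' \<perp> pprt (a - s)"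
    by (rule pprt_diff_trans[OF emb_perp_sub[OF hX h'(1,2)] h'(3)])
  moreover have "h' \<le> g" using h h' by (meson order_trans)
  ultimately show "\<exists>h. 0 < h \<and> h \<le> g \<and> emb h \<perp> pprt (a - s)" using h'(1) by blast
qed

lemma uc_lub_exists:
  assumes A: "A \<noteq> {}" "\<And>a. a \<in> A \<Longrightarrow> 0 \<le> a" and bdd: "locally_bounded (minorants A)"
  shows "\<exists>s. lub A s"
proof -
  obtain a where "a \<in> A" using A(1) by blast
  then have "0 \<in> minorants A" using A(2)[of a] by (auto simp: minorants_def emb_0)
  then have "minorants A \<noteq> {}" by blast
  then have "\<exists>s. lub (emb ` minorants A) s"
    by (rule emb_lub_exists[OF _ _ bdd]) (simp add: minorants_def)
  then obtain s where s: "lub (emb ` minorants A) s" ..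
  have "lub A s"
  proof (rule lubI)
    fix a assume a: "a \<in> A"
    show "a \<le> s"
      by (rule uc_le_minorants[OF A(2)[OF a]], rule lub_ge[OF s]) (use a in \<open>auto simp: minorants_def\<close>)
  next
    fix b assume b: "\<And>a. a \<in> A \<Longrightarrow> a \<le> b"
    show "s \<le> b"
      by (rule lub_le[OF s]) (use b in \<open>auto simp: minorants_def intro: order_trans\<close>)
  qed
  then show ?thesis ..
qed

lemma uc_local_pprt:
  assumes "0 < g"
  obtains h Y where "0 < h" "h \<le> g" "0 \<le> Y" "\<And>x. emb x \<le> b \<Longrightarrow> h \<perp> pprt (x - Y)"
proof -
  obtain h X where h: "0 < h" "h \<le> g" "emb h \<perp> b - emb X" using uc_local[OF assms] by metis
  have "h \<perp> pprt (x - pprt X)" if "emb x \<le> b" for x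
  proof (rule perp_mono[OF pprt_local_le[OF h(3) that]])
    show "pprt (x - pprt X) \<le> pprt (x - X)" by (intro pprt_mono diff_left_mono) (simp add: pprt_def)
  qed simp
  then show thesis using that h zero_le_pprt by blast
qed

instance uc :: (dc_vector_lattice) dc_vector_lattice
proof
  fix A :: "'a uc set" and b
  assume A: "A \<noteq> {}" and b: "\<And>a. a \<in> A \<Longrightarrow> a \<le> b"
  obtain a0 where a0: "a0 \<in> A" using A by auto
  \<comment> \<open>Passing to \<open>sup a a0 - a0\<close> makes the family positive. As
    \<open>a0\<close> belongs to \<open>A\<close>, the upper bounds are only translated by
    \<open>a0\<close>.\<close>
  let ?B = "(\<lambda>a. sup a a0 - a0) ` A"
  have "\<exists>t. lub ?B t"
  proof (rule uc_lub_exists)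
    show "?B \<noteq> {}" using A by simp
    show "0 \<le> a" if "a \<in> ?B" for a using that by auto
    show "locally_bounded (minorants ?B)"
      unfolding locally_bounded_def
    proof (intro allI impI)
      fix g :: 'a assume "0 < g"
      then obtain h Y where h: "0 < h" "h \<le> g" "0 \<le> Y" "\<And>x. emb x \<le> b - a0 \<Longrightarrow> h \<perp> pprt (x - Y)"
        using uc_local_pprt by metis
      have "emb x \<le> b - a0" if "x \<in> minorants ?B" for x
      proof -
        obtain a where a: "a \<in> A" "emb x \<le> sup a a0 - a0" using \<open>x \<in> minorants ?B\<close> by (auto simp: minorants_def)
        have "sup a a0 - a0 \<le> b - a0" using b a a0 by (simp del: diff_le_eq)
        with a(2) show ?thesis by (rule order_trans)
      qed
      then show "\<exists>h Y. 0 < h \<and> h \<le> g \<and> 0 \<le> Y \<and> (\<forall>x\<in>minorants ?B. h \<perp> pprt (x - Y))"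
        using h by blast
    qed
  qed
  then obtain t where t: "lub ?B t" ..
  have "a \<le> t + a0" if "a \<in> A" for a
  proof -
    have "sup a a0 - a0 \<le> t" using that by (intro lub_ge[OF t]) auto
    then have "sup a a0 \<le> t + a0" by (simp only: diff_le_eq)
    then show ?thesis by simp
  qed
  moreover have "t + a0 \<le> c" if c: "\<forall>a\<in>A. a \<le> c" for c
  proof -
    have "t \<le> c - a0"
      by (rule lub_le[OF t]) (use c a0 in \<open>auto simp: diff_right_mono\<close>)
    then show ?thesis by (simp only: le_diff_eq)
  qed
  ultimately show "\<exists>s. (\<forall>a\<in>A. a \<le> s) \<and> (\<forall>b. (\<forall>a\<in>A. a \<le> b) \<longrightarrow> s \<le> b)" by blast
qed

text \<open>If a member \<open>a0\<close> meets \<open>emb g\<close>, there is \<open>k > 0\<close>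
  with \<open>emb k\<close> below both. All other members are disjoint from \<open>emb k\<close>, so
  below \<open>k\<close> only the local bound of \<open>a0\<close> matters. If no member meets
  \<open>emb g\<close>, the bound 0 serves.\<close>

lemma uc_laterally_complete: "laterally_complete (UNIV :: 'v::dc_vector_lattice uc set)"
  unfolding laterally_complete_def
proof (intro allI impI, elim conjE)
  fix A :: "'v uc set"
  assume pos: "\<forall>a\<in>A. 0 \<le> a" and disj: "\<forall>x\<in>A. \<forall>y\<in>A. x \<noteq> y \<longrightarrow> x \<perp> y"
  show "\<exists>b\<in>UNIV. \<forall>a\<in>A. a \<le> b"
  proof (cases "A = {}")
    case False
    have "locally_bounded (minorants A)"
      unfolding locally_bounded_def
    proof (intro allI impI)
      fix g :: 'v assume g: "0 < g"
      show "\<exists>h Y. 0 < h \<and> h \<le> g \<and> 0 \<le> Y \<and> (\<forall>x\<in>minorants A. h \<perp> pprt (x - Y))"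
      proof (cases "\<forall>a\<in>A. a \<perp> emb g")
        case True
        have "g \<perp> pprt (x - 0)" if "x \<in> minorants A" for x
        proof -
          obtain a where a: "a \<in> A" "0 \<le> x" "emb x \<le> a" using \<open>x \<in> minorants A\<close> by (auto simp: minorants_def)
          have "emb g \<perp> emb x"
            using perp_mono[OF perp_sym[OF True[rule_format, OF a(1)]]] a by (simp add: emb_nonneg_iff)
          then show ?thesis using a(2) by (simp add: emb_perp_iff)
        qed
        then show ?thesis using g by blast
      next
        case False
        then obtain a0 where a0: "a0 \<in> A" "\<not> a0 \<perp> emb g" by blast
        have a00: "0 \<le> a0" using pos a0 by blast
        have "0 < inf a0 (emb g)"
          using a0(2) a00 g by (simp add: perp_pos emb_nonneg_iff order_less_le)
        then obtain k where k: "0 < k" "emb k \<le> inf a0 (emb g)" using uc_dense by blast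
        obtain h Y where h: "0 < h" "h \<le> k" "0 \<le> Y" "\<And>x. emb x \<le> a0 \<Longrightarrow> h \<perp> pprt (x - Y)"
          using uc_local_pprt[OF k(1)] by metis
        have "h \<perp> pprt (x - Y)" if "x \<in> minorants A" for x
        proof -
          obtain a where a: "a \<in> A" "0 \<le> x" "emb x \<le> a" using \<open>x \<in> minorants A\<close> by (auto simp: minorants_def)
          show ?thesis
          proof (cases "a = a0")
            case False
            then have "a0 \<perp> a" using disj a(1) a0(1) by simp
            moreover have "0 \<le> emb x" using a(2) by (simp only: emb_nonneg_iff)
            ultimately have 1: "a0 \<perp> emb x" using a(3) by (rule perp_mono)
            have "emb h \<le> emb k" using h by (simp add: emb_le_iff)
            also have "emb k \<le> a0" using k(2) by simp
            finally have "emb h \<le> a0" .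
            moreover have "0 \<le> emb h" using h(1) by (simp add: emb_nonneg_iff)
            ultimately have "emb h \<perp> emb x" using perp_mono2[OF 1] by blast
            then have "h \<perp> x" by (simp add: emb_perp_iff)
            moreover have "pprt (x - Y) \<le> x"
              using pprt_mono[of "x - Y" x] h(3) a(2) by simp
            ultimately show ?thesis by (rule perp_mono[OF _ zero_le_pprt])
          qed (use a(3) h(4) in simp)
        qed
        moreover have "h \<le> g"
        proof -
          have "emb k \<le> emb g" using k(2) by simp
          then show ?thesis using h by (simp add: emb_le_iff)
        qed
        ultimately show ?thesis using h by blast
      qed
    qed
    then obtain s where "lub A s" using uc_lub_exists[OF False] pos by blast
    then show ?thesis by (auto simp: lub_def)
  qed simp
qed

lemma emb_order_dense: "order_dense_in (range emb) UNIV"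
  unfolding order_dense_in_def using uc_dense by (force simp: emb_pos_iff)

lemma range_emb_ideal: "order_ideal (range emb)"
proof (rule order_dense_complete_ideal[OF _ _ _ _ _ _ emb_order_dense])
  show "0 \<in> range emb" using emb_0 by (metis rangeI)
  show "x + y \<in> range emb" if "x \<in> range emb" "y \<in> range emb" for x y :: "'a uc"
    using that by (auto simp: emb_add[symmetric])
  show "c *\<^sub>R x \<in> range emb" if "x \<in> range emb" for x :: "'a uc" and c
    using that by (auto simp: emb_scaleR[symmetric])
  show "\<bar>x\<bar> \<in> range emb" if "x \<in> range emb" for x :: "'a uc"
    using that by (auto simp: emb_abs[symmetric])
  show "order_ideal (UNIV :: 'a uc set)" by (simp add: order_ideal_def)
  fix A :: "'a uc set" and b
  assume A: "A \<subseteq> range emb" "A \<noteq> {}" and b: "b \<in> range emb" "\<And>a. a \<in> A \<Longrightarrow> a \<le> b"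
  obtain A' where A': "A = emb ` A'" using A(1) by (auto simp: subset_image_iff)
  obtain b' where b': "b = emb b'" using b(1) by auto
  have "a \<le> b'" if "a \<in> A'" for a using b(2)[of "emb a"] that by (simp add: A' b' emb_le_iff)
  moreover have "A' \<noteq> {}" using A(2) A' by simp
  ultimately have "\<exists>s. lub A' s" using lub_exists by blast
  then obtain s where "lub A' s" ..
  then show "\<exists>s\<in>range emb. (\<forall>a\<in>A. a \<le> s) \<and> (\<forall>c\<in>range emb. (\<forall>a\<in>A. a \<le> c) \<longrightarrow> s \<le> c)"
    by (intro bexI[of _ "emb s"]) (auto simp: A' lub_def emb_le_iff)
qed auto

section \<open>Carrier-based Riesz spaces inside a type\<close>

lemma riesz_space_facts:
  assumes "riesz_space F"
  shows riesz_zero: "\<zero>\<^bsub>F\<^esub> \<in> carrier F"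
    and riesz_add: "x \<in> carrier F \<Longrightarrow> y \<in> carrier F \<Longrightarrow> x \<oplus>\<^bsub>F\<^esub> y \<in> carrier F"
    and riesz_add_assoc: "x \<in> carrier F \<Longrightarrow> y \<in> carrier F \<Longrightarrow> z \<in> carrier F \<Longrightarrow>
      x \<oplus>\<^bsub>F\<^esub> y \<oplus>\<^bsub>F\<^esub> z = x \<oplus>\<^bsub>F\<^esub> (y \<oplus>\<^bsub>F\<^esub> z)"
    and riesz_add_comm: "x \<in> carrier F \<Longrightarrow> y \<in> carrier F \<Longrightarrow> x \<oplus>\<^bsub>F\<^esub> y = y \<oplus>\<^bsub>F\<^esub> x"
    and riesz_zero_add: "x \<in> carrier F \<Longrightarrow> \<zero>\<^bsub>F\<^esub> \<oplus>\<^bsub>F\<^esub> x = x"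
    and riesz_smult: "x \<in> carrier F \<Longrightarrow> a \<odot>\<^bsub>F\<^esub> x \<in> carrier F"
    and riesz_smult_ldistr: "x \<in> carrier F \<Longrightarrow> (a + b) \<odot>\<^bsub>F\<^esub> x = a \<odot>\<^bsub>F\<^esub> x \<oplus>\<^bsub>F\<^esub> b \<odot>\<^bsub>F\<^esub> x"
    and riesz_smult_rdistr: "x \<in> carrier F \<Longrightarrow> y \<in> carrier F \<Longrightarrow>
      a \<odot>\<^bsub>F\<^esub> (x \<oplus>\<^bsub>F\<^esub> y) = a \<odot>\<^bsub>F\<^esub> x \<oplus>\<^bsub>F\<^esub> a \<odot>\<^bsub>F\<^esub> y"
    and riesz_smult_assoc: "x \<in> carrier F \<Longrightarrow> (a * b) \<odot>\<^bsub>F\<^esub> x = a \<odot>\<^bsub>F\<^esub> (b \<odot>\<^bsub>F\<^esub> x)"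
    and riesz_smult_one: "x \<in> carrier F \<Longrightarrow> 1 \<odot>\<^bsub>F\<^esub> x = x"
    and riesz_left_inv: "x \<in> carrier F \<Longrightarrow> (-1) \<odot>\<^bsub>F\<^esub> x \<oplus>\<^bsub>F\<^esub> x = \<zero>\<^bsub>F\<^esub>"
    and riesz_minus: "x \<in> carrier F \<Longrightarrow> \<ominus>\<^bsub>F\<^esub> x = (-1) \<odot>\<^bsub>F\<^esub> x"
    and riesz_refl: "x \<in> carrier F \<Longrightarrow> x \<preceq>\<^bsub>F\<^esub> x"
    and riesz_antisym: "x \<in> carrier F \<Longrightarrow> y \<in> carrier F \<Longrightarrow> x \<preceq>\<^bsub>F\<^esub> y \<Longrightarrow> y \<preceq>\<^bsub>F\<^esub> x \<Longrightarrow> x = y"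
    and riesz_trans: "x \<in> carrier F \<Longrightarrow> y \<in> carrier F \<Longrightarrow> z \<in> carrier F \<Longrightarrow>
      x \<preceq>\<^bsub>F\<^esub> y \<Longrightarrow> y \<preceq>\<^bsub>F\<^esub> z \<Longrightarrow> x \<preceq>\<^bsub>F\<^esub> z"
    and riesz_join: "x \<in> carrier F \<Longrightarrow> y \<in> carrier F \<Longrightarrow> x \<squnion>\<^bsub>ord_of F\<^esub> y \<in> carrier F"
    and riesz_join_left: "x \<in> carrier F \<Longrightarrow> y \<in> carrier F \<Longrightarrow> x \<preceq>\<^bsub>F\<^esub> x \<squnion>\<^bsub>ord_of F\<^esub> y"
    and riesz_join_right: "x \<in> carrier F \<Longrightarrow> y \<in> carrier F \<Longrightarrow> y \<preceq>\<^bsub>F\<^esub> x \<squnion>\<^bsub>ord_of F\<^esub> y"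
    and riesz_join_le: "x \<in> carrier F \<Longrightarrow> y \<in> carrier F \<Longrightarrow> z \<in> carrier F \<Longrightarrow>
      x \<preceq>\<^bsub>F\<^esub> z \<Longrightarrow> y \<preceq>\<^bsub>F\<^esub> z \<Longrightarrow> x \<squnion>\<^bsub>ord_of F\<^esub> y \<preceq>\<^bsub>F\<^esub> z"
    and riesz_meet: "x \<in> carrier F \<Longrightarrow> y \<in> carrier F \<Longrightarrow> x \<sqinter>\<^bsub>ord_of F\<^esub> y \<in> carrier F"
    and riesz_meet_left: "x \<in> carrier F \<Longrightarrow> y \<in> carrier F \<Longrightarrow> x \<sqinter>\<^bsub>ord_of F\<^esub> y \<preceq>\<^bsub>F\<^esub> x"
    and riesz_meet_right: "x \<in> carrier F \<Longrightarrow> y \<in> carrier F \<Longrightarrow> x \<sqinter>\<^bsub>ord_of F\<^esub> y \<preceq>\<^bsub>F\<^esub> y"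
    and riesz_meet_le: "x \<in> carrier F \<Longrightarrow> y \<in> carrier F \<Longrightarrow> z \<in> carrier F \<Longrightarrow>
      z \<preceq>\<^bsub>F\<^esub> x \<Longrightarrow> z \<preceq>\<^bsub>F\<^esub> y \<Longrightarrow> z \<preceq>\<^bsub>F\<^esub> x \<sqinter>\<^bsub>ord_of F\<^esub> y"
    and riesz_add_mono: "x \<in> carrier F \<Longrightarrow> y \<in> carrier F \<Longrightarrow> z \<in> carrier F \<Longrightarrow>
      x \<preceq>\<^bsub>F\<^esub> y \<Longrightarrow> z \<oplus>\<^bsub>F\<^esub> x \<preceq>\<^bsub>F\<^esub> z \<oplus>\<^bsub>F\<^esub> y"
    and riesz_smult_nonneg: "x \<in> carrier F \<Longrightarrow> 0 \<le> a \<Longrightarrow> \<zero>\<^bsub>F\<^esub> \<preceq>\<^bsub>F\<^esub> x \<Longrightarrow> \<zero>\<^bsub>F\<^esub> \<preceq>\<^bsub>F\<^esub> a \<odot>\<^bsub>F\<^esub> x"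
proof -
  interpret riesz_space F by fact
  have c: "carrier real_ring = UNIV" "\<And>a b. a \<oplus>\<^bsub>real_ring\<^esub> b = a + b" "\<And>a b. a \<otimes>\<^bsub>real_ring\<^esub> b = a * b"
    "\<one>\<^bsub>real_ring\<^esub> = 1" "\<zero>\<^bsub>real_ring\<^esub> = 0"
    by (simp_all add: real_ring_def)
  have o: "carrier (ord_of F) = carrier F" "\<And>x y. x \<sqsubseteq>\<^bsub>ord_of F\<^esub> y \<longleftrightarrow> x \<preceq>\<^bsub>F\<^esub> y" "\<And>x y. x .=\<^bsub>ord_of F\<^esub> y \<longleftrightarrow> x = y"
    by (simp_all add: ord_of_def)
  show "\<zero>\<^bsub>F\<^esub> \<in> carrier F" by simp
  show "x \<oplus>\<^bsub>F\<^esub> y \<in> carrier F" if "x \<in> carrier F" "y \<in> carrier F" for x y using that by simp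
  show "x \<oplus>\<^bsub>F\<^esub> y \<oplus>\<^bsub>F\<^esub> z = x \<oplus>\<^bsub>F\<^esub> (y \<oplus>\<^bsub>F\<^esub> z)" if "x \<in> carrier F" "y \<in> carrier F" "z \<in> carrier F" for x y z
    using that by (rule M.a_assoc)
  show comm: "x \<oplus>\<^bsub>F\<^esub> y = y \<oplus>\<^bsub>F\<^esub> x" if "x \<in> carrier F" "y \<in> carrier F" for x y
    using that by (rule M.a_comm)
  show "\<zero>\<^bsub>F\<^esub> \<oplus>\<^bsub>F\<^esub> x = x" if "x \<in> carrier F" for x using that by simp
  show sm: "a \<odot>\<^bsub>F\<^esub> x \<in> carrier F" if "x \<in> carrier F" for a x using that by (simp add: c)
  show ld: "(a + b) \<odot>\<^bsub>F\<^esub> x = a \<odot>\<^bsub>F\<^esub> x \<oplus>\<^bsub>F\<^esub> b \<odot>\<^bsub>F\<^esub> x" if "x \<in> carrier F" for a b x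
    using smult_l_distr[of a b x] that by (simp add: c)
  show "a \<odot>\<^bsub>F\<^esub> (x \<oplus>\<^bsub>F\<^esub> y) = a \<odot>\<^bsub>F\<^esub> x \<oplus>\<^bsub>F\<^esub> a \<odot>\<^bsub>F\<^esub> y" if "x \<in> carrier F" "y \<in> carrier F" for a x y
    using smult_r_distr[of a x y] that by (simp add: c)
  show "(a * b) \<odot>\<^bsub>F\<^esub> x = a \<odot>\<^bsub>F\<^esub> (b \<odot>\<^bsub>F\<^esub> x)" if "x \<in> carrier F" for a b x
    using smult_assoc1[of a b x] that by (simp add: c)
  show one: "1 \<odot>\<^bsub>F\<^esub> x = x" if "x \<in> carrier F" for x using smult_one[of x] that by (simp add: c)
  show li: "(-1) \<odot>\<^bsub>F\<^esub> x \<oplus>\<^bsub>F\<^esub> x = \<zero>\<^bsub>F\<^esub>" if x: "x \<in> carrier F" for x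
  proof -
    have "0 \<odot>\<^bsub>F\<^esub> x \<oplus>\<^bsub>F\<^esub> 0 \<odot>\<^bsub>F\<^esub> x = 0 \<odot>\<^bsub>F\<^esub> x"
      using ld[OF x, of 0 0] by simp
    then have "0 \<odot>\<^bsub>F\<^esub> x = \<zero>\<^bsub>F\<^esub>"
      using M.r_neg1[OF sm[OF x] sm[OF x], of 0 0] M.l_neg[OF sm[OF x], of 0] by simp
    then show ?thesis using ld[OF x, of "-1" 1] one[OF x] by simp
  qed
  show "\<ominus>\<^bsub>F\<^esub> x = (-1) \<odot>\<^bsub>F\<^esub> x" if "x \<in> carrier F" for x
    using li[OF that] sm[OF that] that by (metis M.minus_equality)
  show "x \<preceq>\<^bsub>F\<^esub> x" if "x \<in> carrier F" for x using order.le_refl[of x] that by (simp add: o)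
  show "x = y" if "x \<in> carrier F" "y \<in> carrier F" "x \<preceq>\<^bsub>F\<^esub> y" "y \<preceq>\<^bsub>F\<^esub> x" for x y
    using order.le_antisym[of x y] that by (simp add: o)
  show "x \<preceq>\<^bsub>F\<^esub> z" if "x \<in> carrier F" "y \<in> carrier F" "z \<in> carrier F" "x \<preceq>\<^bsub>F\<^esub> y" "y \<preceq>\<^bsub>F\<^esub> z" for x y z
    using order.le_trans[of x y z] that by (simp add: o)
  show "x \<squnion>\<^bsub>ord_of F\<^esub> y \<in> carrier F" if "x \<in> carrier F" "y \<in> carrier F" for x y
    using order.join_closed[of x y] that by (simp add: o)
  show "x \<preceq>\<^bsub>F\<^esub> x \<squnion>\<^bsub>ord_of F\<^esub> y" if "x \<in> carrier F" "y \<in> carrier F" for x y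
    using order.join_left[of x y] that by (simp add: o)
  show "y \<preceq>\<^bsub>F\<^esub> x \<squnion>\<^bsub>ord_of F\<^esub> y" if "x \<in> carrier F" "y \<in> carrier F" for x y
    using order.join_right[of x y] that by (simp add: o)
  show "x \<squnion>\<^bsub>ord_of F\<^esub> y \<preceq>\<^bsub>F\<^esub> z"
    if "x \<in> carrier F" "y \<in> carrier F" "z \<in> carrier F" "x \<preceq>\<^bsub>F\<^esub> z" "y \<preceq>\<^bsub>F\<^esub> z" for x y z
    using order.join_le[of x z y] that by (simp add: o)
  show "x \<sqinter>\<^bsub>ord_of F\<^esub> y \<in> carrier F" if "x \<in> carrier F" "y \<in> carrier F" for x y
    using order.meet_closed[of x y] that by (simp add: o)
  show "x \<sqinter>\<^bsub>ord_of F\<^esub> y \<preceq>\<^bsub>F\<^esub> x" if "x \<in> carrier F" "y \<in> carrier F" for x y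
    using order.meet_left[of x y] that by (simp add: o)
  show "x \<sqinter>\<^bsub>ord_of F\<^esub> y \<preceq>\<^bsub>F\<^esub> y" if "x \<in> carrier F" "y \<in> carrier F" for x y
    using order.meet_right[of x y] that by (simp add: o)
  show "z \<preceq>\<^bsub>F\<^esub> x \<sqinter>\<^bsub>ord_of F\<^esub> y"
    if "x \<in> carrier F" "y \<in> carrier F" "z \<in> carrier F" "z \<preceq>\<^bsub>F\<^esub> x" "z \<preceq>\<^bsub>F\<^esub> y" for x y z
    using order.meet_le[of z x y] that by (simp add: o)
  show "z \<oplus>\<^bsub>F\<^esub> x \<preceq>\<^bsub>F\<^esub> z \<oplus>\<^bsub>F\<^esub> y"
    if "x \<in> carrier F" "y \<in> carrier F" "z \<in> carrier F" "x \<preceq>\<^bsub>F\<^esub> y" for x y z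
    using add_mono[of x y z] that comm by simp
  show "\<zero>\<^bsub>F\<^esub> \<preceq>\<^bsub>F\<^esub> a \<odot>\<^bsub>F\<^esub> x" if "x \<in> carrier F" "0 \<le> a" "\<zero>\<^bsub>F\<^esub> \<preceq>\<^bsub>F\<^esub> x" for a x
    using smult_nonneg[of a x] that by simp
qed

lemma Upper_eq: "A \<subseteq> carrier E \<Longrightarrow> Upper (ord_of E) A = {u \<in> carrier E. \<forall>a\<in>A. a \<preceq>\<^bsub>E\<^esub> u}"
  by (fastforce simp: Upper_def ord_of_def)

lemma Lower_eq: "A \<subseteq> carrier E \<Longrightarrow> Lower (ord_of E) A = {u \<in> carrier E. \<forall>a\<in>A. u \<preceq>\<^bsub>E\<^esub> a}"
  by (fastforce simp: Lower_def ord_of_def)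

lemma is_lub_iff:
  "A \<subseteq> carrier E \<Longrightarrow> is_lub (ord_of E) s A \<longleftrightarrow>
    s \<in> carrier E \<and> (\<forall>a\<in>A. a \<preceq>\<^bsub>E\<^esub> s) \<and> (\<forall>u\<in>carrier E. (\<forall>a\<in>A. a \<preceq>\<^bsub>E\<^esub> u) \<longrightarrow> s \<preceq>\<^bsub>E\<^esub> u)"
  by (simp add: least_def Upper_eq) (auto simp: ord_of_def)

lemma is_glb_iff:
  "A \<subseteq> carrier E \<Longrightarrow> is_glb (ord_of E) s A \<longleftrightarrow>
    s \<in> carrier E \<and> (\<forall>a\<in>A. s \<preceq>\<^bsub>E\<^esub> a) \<and> (\<forall>u\<in>carrier E. (\<forall>a\<in>A. u \<preceq>\<^bsub>E\<^esub> a) \<longrightarrow> u \<preceq>\<^bsub>E\<^esub> s)"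
  by (simp add: greatest_def Lower_eq) (auto simp: ord_of_def)

lemma Upper_nonempty_iff:
  "A \<subseteq> carrier E \<Longrightarrow> Upper (ord_of E) A \<noteq> {} \<longleftrightarrow> (\<exists>b\<in>carrier E. \<forall>a\<in>A. a \<preceq>\<^bsub>E\<^esub> b)"
  by (auto simp: Upper_eq)

text \<open>
  Every Dedekind complete Riesz space over a type is an ideal in the product of all of them. This
  product is itself a type, so that spaces with an explicit carrier can be handled in a type class.
\<close>

typedef 'a dprod = "{f :: 'a riesz \<Rightarrow> 'a. \<forall>F. if dedekind_complete F then f F \<in> carrier F else f F = undefined}"
proof
  show "(\<lambda>F. if dedekind_complete F then \<zero>\<^bsub>F\<^esub> else undefined) \<in>
      {f. \<forall>F. if dedekind_complete F then f F \<in> carrier F else f F = undefined}"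
    by (auto simp: dedekind_complete_def riesz_zero)
qed

setup_lifting type_definition_dprod

lemma dc_riesz: "dedekind_complete F \<Longrightarrow> riesz_space F"
  by (simp add: dedekind_complete_def)

lift_definition cmp :: "'a dprod \<Rightarrow> 'a riesz \<Rightarrow> 'a" is "\<lambda>f F. f F" .

lemma cmp_closed: "dedekind_complete F \<Longrightarrow> cmp f F \<in> carrier F"
  by transfer (simp split: if_splits)

lemma dprod_eqI: "(\<And>F. dedekind_complete F \<Longrightarrow> cmp f F = cmp g F) \<Longrightarrow> f = g"
  by transfer (rule ext, metis)

text \<open>Values outside the carrier are replaced by zero, so that componentwise operations can be
  defined first and their closure invoked only when components are computed.\<close>

lift_definition mk_dprod :: "('a riesz \<Rightarrow> 'a) \<Rightarrow> 'a dprod"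
  is "\<lambda>f F. if dedekind_complete F then if f F \<in> carrier F then f F else \<zero>\<^bsub>F\<^esub> else undefined"
  by (simp add: dc_riesz riesz_zero)

lemma cmp_mk: "dedekind_complete F \<Longrightarrow> f F \<in> carrier F \<Longrightarrow> cmp (mk_dprod f) F = f F"
  by transfer simp

instantiation dprod :: (type) "{zero, plus, uminus, minus, scaleR, ord, sup, inf, abs}"
begin
definition "0 = mk_dprod (\<lambda>F. \<zero>\<^bsub>F\<^esub>)"
definition "f + g = mk_dprod (\<lambda>F. cmp f F \<oplus>\<^bsub>F\<^esub> cmp g F)"
definition "c *\<^sub>R f = mk_dprod (\<lambda>F. c \<odot>\<^bsub>F\<^esub> cmp f F)"
definition "- f = (-1) *\<^sub>R (f :: 'a dprod)"
definition "f - g = f + (-1) *\<^sub>R (g :: 'a dprod)"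
definition "f \<le> g \<longleftrightarrow> (\<forall>F. dedekind_complete F \<longrightarrow> cmp f F \<preceq>\<^bsub>F\<^esub> cmp g F)"
definition "f < g \<longleftrightarrow> f \<le> g \<and> \<not> g \<le> (f :: 'a dprod)"
definition "sup f g = mk_dprod (\<lambda>F. cmp f F \<squnion>\<^bsub>ord_of F\<^esub> cmp g F)"
definition "inf f g = mk_dprod (\<lambda>F. cmp f F \<sqinter>\<^bsub>ord_of F\<^esub> cmp g F)"
definition "\<bar>f\<bar> = sup f (- f :: 'a dprod)"
instance ..
end

context
  fixes F :: "'a riesz" assumes F: "dedekind_complete F"
begin
lemma cmp_zero: "cmp 0 F = \<zero>\<^bsub>F\<^esub>"
  by (simp add: zero_dprod_def cmp_mk F dc_riesz riesz_zero)
lemma cmp_add: "cmp (f + g) F = cmp f F \<oplus>\<^bsub>F\<^esub> cmp g F"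
  by (simp add: plus_dprod_def cmp_mk F dc_riesz riesz_add cmp_closed)
lemma cmp_scaleR: "cmp (c *\<^sub>R f) F = c \<odot>\<^bsub>F\<^esub> cmp f F"
  by (simp add: scaleR_dprod_def cmp_mk F dc_riesz riesz_smult cmp_closed)
lemma cmp_sup: "cmp (sup f g) F = cmp f F \<squnion>\<^bsub>ord_of F\<^esub> cmp g F"
  by (simp add: sup_dprod_def cmp_mk F dc_riesz riesz_join cmp_closed)
lemma cmp_inf: "cmp (inf f g) F = cmp f F \<sqinter>\<^bsub>ord_of F\<^esub> cmp g F"
  by (simp add: inf_dprod_def cmp_mk F dc_riesz riesz_meet cmp_closed)
end

instance dprod :: (type) real_vector
proof
  fix x y z :: "'a dprod" and a b :: real
  note [simp] = cmp_zero cmp_add cmp_scaleR cmp_closed dc_riesz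
  show "x + y + z = x + (y + z)" by (rule dprod_eqI) (simp add: riesz_add_assoc)
  show "x + y = y + x" by (rule dprod_eqI) (simp add: riesz_add_comm)
  show "0 + x = x" by (rule dprod_eqI) (simp add: riesz_zero_add)
  show "- x + x = 0" by (rule dprod_eqI) (simp add: uminus_dprod_def riesz_left_inv)
  show "x - y = x + - y" by (simp add: uminus_dprod_def minus_dprod_def)
  show "a *\<^sub>R (x + y) = a *\<^sub>R x + a *\<^sub>R y" by (rule dprod_eqI) (simp add: riesz_smult_rdistr)
  show "(a + b) *\<^sub>R x = a *\<^sub>R x + b *\<^sub>R x" by (rule dprod_eqI) (simp add: riesz_smult_ldistr)
  show "a *\<^sub>R b *\<^sub>R x = (a * b) *\<^sub>R x" by (rule dprod_eqI) (simp add: riesz_smult_assoc)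
  show "1 *\<^sub>R x = x" by (rule dprod_eqI) (simp add: riesz_smult_one)
qed

instance dprod :: (type) "{ordered_ab_group_add, lattice}"
proof
  fix x y z :: "'a dprod"
  note [simp] = cmp_zero cmp_add cmp_sup cmp_inf cmp_closed dc_riesz less_eq_dprod_def
  show "(x < y) = (x \<le> y \<and> \<not> y \<le> x)" by (simp add: less_dprod_def)
  show "x \<le> x" by (simp add: riesz_refl)
  show "x \<le> z" if "x \<le> y" "y \<le> z"
    using that unfolding less_eq_dprod_def by (meson riesz_trans cmp_closed dc_riesz)
  show "x = y" if "x \<le> y" "y \<le> x" using that unfolding less_eq_dprod_def
    by (intro dprod_eqI) (meson riesz_antisym cmp_closed dc_riesz)
  show "z + x \<le> z + y" if "x \<le> y" using that by (simp add: riesz_add_mono)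
  show "x \<le> sup x y" "y \<le> sup x y" by (simp_all add: riesz_join_left riesz_join_right)
  show "sup y z \<le> x" if "y \<le> x" "z \<le> x" using that by (simp add: riesz_join_le)
  show "inf x y \<le> x" "inf x y \<le> y" by (simp_all add: riesz_meet_left riesz_meet_right)
  show "x \<le> inf y z" if "x \<le> y" "x \<le> z" using that by (simp add: riesz_meet_le)
qed

lemma scaleR_nonneg_dprod: "0 \<le> a \<Longrightarrow> 0 \<le> x \<Longrightarrow> 0 \<le> a *\<^sub>R x" for x :: "'a dprod"
  unfolding less_eq_dprod_def
  by (metis cmp_zero cmp_scaleR riesz_smult_nonneg dc_riesz cmp_closed)

instance dprod :: (type) vector_lattice
proof
  fix x y :: "'a dprod" and a b :: real
  show "a *\<^sub>R x \<le> a *\<^sub>R y" if "x \<le> y" "0 \<le> a"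
  proof -
    have "0 \<le> a *\<^sub>R (y - x)" using that by (intro scaleR_nonneg_dprod) (simp_all only: diff_ge_0_iff_ge)
    then show ?thesis by (simp only: scaleR_diff_right diff_ge_0_iff_ge)
  qed
  show "a *\<^sub>R x \<le> b *\<^sub>R x" if "a \<le> b" "0 \<le> x"
  proof -
    have "0 \<le> (b - a) *\<^sub>R x" using that by (intro scaleR_nonneg_dprod) simp_all
    then show ?thesis by (simp only: scaleR_diff_left diff_ge_0_iff_ge)
  qed
  show "\<bar>x\<bar> = sup x (- x)" by (simp add: abs_dprod_def)
qed

instance dprod :: (type) dc_vector_lattice
proof
  fix A :: "'a dprod set" and b
  assume A: "A \<noteq> {}" and b: "\<And>a. a \<in> A \<Longrightarrow> a \<le> b"
  \<comment> \<open>The implication makes the claim true for every \<open>F\<close>, so that one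
    choice function covers all components.\<close>
  have ex: "\<exists>s. dedekind_complete F \<longrightarrow> is_lub (ord_of F) s ((\<lambda>f. cmp f F) ` A)" for F :: "'a riesz"
  proof (cases "dedekind_complete F")
    case True
    have sub: "(\<lambda>f. cmp f F) ` A \<subseteq> carrier F" using cmp_closed[OF True] by auto
    moreover have "Upper (ord_of F) ((\<lambda>f. cmp f F) ` A) \<noteq> {}"
      unfolding Upper_nonempty_iff[OF sub]
      using b cmp_closed[OF True] True by (auto simp: less_eq_dprod_def intro!: bexI[of _ "cmp b F"])
    moreover have "(\<lambda>f. cmp f F) ` A \<noteq> {}" using A by simp
    ultimately show ?thesis using True unfolding dedekind_complete_def by blast
  qed simp
  obtain s where s: "\<And>F. dedekind_complete F \<Longrightarrow> is_lub (ord_of F) (s F) ((\<lambda>f. cmp f F) ` A)"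
    using ex by metis
  have sub: "dedekind_complete F \<Longrightarrow> (\<lambda>f. cmp f F) ` A \<subseteq> carrier F" for F using cmp_closed by auto
  have s': "s F \<in> carrier F \<and> (\<forall>a\<in>A. cmp a F \<preceq>\<^bsub>F\<^esub> s F) \<and>
      (\<forall>u\<in>carrier F. (\<forall>a\<in>A. cmp a F \<preceq>\<^bsub>F\<^esub> u) \<longrightarrow> s F \<preceq>\<^bsub>F\<^esub> u)" if "dedekind_complete F" for F
    using s[OF that] unfolding is_lub_iff[OF sub[OF that]] by simp
  have cs: "cmp (mk_dprod s) F = s F" if "dedekind_complete F" for F
    using s'[OF that] that by (intro cmp_mk) auto
  show "\<exists>s. (\<forall>a\<in>A. a \<le> s) \<and> (\<forall>b. (\<forall>a\<in>A. a \<le> b) \<longrightarrow> s \<le> b)"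
  proof (intro exI[of _ "mk_dprod s"] conjI ballI allI impI)
    fix a assume "a \<in> A"
    then show "a \<le> mk_dprod s" using s' by (simp add: less_eq_dprod_def cs)
  next
    fix c assume "\<forall>a\<in>A. a \<le> c"
    then show "mk_dprod s \<le> c" using s' cmp_closed[of _ c] by (simp add: less_eq_dprod_def cs)
  qed
qed

definition single :: "'a riesz \<Rightarrow> 'a \<Rightarrow> 'a dprod"
  where "single E x = mk_dprod (\<lambda>F. if F = E then x else \<zero>\<^bsub>F\<^esub>)"

lemma cmp_single:
  "x \<in> carrier E \<Longrightarrow> dedekind_complete F \<Longrightarrow> cmp (single E x) F = (if F = E then x else \<zero>\<^bsub>F\<^esub>)"
  by (simp add: single_def cmp_mk dc_riesz riesz_zero)

section \<open>Riesz subspaces of a type, relative suprema and order continuity\<close>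

definition riesz_sub :: "'u::vector_lattice set \<Rightarrow> bool"
  where "riesz_sub S \<longleftrightarrow> 0 \<in> S \<and> (\<forall>x\<in>S. \<forall>y\<in>S. x + y \<in> S \<and> sup x y \<in> S) \<and> (\<forall>c. \<forall>x\<in>S. c *\<^sub>R x \<in> S)"

lemma riesz_subD:
  assumes "riesz_sub S"
  shows "0 \<in> S" "x \<in> S \<Longrightarrow> y \<in> S \<Longrightarrow> x + y \<in> S" "x \<in> S \<Longrightarrow> y \<in> S \<Longrightarrow> sup x y \<in> S"
    "x \<in> S \<Longrightarrow> c *\<^sub>R x \<in> S" "x \<in> S \<Longrightarrow> - x \<in> S" "x \<in> S \<Longrightarrow> y \<in> S \<Longrightarrow> inf x y \<in> S" "x \<in> S \<Longrightarrow> \<bar>x\<bar> \<in> S"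
proof -
  show "0 \<in> S" and 1: "\<And>x y. x \<in> S \<Longrightarrow> y \<in> S \<Longrightarrow> x + y \<in> S" "\<And>x y. x \<in> S \<Longrightarrow> y \<in> S \<Longrightarrow> sup x y \<in> S"
    "\<And>c x. x \<in> S \<Longrightarrow> c *\<^sub>R x \<in> S" using assms by (auto simp: riesz_sub_def)
  show 2: "- x \<in> S" if "x \<in> S" for x using 1(3)[OF that, of "-1"] by simp
  show "inf x y \<in> S" if "x \<in> S" "y \<in> S" for x y
    unfolding inf_eq_neg_sup[of x y] using that by (intro 1 2)
  show "\<bar>x\<bar> \<in> S" if "x \<in> S" for x unfolding abs_lattice[of x] using that by (intro 1 2)
qed

lemma ideal_riesz_sub: "order_ideal S \<Longrightarrow> riesz_sub S"
  by (simp add: riesz_sub_def ideal_0 ideal_add ideal_sup ideal_scaleR)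

definition lub_in :: "'p::order set \<Rightarrow> 'p set \<Rightarrow> 'p \<Rightarrow> bool"
  where "lub_in S A s \<longleftrightarrow> s \<in> S \<and> (\<forall>a\<in>A. a \<le> s) \<and> (\<forall>c\<in>S. (\<forall>a\<in>A. a \<le> c) \<longrightarrow> s \<le> c)"

definition complete_set :: "'p::order set \<Rightarrow> bool"
  where "complete_set S \<longleftrightarrow> (\<forall>A. A \<subseteq> S \<and> A \<noteq> {} \<and> (\<exists>b\<in>S. \<forall>a\<in>A. a \<le> b) \<longrightarrow> (\<exists>s. lub_in S A s))"

text \<open>An upper bound \<open>b\<close> outside \<open>S\<close> is replaced by
  \<open>inf b s\<close>, which lies between a member of \<open>A\<close> and \<open>s\<close>,
  hence in the ideal, and still bounds \<open>A\<close>.\<close>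

lemma lub_in_ideal:
  assumes S: "order_ideal S" and A: "A \<subseteq> S" "A \<noteq> {}"
  shows "lub_in S A s \<longleftrightarrow> s \<in> S \<and> lub A s"
proof
  assume l: "lub_in S A s"
  have "s \<le> b" if b: "\<forall>a\<in>A. a \<le> b" for b
  proof -
    obtain a where a: "a \<in> A" using A(2) by blast
    have le: "a \<le> inf b s" using l b a by (simp add: lub_in_def)
    have "a \<in> S" "s \<in> S" using A a l by (auto simp: lub_in_def)
    then have "inf b s \<in> S" using le by (rule ideal_between[OF S]) simp
    moreover have "\<forall>a\<in>A. a \<le> inf b s" using l b by (simp add: lub_in_def)
    ultimately have "s \<le> inf b s" using l unfolding lub_in_def by blast
    then show ?thesis by simp
  qed
  then show "s \<in> S \<and> lub A s" using l by (simp add: lub_in_def lub_def)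
qed (auto simp: lub_in_def lub_def)

lemma ideal_complete_set:
  fixes S :: "'u::dc_vector_lattice set"
  assumes S: "order_ideal S" shows "complete_set S"
  unfolding complete_set_def
proof (intro allI impI, elim conjE bexE)
  fix A b assume A: "A \<subseteq> S" "A \<noteq> {}" and b: "b \<in> S" "\<forall>a\<in>A. a \<le> b"
  have "\<exists>s. lub A s" using A(2) b(2) by (intro lub_exists[of A b]) auto
  then obtain s where s: "lub A s" ..
  obtain a where a: "a \<in> A" using A by blast
  have "a \<in> S" using A(1) a by blast
  moreover have "a \<le> s" using s a by (rule lub_ge)
  moreover have "s \<le> b" using b(2) by (intro lub_le[OF s]) simp
  ultimately have "s \<in> S" using b(1) ideal_between[OF S] by blast
  then show "\<exists>s. lub_in S A s" using s lub_in_ideal[OF S A] by blast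
qed

definition glb_zero :: "'u::vector_lattice set \<Rightarrow> bool"
  where "glb_zero A \<longleftrightarrow> (\<forall>a\<in>A. 0 \<le> a) \<and> (\<forall>b. (\<forall>a\<in>A. b \<le> a) \<longrightarrow> b \<le> 0)"

definition down_dir :: "'p::order set \<Rightarrow> bool"
  where "down_dir A \<longleftrightarrow> (\<forall>x\<in>A. \<forall>y\<in>A. \<exists>z\<in>A. z \<le> x \<and> z \<le> y)"

text \<open>Reflecting \<open>a\<close> to \<open>s - a\<close> exchanges families directed upwards
  to \<open>s\<close> with families directed downwards to 0.\<close>

lemma normal_on_iff_glb:
  fixes t :: "'u::vector_lattice \<Rightarrow> 'w::vector_lattice"
  assumes S: "order_ideal S" and t: "positive_on S t"
  shows "normal_on S t \<longleftrightarrow> (\<forall>A. A \<subseteq> S \<and> A \<noteq> {} \<and> down_dir A \<and> glb_zero A \<longrightarrow> glb_zero (t ` A))"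
proof
  assume n: "normal_on S t"
  show "\<forall>A. A \<subseteq> S \<and> A \<noteq> {} \<and> down_dir A \<and> glb_zero A \<longrightarrow> glb_zero (t ` A)"
  proof (intro allI impI, elim conjE)
    fix A assume A: "A \<subseteq> S" "A \<noteq> {}" "down_dir A" "glb_zero A"
    obtain a0 where a0: "a0 \<in> A" using A by blast
    \<comment> \<open>The decreasing family may be unbounded above, so only its part below a fixed
      member \<open>a0\<close> is reflected; by directedness this part has the same infimum.\<close>
    let ?D = "(\<lambda>a. a0 - a) ` {a \<in> A. a \<le> a0}"
    have "lub (t ` ?D) (t a0)"
    proof (rule normal_onD[OF n])
      show "?D \<subseteq> S" using A a0 ideal_diff[OF S] by auto
      show "dir ?D"
        unfolding dir_def
      proof (intro conjI ballI)
        show "?D \<noteq> {}" using a0 by auto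
        fix x y assume "x \<in> ?D" "y \<in> ?D"
        then obtain a b where ab: "x = a0 - a" "y = a0 - b" "a \<in> A" "b \<in> A" "a \<le> a0" by auto
        obtain c where c: "c \<in> A" "c \<le> a" "c \<le> b" using A(3) ab unfolding down_dir_def by blast
        then show "\<exists>z\<in>?D. x \<le> z \<and> y \<le> z"
          using ab by (intro bexI[of _ "a0 - c"]) (auto intro: diff_left_mono order_trans)
      qed
      show "0 \<le> a" if "a \<in> ?D" for a using that by auto
      show "a0 \<in> S" using a0 A by blast
      show "lub ?D a0"
      proof (rule lubI)
        fix x assume "x \<in> ?D" then show "x \<le> a0" using A(4) by (auto simp: glb_zero_def)
      next
        fix b assume b: "\<And>x. x \<in> ?D \<Longrightarrow> x \<le> b"
        have "a0 - b \<le> a" if a: "a \<in> A" for a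
        proof -
          obtain c where c: "c \<in> A" "c \<le> a" "c \<le> a0" using A(3) a a0 unfolding down_dir_def by blast
          then have "a0 - c \<le> b" by (intro b) auto
          then have "a0 - b \<le> c" by (simp only: diff_le_eq add.commute)
          then show ?thesis using c(2) by (rule order_trans)
        qed
        then have "a0 - b \<le> 0" using A(4) unfolding glb_zero_def by blast
        then show "a0 \<le> b" by simp
      qed
    qed
    show "glb_zero (t ` A)"
      unfolding glb_zero_def
    proof (intro conjI ballI allI impI)
      fix y assume "y \<in> t ` A"
      then show "0 \<le> y" using A positive_onD(3)[OF t] by (auto simp: glb_zero_def)
    next
      fix b assume b: "\<forall>y\<in>t ` A. b \<le> y"
      have "t a0 \<le> t a0 - b"
      proof (rule lub_le[OF \<open>lub (t ` ?D) (t a0)\<close>])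
        fix y assume "y \<in> t ` ?D"
        then obtain a where a: "a \<in> A" "y = t (a0 - a)" by auto
        have "t (a0 - a) = t a0 - t a" using A a a0 by (intro positive_on_diff[OF S t]) auto
        then show "y \<le> t a0 - b" using a b by (simp add: diff_left_mono)
      qed
      then show "b \<le> 0" by simp
    qed
  qed
next
  assume oc: "\<forall>A. A \<subseteq> S \<and> A \<noteq> {} \<and> down_dir A \<and> glb_zero A \<longrightarrow> glb_zero (t ` A)"
  show "normal_on S t"
    unfolding normal_on_def
  proof (intro allI impI, elim conjE)
    fix A s assume A: "A \<subseteq> S" "dir A" "\<forall>a\<in>A. 0 \<le> a" and s: "s \<in> S" "lub A s"
    let ?D = "(\<lambda>a. s - a) ` A"
    have "?D \<subseteq> S" using A s ideal_diff[OF S] by auto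
    moreover have "?D \<noteq> {}" using A by (auto simp: dir_def)
    moreover have "down_dir ?D"
      using A(2) unfolding dir_def down_dir_def by (auto simp: diff_left_mono)
    moreover have "glb_zero ?D"
      unfolding glb_zero_def
    proof (intro conjI ballI allI impI)
      fix x assume "x \<in> ?D" then show "0 \<le> x" using lub_ge[OF s(2)] by auto
    next
      fix b assume b: "\<forall>x\<in>?D. b \<le> x"
      have "s \<le> s - b"
      proof (rule lub_le[OF s(2)])
        fix a assume "a \<in> A"
        then have "b \<le> s - a" using b by auto
        then show "a \<le> s - b" by (simp only: le_diff_eq add.commute)
      qed
      then show "b \<le> 0" by simp
    qed
    ultimately have g: "glb_zero (t ` ?D)" using oc by blast
    have td: "t (s - a) = t s - t a" if "a \<in> A" for a
      using A s that by (intro positive_on_diff[OF S t]) auto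
    show "lub (t ` A) (t s)"
    proof (rule lubI)
      fix y assume "y \<in> t ` A"
      then show "y \<le> t s" using A s lub_ge[OF s(2)] by (auto intro!: positive_on_mono[OF S t])
    next
      fix b assume b: "\<And>y. y \<in> t ` A \<Longrightarrow> y \<le> b"
      have "t s - b \<le> y" if "y \<in> t ` ?D" for y
        using that b by (auto simp: td intro: diff_left_mono)
      then have "t s - b \<le> 0" using g unfolding glb_zero_def by blast
      then show "t s \<le> b" by simp
    qed
  qed
qed

text \<open>Members may have any sign; the translate \<open>s - a0\<close> is positive and is
  handled as an excess over \<open>a0\<close>.\<close>

lemma lub_perp_any:
  fixes s :: "'v::vector_lattice"
  assumes "lub A s" "A \<noteq> {}" "\<And>a. a \<in> A \<Longrightarrow> x \<perp> a" shows "x \<perp> s"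
proof -
  obtain a0 where a0: "a0 \<in> A" using assms(2) by blast
  have "x \<perp> pprt (s - a0)"
    by (rule lub_pprt_perp[OF assms(1,2)]) (use assms(3) a0 in \<open>auto intro: perp_pprt perp_diff\<close>)
  moreover have "pprt (s - a0) = s - a0" using lub_ge[OF assms(1) a0] by simp
  ultimately have "x \<perp> (s - a0) + a0" using assms(3)[OF a0] by (intro perp_add) auto
  then show ?thesis by simp
qed

lemma lub_in_pair:
  fixes a b :: "'u::vector_lattice"
  assumes "sup a b \<in> S" shows "lub_in S {a, b} s \<longleftrightarrow> s = sup a b"
proof
  assume l: "lub_in S {a, b} s"
  then have "s \<le> sup a b" using assms by (simp add: lub_in_def)
  moreover have "sup a b \<le> s" using l by (simp add: lub_in_def)
  ultimately show "s = sup a b" by (rule antisym)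
qed (use assms in \<open>simp add: lub_in_def\<close>)

lemma glb_in_pair:
  fixes a b :: "'u::vector_lattice"
  assumes "inf a b \<in> S"
  shows "(\<forall>c\<in>{a, b}. s \<le> c) \<and> (\<forall>u\<in>S. (\<forall>c\<in>{a, b}. u \<le> c) \<longrightarrow> u \<le> s) \<longleftrightarrow> s = inf a b" (is "?L \<longleftrightarrow> ?R")
proof
  assume l: ?L
  then have "inf a b \<le> s" using assms by simp
  moreover have "s \<le> inf a b" using l by simp
  ultimately show "s = inf a b" by (intro antisym)
qed (use assms in simp)

text \<open>A copy of the structure \<open>E\<close> inside a type. That \<open>E\<close> is a Riesz
  space is a consequence, so spaces built by hand are treated in the same way as given ones.\<close>

locale rep =
  fixes E :: "'a riesz" (structure) and k :: "'a \<Rightarrow> 'u::vector_lattice"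
  assumes zero_closed: "\<zero> \<in> carrier E" and k_zero: "k \<zero> = 0"
    and add_closed: "x \<in> carrier E \<Longrightarrow> y \<in> carrier E \<Longrightarrow> x \<oplus> y \<in> carrier E"
    and k_add: "x \<in> carrier E \<Longrightarrow> y \<in> carrier E \<Longrightarrow> k (x \<oplus> y) = k x + k y"
    and smult_closed: "x \<in> carrier E \<Longrightarrow> a \<odot> x \<in> carrier E"
    and k_smult: "x \<in> carrier E \<Longrightarrow> k (a \<odot> x) = a *\<^sub>R k x"
    and k_le: "x \<in> carrier E \<Longrightarrow> y \<in> carrier E \<Longrightarrow> x \<preceq> y \<longleftrightarrow> k x \<le> k y"
    and k_inj: "inj_on k (carrier E)"
    and k_img: "riesz_sub (k ` carrier E)"
begin

abbreviation "S \<equiv> k ` carrier E"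
abbreviation "k' \<equiv> inv_into (carrier E) k"

lemma k'k: "x \<in> carrier E \<Longrightarrow> k' (k x) = x"
  using k_inj by (rule inv_into_f_f)

lemma kk': "u \<in> S \<Longrightarrow> k (k' u) = u"
  by (rule f_inv_into_f)

lemma k'_closed: "u \<in> S \<Longrightarrow> k' u \<in> carrier E"
  by (rule inv_into_into)

lemma k_eq: "x \<in> carrier E \<Longrightarrow> y \<in> carrier E \<Longrightarrow> k x = k y \<longleftrightarrow> x = y"
  using k_inj by (auto simp: inj_on_def)

lemma lub_transfer:
  assumes "A \<subseteq> carrier E"
  shows "is_lub (ord_of E) s A \<longleftrightarrow> s \<in> carrier E \<and> lub_in S (k ` A) (k s)"
  using assms unfolding is_lub_iff[OF assms] lub_in_def by (auto simp: k_le subset_iff)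

lemma glb_transfer:
  assumes "A \<subseteq> carrier E"
  shows "is_glb (ord_of E) s A \<longleftrightarrow>
    s \<in> carrier E \<and> (\<forall>a\<in>A. k s \<le> k a) \<and> (\<forall>u\<in>S. (\<forall>a\<in>A. u \<le> k a) \<longrightarrow> u \<le> k s)"
  using assms unfolding is_glb_iff[OF assms] by (auto simp: k_le subset_iff)

lemma sup_lub: "x \<in> carrier E \<Longrightarrow> y \<in> carrier E \<Longrightarrow> is_lub (ord_of E) s {x, y} \<longleftrightarrow> s \<in> carrier E \<and> k s = sup (k x) (k y)"
proof -
  assume xy: "x \<in> carrier E" "y \<in> carrier E"
  have "sup (k x) (k y) \<in> S" using riesz_subD(3)[OF k_img] xy by blast
  from lub_in_pair[OF this] show ?thesis using xy by (simp add: lub_transfer)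
qed

lemma inf_glb: "x \<in> carrier E \<Longrightarrow> y \<in> carrier E \<Longrightarrow> is_glb (ord_of E) s {x, y} \<longleftrightarrow> s \<in> carrier E \<and> k s = inf (k x) (k y)"
proof -
  assume xy: "x \<in> carrier E" "y \<in> carrier E"
  have "inf (k x) (k y) \<in> S" using riesz_subD(6)[OF k_img] xy by blast
  from glb_in_pair[OF this] show ?thesis using xy by (simp add: glb_transfer)
qed

lemma join_k: "x \<in> carrier E \<Longrightarrow> y \<in> carrier E \<Longrightarrow> x \<squnion>\<^bsub>ord_of E\<^esub> y \<in> carrier E \<and> k (x \<squnion>\<^bsub>ord_of E\<^esub> y) = sup (k x) (k y)"
proof -
  assume xy: "x \<in> carrier E" "y \<in> carrier E"
  obtain s where "s \<in> carrier E" "k s = sup (k x) (k y)" using riesz_subD(3)[OF k_img, of "k x" "k y"] xy by force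
  then have "is_lub (ord_of E) s {x, y}" using sup_lub xy by blast
  \<comment> \<open>The join is a choice among least upper bounds; the exhibited \<open>s\<close>
    shows that there is one.\<close>
  then have "is_lub (ord_of E) (x \<squnion>\<^bsub>ord_of E\<^esub> y) {x, y}"
    unfolding join_def Lattice.sup_def by (rule someI)
  then show ?thesis using sup_lub xy by blast
qed

lemma meet_k: "x \<in> carrier E \<Longrightarrow> y \<in> carrier E \<Longrightarrow> x \<sqinter>\<^bsub>ord_of E\<^esub> y \<in> carrier E \<and> k (x \<sqinter>\<^bsub>ord_of E\<^esub> y) = inf (k x) (k y)"
proof -
  assume xy: "x \<in> carrier E" "y \<in> carrier E"
  obtain s where "s \<in> carrier E" "k s = inf (k x) (k y)" using riesz_subD(6)[OF k_img, of "k x" "k y"] xy by force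
  then have "is_glb (ord_of E) s {x, y}" using inf_glb xy by blast
  then have "is_glb (ord_of E) (x \<sqinter>\<^bsub>ord_of E\<^esub> y) {x, y}"
    unfolding meet_def Lattice.inf_def by (rule someI)
  then show ?thesis using inf_glb xy by blast
qed

lemma riesz: "riesz_space E"
proof -
  have m: "module real_ring E"
  proof (rule moduleI)
    show "cring real_ring"
      by (rule cringI; (rule abelian_groupI)?; (rule comm_monoidI)?)
        (auto simp: real_ring_def algebra_simps intro: exI[of _ "- _ :: real"])
    show "abelian_group E"
    proof (rule abelian_groupI)
      fix x assume x: "x \<in> carrier E"
      then show "\<exists>y\<in>carrier E. y \<oplus> x = \<zero>"
        using k_eq[of "(-1) \<odot> x \<oplus> x" \<zero>]
        by (intro bexI[of _ "(-1) \<odot> x"]) (auto simp: add_closed smult_closed k_add k_smult k_zero zero_closed)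
    next
      fix x y z assume xyz: "x \<in> carrier E" "y \<in> carrier E" "z \<in> carrier E"
      then show "x \<oplus> y \<oplus> z = x \<oplus> (y \<oplus> z)"
        using k_eq[of "x \<oplus> y \<oplus> z" "x \<oplus> (y \<oplus> z)"] by (simp add: add_closed k_add add.assoc)
    next
      fix x y assume xyz: "x \<in> carrier E" "y \<in> carrier E"
      then show "x \<oplus> y = y \<oplus> x"
        using k_eq[of "x \<oplus> y" "y \<oplus> x"] by (simp add: add_closed k_add add.commute)
    next
      fix x assume "x \<in> carrier E"
      then show "\<zero> \<oplus> x = x" using k_eq[of "\<zero> \<oplus> x" x] by (simp add: add_closed k_add k_zero zero_closed)
    qed (auto simp: add_closed zero_closed)
    fix a b x y assume "x \<in> carrier E" "y \<in> carrier E"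
    then show "a \<odot> x \<in> carrier E"
      "(a \<oplus>\<^bsub>real_ring\<^esub> b) \<odot> x = a \<odot> x \<oplus> b \<odot> x"
      "a \<odot> (x \<oplus> y) = a \<odot> x \<oplus> a \<odot> y"
      "(a \<otimes>\<^bsub>real_ring\<^esub> b) \<odot> x = a \<odot> (b \<odot> x)"
      "\<one>\<^bsub>real_ring\<^esub> \<odot> x = x"
      by (auto simp: real_ring_def smult_closed add_closed k_add k_smult k_eq[symmetric] algebra_simps)
  qed
  have po: "partial_order (ord_of E)"
    by standard (auto simp: ord_of_def k_le k_eq[symmetric] intro: order_trans)
  have l: "lattice (ord_of E)"
  proof -
    have "\<exists>s. is_lub (ord_of E) s {x, y}" "\<exists>s. is_glb (ord_of E) s {x, y}"
      if "x \<in> carrier (ord_of E)" "y \<in> carrier (ord_of E)" for x y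
      using that sup_lub[of x y] inf_glb[of x y] join_k[of x y] meet_k[of x y] by (auto simp: ord_of_def)
    then show ?thesis
      using po by (intro lattice.intro upper_semilattice.intro lower_semilattice.intro
        upper_semilattice_axioms.intro lower_semilattice_axioms.intro)
  qed
  show ?thesis
  proof (intro riesz_space.intro m l riesz_space_axioms.intro)
    show "x \<oplus> z \<preceq> y \<oplus> z" if "x \<in> carrier E" "y \<in> carrier E" "z \<in> carrier E" "x \<preceq> y" for x y z
      using that by (simp add: k_le k_add add_closed)
    show "\<zero> \<preceq> a \<odot> x" if "0 \<le> a" "x \<in> carrier E" "\<zero> \<preceq> x" for a x
      using that by (simp add: k_le smult_closed zero_closed k_zero k_smult nonneg_scaleR)
  qed
qed

lemma minus_k: "x \<in> carrier E \<Longrightarrow> \<ominus> x \<in> carrier E \<and> k (\<ominus> x) = - k x"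
  using riesz_minus[OF riesz, of x] by (simp add: smult_closed k_smult)

lemma modulus_k: "x \<in> carrier E \<Longrightarrow> modulus E x \<in> carrier E \<and> k (modulus E x) = \<bar>k x\<bar>"
  unfolding modulus_def using minus_k[of x] join_k[of x "\<ominus> x"] by (simp add: abs_lattice)

lemma disjoint_k: "x \<in> carrier E \<Longrightarrow> y \<in> carrier E \<Longrightarrow> disjoint_elts E x y \<longleftrightarrow> k x \<perp> k y"
  unfolding disjoint_elts_def perp_def
  using modulus_k[of x] modulus_k[of y] meet_k[of "modulus E x" "modulus E y"] zero_closed
  by (metis k_eq k_zero)

lemma pos_cone_k: "x \<in> pos_cone E \<longleftrightarrow> x \<in> carrier E \<and> 0 \<le> k x"
  unfolding pos_cone_def using zero_closed by (auto simp: k_le k_zero)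

lemma k_pos_iff: "x \<in> pos_cone E - {\<zero>} \<longleftrightarrow> x \<in> carrier E \<and> 0 < k x"
  using k_eq[OF _ zero_closed, of x] by (auto simp: pos_cone_k k_zero order_less_le)

lemma directed_up_k: "A \<subseteq> carrier E \<Longrightarrow> A \<noteq> {} \<Longrightarrow> directed_up E A \<longleftrightarrow> dir (k ` A)"
  unfolding directed_up_def dir_def by (simp add: k_le subset_iff)

lemma directed_down_k: "A \<subseteq> carrier E \<Longrightarrow> directed_down E A \<longleftrightarrow> down_dir (k ` A)"
  unfolding directed_down_def down_dir_def by (simp add: k_le subset_iff)

lemma submodule_k:
  assumes "D \<subseteq> carrier E"
  shows "submodule D real_ring E \<longleftrightarrow> 0 \<in> k ` D \<and> (\<forall>x\<in>k ` D. \<forall>y\<in>k ` D. x + y \<in> k ` D) \<and> (\<forall>c. \<forall>x\<in>k ` D. c *\<^sub>R x \<in> k ` D)"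
    (is "?L \<longleftrightarrow> ?R")
proof -
  have mem: "k x \<in> k ` D \<longleftrightarrow> x \<in> D" if "x \<in> carrier E" for x
    using that assms k_eq by (auto simp: subset_iff)
  have "\<zero> \<in> D \<longleftrightarrow> 0 \<in> k ` D" using mem[OF zero_closed] by (simp add: k_zero)
  moreover have "(\<forall>x\<in>D. \<forall>y\<in>D. x \<oplus> y \<in> D) \<longleftrightarrow> (\<forall>x\<in>k ` D. \<forall>y\<in>k ` D. x + y \<in> k ` D)"
    using assms mem by (simp add: k_add[symmetric] subset_iff add_closed)
  moreover have "(\<forall>c. \<forall>x\<in>D. c \<odot> x \<in> D) \<longleftrightarrow> (\<forall>c. \<forall>x\<in>k ` D. c *\<^sub>R x \<in> k ` D)"
    using assms mem by (simp add: k_smult[symmetric] subset_iff smult_closed)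
  ultimately have R: "?R \<longleftrightarrow> \<zero> \<in> D \<and> (\<forall>x\<in>D. \<forall>y\<in>D. x \<oplus> y \<in> D) \<and> (\<forall>c. \<forall>x\<in>D. c \<odot> x \<in> D)"
    by argo
  interpret riesz_space E by (rule riesz)
  show ?thesis
  proof
    assume L: ?L
    then interpret D: submodule D real_ring E .
    show ?R unfolding R using D.one_closed D.m_closed D.smult_closed by (simp add: real_ring_def)
  next
    assume r: ?R
    show ?L
      by (rule submoduleI) (use r[unfolded R] assms riesz_minus[OF riesz] in \<open>auto simp: subset_iff\<close>)
  qed
qed

lemma riesz_subspace_k:
  assumes "D \<subseteq> carrier E" shows "riesz_subspace E D \<longleftrightarrow> riesz_sub (k ` D)"
proof -
  have mem: "k x \<in> k ` D \<longleftrightarrow> x \<in> D" if "x \<in> carrier E" for x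
    using that assms k_eq by (auto simp: subset_iff)
  have "x \<squnion>\<^bsub>ord_of E\<^esub> y \<in> D \<longleftrightarrow> sup (k x) (k y) \<in> k ` D" if "x \<in> D" "y \<in> D" for x y
    using mem[of "x \<squnion>\<^bsub>ord_of E\<^esub> y"] join_k[of x y] that assms by (simp add: subset_iff)
  then have 1: "(\<forall>x\<in>D. \<forall>y\<in>D. x \<squnion>\<^bsub>ord_of E\<^esub> y \<in> D) \<longleftrightarrow> (\<forall>x\<in>k ` D. \<forall>y\<in>k ` D. sup x y \<in> k ` D)"
    by simp
  have "x \<sqinter>\<^bsub>ord_of E\<^esub> y \<in> D \<longleftrightarrow> inf (k x) (k y) \<in> k ` D" if "x \<in> D" "y \<in> D" for x y
    using mem[of "x \<sqinter>\<^bsub>ord_of E\<^esub> y"] meet_k[of x y] that assms by (simp add: subset_iff)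
  then have 2: "(\<forall>x\<in>D. \<forall>y\<in>D. x \<sqinter>\<^bsub>ord_of E\<^esub> y \<in> D) \<longleftrightarrow> (\<forall>x\<in>k ` D. \<forall>y\<in>k ` D. inf x y \<in> k ` D)"
    by simp
  show ?thesis
    unfolding riesz_subspace_def submodule_k[OF assms] ball_conj_distrib 1 2
  proof
    assume r: "riesz_sub (k ` D)"
    show "(0 \<in> k ` D \<and> (\<forall>x\<in>k ` D. \<forall>y\<in>k ` D. x + y \<in> k ` D) \<and> (\<forall>c. \<forall>x\<in>k ` D. c *\<^sub>R x \<in> k ` D)) \<and>
      (\<forall>x\<in>k ` D. \<forall>y\<in>k ` D. sup x y \<in> k ` D) \<and> (\<forall>x\<in>k ` D. \<forall>y\<in>k ` D. inf x y \<in> k ` D)"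
      by (intro conjI ballI allI riesz_subD[OF r])
  qed (simp add: riesz_sub_def)
qed

lemma order_dense_k:
  assumes "D \<subseteq> carrier E" shows "order_dense E D \<longleftrightarrow> order_dense_in (k ` D) S"
proof -
  have "g \<in> D \<inter> pos_cone E - {\<zero>} \<longleftrightarrow> g \<in> D \<and> 0 < k g" for g
    using k_pos_iff[of g] assms by blast
  then have "order_dense E D \<longleftrightarrow> (\<forall>f. f \<in> carrier E \<and> 0 < k f \<longrightarrow> (\<exists>g. (g \<in> D \<and> 0 < k g) \<and> g \<preceq> f))"
    unfolding order_dense_def Ball_def Bex_def k_pos_iff by simp
  also have "\<dots> \<longleftrightarrow> (\<forall>f. f \<in> carrier E \<and> 0 < k f \<longrightarrow> (\<exists>g. (g \<in> D \<and> 0 < k g) \<and> k g \<le> k f))"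
    using assms k_le by (meson subsetD)
  finally show ?thesis unfolding order_dense_in_def by auto
qed

lemma dedekind_k: "dedekind_complete E \<longleftrightarrow> complete_set S"
proof -
  have lub: "(\<exists>s. is_lub (ord_of E) s A) \<longleftrightarrow> (\<exists>s. lub_in S (k ` A) s)" if "A \<subseteq> carrier E" for A
    unfolding lub_transfer[OF that] by (auto simp: lub_in_def)
  have bd: "Upper (ord_of E) A \<noteq> {} \<longleftrightarrow> (\<exists>b\<in>S. \<forall>a\<in>k ` A. a \<le> b)" if "A \<subseteq> carrier E" for A
    unfolding Upper_nonempty_iff[OF that] using that by (auto simp: k_le subset_iff)
  show ?thesis
  proof
    assume L: "dedekind_complete E"
    show "complete_set S"
      unfolding complete_set_def
    proof (intro allI impI, elim conjE)
      fix B assume B: "B \<subseteq> S" "B \<noteq> {}" "\<exists>b\<in>S. \<forall>a\<in>B. a \<le> b"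
      obtain A where A: "A \<subseteq> carrier E" "B = k ` A" using B(1) by (auto simp: subset_image_iff)
      then show "\<exists>s. lub_in S B s"
        using L B(2,3) lub[OF A(1)] bd[OF A(1)] unfolding dedekind_complete_def by simp
    qed
  next
    assume R: "complete_set S"
    show "dedekind_complete E"
      unfolding dedekind_complete_def
    proof (intro conjI riesz allI impI, elim conjE)
      fix A assume A: "A \<subseteq> carrier E" "A \<noteq> {}" "Upper (ord_of E) A \<noteq> {}"
      have "k ` A \<subseteq> S" "k ` A \<noteq> {}" using A by auto
      then have "\<exists>s. lub_in S (k ` A) s"
        using R A(3) bd[OF A(1)] unfolding complete_set_def by blast
      then show "\<exists>s. is_lub (ord_of E) s A" using lub[OF A(1)] by simp
    qed
  qed
qed

definition induced :: "('a \<Rightarrow> 'a) \<Rightarrow> 'u \<Rightarrow> 'u"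
  where "induced T u = k (T (k' u))"

lemma induced_k: "x \<in> carrier E \<Longrightarrow> induced T (k x) = k (T x)"
  by (simp add: induced_def k'k)

lemma positive_k:
  "linear_map E E T \<and> T \<in> pos_cone E \<rightarrow> pos_cone E \<longleftrightarrow>
    T \<in> carrier E \<rightarrow> carrier E \<and> positive_on S (induced T)"
proof (cases "T \<in> carrier E \<rightarrow> carrier E")
  case True
  then have T: "T x \<in> carrier E" if "x \<in> carrier E" for x using that by blast
  have "T \<in> pos_cone E \<rightarrow> pos_cone E \<longleftrightarrow> (\<forall>x\<in>S. 0 \<le> x \<longrightarrow> 0 \<le> induced T x)"
    using T by (auto simp: pos_cone_k induced_k Pi_iff)
  moreover have "(\<forall>x\<in>carrier E. \<forall>y\<in>carrier E. T (x \<oplus> y) = T x \<oplus> T y) \<longleftrightarrow>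
      (\<forall>x\<in>S. \<forall>y\<in>S. induced T (x + y) = induced T x + induced T y)"
    using T by (simp add: induced_k k_add[symmetric] add_closed k_eq)
  moreover have "(\<forall>a. \<forall>x\<in>carrier E. T (a \<odot> x) = a \<odot> T x) \<longleftrightarrow>
      (\<forall>a. \<forall>x\<in>S. induced T (a *\<^sub>R x) = a *\<^sub>R induced T x)"
    using T by (simp add: induced_k k_smult[symmetric] smult_closed k_eq)
  ultimately show ?thesis using True unfolding linear_map_def positive_on_def by argo
qed (auto simp: linear_map_def)

end

lemma conditional_on_cong:
  assumes "\<And>x. x \<in> S \<Longrightarrow> T x = T' x" "conditional_on S e T" shows "conditional_on S e T'"
proof -
  note d = assms(2)[unfolded conditional_on_def]
  have S: "order_ideal S" and TS: "T ` S \<subseteq> S" using d by blast+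
  have "T ` A = T' ` A" if "A \<subseteq> S" for A using assms(1) that by (intro image_cong) auto
  then have "normal_on S T'" using d assms(1) unfolding normal_on_def by simp
  moreover have "positive_on S T'"
    using d assms(1) unfolding positive_on_def by (simp add: ideal_add[OF S] ideal_scaleR[OF S])
  moreover have "T' ` S \<subseteq> S" "\<forall>x\<in>S. T' (T' x) = T' x" "\<forall>x\<in>S. 0 < x \<longrightarrow> 0 < T' x"
    using d assms(1) TS by (auto simp: image_subset_iff)
  moreover have "T' e = e" using d assms(1)[of e] by (auto simp: weak_unit_in_def)
  ultimately show ?thesis using d unfolding conditional_on_def by blast
qed

lemma perp_ideal: "order_ideal S \<Longrightarrow> order_ideal {v \<in> S. u \<perp> v}"
  unfolding order_ideal_def[of "{v \<in> S. u \<perp> v}"]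
  using ideal_0 ideal_add ideal_scaleR ideal_solid
  by (auto intro: perp_add perp_scaleR perp_solid)

text \<open>That the range of a strictly positive projection is a Dedekind complete Riesz subspace is automatic:
  \<open>u = T u\<close> gives \<open>|u| \<le> T |u|\<close>, and \<open>T\<close> annihilates the difference.\<close>

lemma range_complete:
  fixes S :: "'u::dc_vector_lattice set"
  assumes c: "conditional_on S e t"
  shows "riesz_sub (t ` S) \<and> complete_set (t ` S)"
proof -
  note d = c[unfolded conditional_on_def]
  have ideal: "order_ideal S" and pos: "positive_on S t" and tS: "\<And>u. u \<in> S \<Longrightarrow> t u \<in> S" and tt: "\<And>u. u \<in> S \<Longrightarrow> t (t u) = t u"
    and strict: "\<And>u. u \<in> S \<Longrightarrow> 0 < u \<Longrightarrow> 0 < t u" using d by auto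
  have mem: "u \<in> t ` S \<longleftrightarrow> u \<in> S \<and> t u = u" for u using tS tt by force
  have fixp: "t u = u" if u: "u \<in> S" "u \<le> t u" for u
  proof (rule ccontr)
    assume "t u \<noteq> u"
    then have "0 < t u - u" using u by (simp add: order_less_le)
    moreover have "t u - u \<in> S" using u tS ideal_diff[OF ideal] by blast
    ultimately have "0 < t (t u - u)" using strict by blast
    then show False using positive_on_diff[OF ideal pos tS[OF u(1)] u(1)] tt[OF u(1)] by simp
  qed
  have sub: "riesz_sub (t ` S)"
    unfolding riesz_sub_def
  proof (intro conjI ballI allI)
    show "0 \<in> t ` S" using positive_on_0[OF pos] ideal_0[OF ideal] mem by blast
    fix x y assume x: "x \<in> t ` S" and y: "y \<in> t ` S"
    then have xy: "x \<in> S" "y \<in> S" "t x = x" "t y = y" using mem by auto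
    then show "x + y \<in> t ` S" using positive_onD(1)[OF pos] ideal_add[OF ideal] mem by simp
    have s: "sup x y \<in> S" using xy ideal_sup[OF ideal] by blast
    have "x \<le> t (sup x y)" "y \<le> t (sup x y)"
      using positive_on_mono[OF ideal pos xy(1) s] positive_on_mono[OF ideal pos xy(2) s] xy by auto
    then show "sup x y \<in> t ` S" using fixp[OF s] s mem by simp
  next
    fix c x assume "x \<in> t ` S"
    then show "c *\<^sub>R x \<in> t ` S" using positive_onD(2)[OF pos] ideal_scaleR[OF ideal] mem by simp
  qed
  have "complete_set (t ` S)"
    unfolding complete_set_def
  proof (intro allI impI, elim conjE bexE)
    fix A b assume A: "A \<subseteq> t ` S" "A \<noteq> {}" and b: "b \<in> t ` S" "\<forall>a\<in>A. a \<le> b"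
    have AS: "A \<subseteq> S" and bS: "b \<in> S" using A(1) b(1) mem by blast+
    obtain s where "lub_in S A s"
      using ideal_complete_set[OF ideal] AS A(2) bS b(2) unfolding complete_set_def by blast
    then have s: "s \<in> S" "\<And>a. a \<in> A \<Longrightarrow> a \<le> s" "\<And>c. c \<in> S \<Longrightarrow> \<forall>a\<in>A. a \<le> c \<Longrightarrow> s \<le> c"
      unfolding lub_in_def by blast+
    have "a \<le> t s" if a: "a \<in> A" for a
    proof -
      have "a \<in> t ` S" using A(1) a by blast
      then have "a \<in> S" "t a = a" using mem by blast+
      then show ?thesis using positive_on_mono[OF ideal pos _ s(1) s(2)[OF a]] by simp
    qed
    then have "s \<le> t s" using s(3) tS[OF s(1)] by blast
    then have "s \<in> t ` S" using fixp[OF s(1)] s(1) mem by blast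
    moreover have "c \<in> S" if "c \<in> t ` S" for c using that mem by blast
    ultimately have "lub_in (t ` S) A s" using s(2,3) unfolding lub_in_def by blast
    then show "\<exists>s. lub_in (t ` S) A s" ..
  qed
  then show ?thesis using sub by blast
qed

text \<open>Once the image is an ideal, suprema of nonempty families in \<open>E\<close> are those
  of the ambient type, and properties of \<open>E\<close> become properties of a subset of the
  type.\<close>

locale rep_ideal = rep E k for E :: "'a riesz" (structure) and k :: "'a \<Rightarrow> 'u::dc_vector_lattice" +
  assumes ideal: "order_ideal (k ` carrier E)"
begin

lemma dedekind: "dedekind_complete E"
  using dedekind_k ideal_complete_set[OF ideal] by blast

lemma is_lub_k:
  "A \<subseteq> carrier E \<Longrightarrow> A \<noteq> {} \<Longrightarrow> is_lub (ord_of E) s A \<longleftrightarrow> s \<in> carrier E \<and> lub (k ` A) (k s)"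
  using lub_transfer[of A s] lub_in_ideal[OF ideal, of "k ` A" "k s"] by auto

text \<open>A lower bound \<open>b\<close> in the type is replaced by \<open>sup b 0\<close>, which
  lies in the ideal because it is between 0 and a member of the family.\<close>

lemma is_glb_zero_k:
  assumes "A \<subseteq> carrier E" "A \<noteq> {}" shows "is_glb (ord_of E) \<zero> A \<longleftrightarrow> glb_zero (k ` A)"
proof
  assume l: "is_glb (ord_of E) \<zero> A"
  then have pos: "0 \<le> k a" if "a \<in> A" for a using that by (simp add: glb_transfer[OF assms(1)] k_zero)
  obtain a where a: "a \<in> A" using assms(2) by blast
  show "glb_zero (k ` A)"
    unfolding glb_zero_def
  proof (intro conjI ballI allI impI)
    fix b assume b: "\<forall>x\<in>k ` A. b \<le> x"
    have le: "sup b 0 \<le> k x" if "x \<in> A" for x using b pos that by simp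
    have "k a \<in> S" using a assms(1) by blast
    then have "sup b 0 \<in> S" using sup_ge2 le[OF a] by (rule ideal_le[OF ideal])
    moreover have "\<forall>u\<in>S. (\<forall>a\<in>A. u \<le> k a) \<longrightarrow> u \<le> k \<zero>"
      using l unfolding glb_transfer[OF assms(1)] by blast
    ultimately have "sup b 0 \<le> k \<zero>" using le by blast
    then show "b \<le> 0" by (simp add: k_zero)
  qed (use pos in auto)
next
  assume "glb_zero (k ` A)"
  then show "is_glb (ord_of E) \<zero> A"
    by (simp add: glb_transfer[OF assms(1)] glb_zero_def zero_closed k_zero)
qed

lemma order_continuous_k:
  assumes T: "T \<in> carrier E \<rightarrow> carrier E" and pos: "positive_on S (induced T)"
  shows "order_continuous E E T \<longleftrightarrow> normal_on S (induced T)"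
proof -
  have eq: "k ` T ` A = induced T ` k ` A" if "A \<subseteq> carrier E" for A
    unfolding image_image using that by (intro image_cong refl) (auto simp: induced_k)
  have tr: "is_glb (ord_of E) \<zero> (T ` A) \<longleftrightarrow> glb_zero (induced T ` k ` A)" if "A \<subseteq> carrier E" "A \<noteq> {}" for A
  proof -
    have "T ` A \<subseteq> carrier E" "T ` A \<noteq> {}" using T that by auto
    from is_glb_zero_k[OF this] show ?thesis using eq[OF that(1)] by simp
  qed
  show ?thesis
    unfolding normal_on_iff_glb[OF ideal pos]
  proof
    assume oc: "order_continuous E E T"
    show "\<forall>A. A \<subseteq> S \<and> A \<noteq> {} \<and> down_dir A \<and> glb_zero A \<longrightarrow> glb_zero (induced T ` A)"
    proof (intro allI impI, elim conjE)
      fix B assume B: "B \<subseteq> S" "B \<noteq> {}" "down_dir B" "glb_zero B"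
      obtain A where A: "A \<subseteq> carrier E" "B = k ` A" using B(1) by (auto simp: subset_image_iff)
      have A0: "A \<noteq> {}" using A B by auto
      have "directed_down E A" "is_glb (ord_of E) \<zero> A"
        using directed_down_k[OF A(1)] is_glb_zero_k[OF A(1) A0] B(3,4) A(2) by simp_all
      then have "is_glb (ord_of E) \<zero> (T ` A)" using oc A A0 unfolding order_continuous_def by blast
      then show "glb_zero (induced T ` B)" using tr[OF A(1) A0] A by simp
    qed
  next
    assume n: "\<forall>A. A \<subseteq> S \<and> A \<noteq> {} \<and> down_dir A \<and> glb_zero A \<longrightarrow> glb_zero (induced T ` A)"
    show "order_continuous E E T"
      unfolding order_continuous_def
    proof (intro allI impI, elim conjE)
      fix A assume A: "A \<subseteq> carrier E" "A \<noteq> {}" "directed_down E A" "is_glb (ord_of E) \<zero> A"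
      have "k ` A \<subseteq> S" "k ` A \<noteq> {}" "down_dir (k ` A)" "glb_zero (k ` A)"
        using A directed_down_k[OF A(1)] is_glb_zero_k[OF A(1,2)] by auto
      then have "glb_zero (induced T ` k ` A)" using n by blast
      then show "is_glb (ord_of E) \<zero> (T ` A)" using tr[OF A(1,2)] by simp
    qed
  qed
qed

lemma mem_k: "I \<subseteq> carrier E \<Longrightarrow> x \<in> carrier E \<Longrightarrow> k x \<in> k ` I \<longleftrightarrow> x \<in> I"
  using k_eq by (auto simp: subset_iff)

lemma riesz_ideal_k:
  assumes I: "I \<subseteq> carrier E" shows "riesz_ideal E I \<longleftrightarrow> order_ideal (k ` I)"
proof -
  have le: "modulus E x \<preceq> modulus E y \<longleftrightarrow> \<bar>k x\<bar> \<le> \<bar>k y\<bar>" if "x \<in> carrier E" "y \<in> carrier E" for x y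
    using that modulus_k[of x] modulus_k[of y] by (simp add: k_le)
  have "(\<forall>x\<in>carrier E. \<forall>y\<in>I. modulus E x \<preceq> modulus E y \<longrightarrow> x \<in> I) \<longleftrightarrow>
      (\<forall>u. \<forall>v\<in>k ` I. \<bar>u\<bar> \<le> \<bar>v\<bar> \<longrightarrow> u \<in> k ` I)" (is "?L \<longleftrightarrow> ?R")
  proof
    assume L: ?L
    show ?R
    proof (intro allI ballI impI)
      fix u v assume "v \<in> k ` I" and uv: "\<bar>u\<bar> \<le> \<bar>v\<bar>"
      then obtain y where y: "y \<in> I" "v = k y" by blast
      have yE: "y \<in> carrier E" using y I by blast
      then have "v \<in> S" using y by blast
      then have "u \<in> S" using uv by (rule ideal_solid[OF ideal])
      then obtain x where x: "x \<in> carrier E" "u = k x" by blast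
      have "modulus E x \<preceq> modulus E y" using le[OF x(1) yE] uv x y by simp
      then have "x \<in> I" using L x(1) y(1) by blast
      then show "u \<in> k ` I" using x by blast
    qed
  next
    assume R: ?R
    show ?L
    proof (intro ballI impI)
      fix x y assume x: "x \<in> carrier E" and y: "y \<in> I" and xy: "modulus E x \<preceq> modulus E y"
      have "\<bar>k x\<bar> \<le> \<bar>k y\<bar>" using le[OF x] y I xy by blast
      then have "k x \<in> k ` I" using R y by blast
      then show "x \<in> I" using mem_k[OF I x] by blast
    qed
  qed
  then show ?thesis
    unfolding riesz_ideal_def order_ideal_def submodule_k[OF I] by simp
qed

lemma band_subset: "band E B \<Longrightarrow> B \<subseteq> carrier E"
  unfolding band_def riesz_ideal_def submodule_def using subgroup.subset by fastforce

text \<open>The elements disjoint from \<open>u\<close> form a band. If it contains \<open>e\<close>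
  it is everything, and \<open>u\<close> is disjoint from itself.\<close>

lemma weak_order_unitD:
  assumes e: "weak_order_unit E e" shows "e \<in> carrier E \<and> weak_unit_in S (k e)"
proof -
  have eE: "e \<in> carrier E" "0 \<le> k e" and gen: "band_generated E {e} = carrier E"
    using e by (auto simp: weak_order_unit_def pos_cone_k)
  have "u = 0" if u: "u \<in> S" "u \<perp> k e" for u
  proof -
    let ?B = "{y \<in> carrier E. u \<perp> k y}"
    have kB: "k ` ?B = {v \<in> S. u \<perp> v}" by auto
    have "order_ideal (k ` ?B)" unfolding kB by (rule perp_ideal[OF ideal])
    then have "riesz_ideal E ?B" by (subst riesz_ideal_k) auto
    moreover have "s \<in> ?B" if A: "A \<subseteq> ?B" "A \<noteq> {}" "is_lub (ord_of E) s A" for A s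
    proof -
      have AE: "A \<subseteq> carrier E" using A(1) by blast
      have "s \<in> carrier E" "lub (k ` A) (k s)" using A(3) is_lub_k[OF AE A(2)] by auto
      moreover from this(2) have "u \<perp> k s" by (rule lub_perp_any) (use A in auto)
      ultimately show ?thesis by simp
    qed
    ultimately have "band E ?B" unfolding band_def by blast
    moreover have "{e} \<subseteq> ?B" using eE(1) u(2) by simp
    ultimately have "band_generated E {e} \<subseteq> ?B" unfolding band_generated_def by (intro Inter_lower) simp
    moreover obtain y where "y \<in> carrier E" "u = k y" using u(1) by blast
    ultimately have "u \<perp> u" using gen by auto
    then show ?thesis by simp
  qed
  then show ?thesis using eE by (auto simp: weak_unit_in_def)
qed

text \<open>A positive \<open>y\<close> is the supremum of its truncations at multiples of
  \<open>e\<close>, which lie in every band containing \<open>e\<close>: the remainder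
  \<open>k y - p\<close> is disjoint from \<open>k e\<close>, hence zero.\<close>

lemma weak_order_unitI:
  assumes eE: "e \<in> carrier E" and e: "weak_unit_in S (k e)" shows "weak_order_unit E e"
proof -
  have e0: "0 \<le> k e" and eu: "\<And>u. u \<in> S \<Longrightarrow> u \<perp> k e \<Longrightarrow> u = 0" using e by (auto simp: weak_unit_in_def)
  have sub: "carrier E \<subseteq> B" if B: "band E B" "e \<in> B" for B
  proof -
    have BE: "B \<subseteq> carrier E" by (rule band_subset[OF B(1)])
    have BI: "order_ideal (k ` B)" using B(1) riesz_ideal_k[OF BE] by (simp add: band_def)
    have pos: "y \<in> B" if y: "y \<in> carrier E" "0 \<le> k y" for y
    proof -
      obtain p where p: "0 \<le> p" "p \<le> k y" "lub (range (\<lambda>n. inf (k y) (real n *\<^sub>R k e))) p" "k y - p \<perp> k e"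
        using band_projection_exists[OF y(2) e0] by metis
      have "k y \<in> S" using y by blast
      then have "k y - p \<in> S" by (rule ideal_le[OF ideal]) (use p(1,2) in auto)
      then have py: "p = k y" using eu p(4) by force
      let ?A = "{z \<in> carrier E. k z \<in> range (\<lambda>n. inf (k y) (real n *\<^sub>R k e))}"
      have inB: "inf (k y) (real n *\<^sub>R k e) \<in> k ` B" for n
      proof (rule ideal_le[OF BI ideal_scaleR[OF BI imageI[OF B(2)], of "real n"]])
        show "0 \<le> inf (k y) (real n *\<^sub>R k e)" using y(2) nonneg_scaleR[OF e0, of "real n"] by simp
      qed simp
      have kA: "k ` ?A = range (\<lambda>n. inf (k y) (real n *\<^sub>R k e))" using inB BE by force
      have "?A \<subseteq> B"
      proof
        fix z assume z: "z \<in> ?A"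
        then have "k z \<in> k ` B" using inB by auto
        then show "z \<in> B" using mem_k[OF BE] z by blast
      qed
      moreover have "?A \<noteq> {}" using kA by (metis (no_types, lifting) image_is_empty UNIV_not_empty)
      moreover have "is_lub (ord_of E) y ?A"
        using is_lub_k[of ?A y] \<open>?A \<noteq> {}\<close> p(3) py y(1) unfolding kA by auto
      ultimately show ?thesis using B(1) unfolding band_def by blast
    qed
    show ?thesis
    proof
      fix y assume y: "y \<in> carrier E"
      have "modulus E y \<in> B" using modulus_k[OF y] by (intro pos) auto
      then have "\<bar>k y\<bar> \<in> k ` B" using modulus_k[OF y] by (metis imageI)
      then have "k y \<in> k ` B" using ideal_abs_iff[OF BI] by blast
      then show "y \<in> B" using mem_k[OF BE y] by blast
    qed
  qed
  have "band E (carrier E)"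
    unfolding band_def
  proof (intro conjI allI impI)
    show "riesz_ideal E (carrier E)" using riesz_ideal_k ideal by blast
    fix A s assume "A \<subseteq> carrier E \<and> A \<noteq> {} \<and> is_lub (ord_of E) s A"
    then show "s \<in> carrier E" using is_lub_k by blast
  qed
  then have "band_generated E {e} = carrier E"
    unfolding band_generated_def using sub eE by blast
  then show ?thesis using eE e0 by (simp add: weak_order_unit_def pos_cone_k)
qed

lemma conditional_tripleD:
  assumes "conditional_riesz_triple E e T"
  shows "e \<in> carrier E \<and> T \<in> carrier E \<rightarrow> carrier E \<and> conditional_on S (k e) (induced T)"
proof -
  note d = assms[unfolded conditional_riesz_triple_def]
  have e: "e \<in> carrier E" "weak_unit_in S (k e)" using weak_order_unitD d by blast+
  have T: "T \<in> carrier E \<rightarrow> carrier E" and pos: "positive_on S (induced T)" using positive_k[of T] d by blast+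
  have n: "normal_on S (induced T)" using order_continuous_k[OF T pos] d by blast
  have "induced T ` S \<subseteq> S" "\<forall>u\<in>S. induced T (induced T u) = induced T u"
    using T d by (auto simp: induced_k Pi_iff)
  moreover have "induced T (k e) = k e" using d e by (simp add: induced_k)
  moreover have "0 < induced T u" if u: "u \<in> S" "0 < u" for u
  proof -
    obtain x where x: "x \<in> carrier E" "u = k x" using u(1) by blast
    then have "x \<in> pos_cone E - {\<zero>}" using k_pos_iff u(2) by simp
    then have "T x \<in> pos_cone E - {\<zero>}" using d by blast
    then show ?thesis using k_pos_iff x induced_k by simp
  qed
  ultimately show ?thesis unfolding conditional_on_def using ideal e pos n T by blast
qed

lemma rep_restrict:
  assumes "D \<subseteq> carrier E" "riesz_sub (k ` D)" shows "rep (E\<lparr>carrier := D\<rparr>) k"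
proof -
  have cl: "x \<in> D" if "k x \<in> k ` D" "x \<in> carrier E" for x using that mem_k[OF assms(1)] by blast
  note r = riesz_subD[OF assms(2)]
  have D: "x \<in> carrier E" if "x \<in> D" for x using assms(1) that by blast
  show ?thesis
  proof
    show "\<zero>\<^bsub>E\<lparr>carrier := D\<rparr>\<^esub> \<in> carrier (E\<lparr>carrier := D\<rparr>)" using cl[OF _ zero_closed] r(1) k_zero by simp
    show "x \<oplus>\<^bsub>E\<lparr>carrier := D\<rparr>\<^esub> y \<in> carrier (E\<lparr>carrier := D\<rparr>)"
      if "x \<in> carrier (E\<lparr>carrier := D\<rparr>)" "y \<in> carrier (E\<lparr>carrier := D\<rparr>)" for x y
      using that r(2)[of "k x" "k y"] D by (auto intro!: cl simp: k_add add_closed)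
    show "a \<odot>\<^bsub>E\<lparr>carrier := D\<rparr>\<^esub> x \<in> carrier (E\<lparr>carrier := D\<rparr>)" if "x \<in> carrier (E\<lparr>carrier := D\<rparr>)" for a x
      using that r(4)[of "k x" a] D by (auto intro!: cl simp: k_smult smult_closed)
    show "inj_on k (carrier (E\<lparr>carrier := D\<rparr>))" using inj_on_subset[OF k_inj assms(1)] by simp
    show "riesz_sub (k ` carrier (E\<lparr>carrier := D\<rparr>))" using assms(2) by simp
  qed (use D in \<open>auto simp: k_zero k_add k_smult k_le\<close>)
qed

lemma conditional_tripleI:
  assumes eE: "e \<in> carrier E" and T: "T \<in> carrier E \<rightarrow> carrier E" and c: "conditional_on S (k e) (induced T)"
  shows "conditional_riesz_triple E e T"
proof -
  note d = c[unfolded conditional_on_def]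
  have TE: "T x \<in> carrier E" if "x \<in> carrier E" for x using T that by blast
  have pos: "positive_on S (induced T)" using d by blast
  have lin: "linear_map E E T" "T \<in> pos_cone E \<rightarrow> pos_cone E" using positive_k T pos by blast+
  have oc: "order_continuous E E T" using order_continuous_k[OF T pos] d by blast
  have tt: "T (T x) = T x" if x: "x \<in> carrier E" for x
  proof -
    have "induced T (induced T (k x)) = induced T (k x)" using d x by blast
    then show ?thesis using x TE by (simp add: induced_k k_eq)
  qed
  have te: "T e = e"
  proof -
    have "induced T (k e) = k e" using d by blast
    then show ?thesis using eE TE by (simp add: induced_k k_eq)
  qed
  have strict: "T \<in> (pos_cone E - {\<zero>}) \<rightarrow> (pos_cone E - {\<zero>})"
  proof
    fix x assume "x \<in> pos_cone E - {\<zero>}"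
    then have x: "x \<in> carrier E" "0 < k x" using k_pos_iff by auto
    then have "0 < induced T (k x)" using d by blast
    then show "T x \<in> pos_cone E - {\<zero>}" using k_pos_iff TE x induced_k by simp
  qed
  have sub: "T ` carrier E \<subseteq> carrier E" using TE by blast
  have im: "k ` T ` carrier E = induced T ` S" by (force simp: induced_k)
  have r: "riesz_sub (k ` T ` carrier E)" "complete_set (k ` T ` carrier E)"
    using range_complete[OF c] im by auto
  interpret R: rep "E\<lparr>carrier := T ` carrier E\<rparr>" k by (rule rep_restrict[OF sub r(1)])
  have dc: "dedekind_complete (E\<lparr>carrier := T ` carrier E\<rparr>)" using R.dedekind_k r(2) by simp
  have rs: "riesz_subspace E (T ` carrier E)" using riesz_subspace_k[OF sub] r(1) by blast
  have wu: "weak_order_unit E e" using weak_order_unitI[OF eE] d by blast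
  show ?thesis
    unfolding conditional_riesz_triple_def
    by (intro conjI ballI dedekind wu lin oc tt te rs dc strict)
qed

lemma laterally_completeD:
  assumes "universally_complete E" shows "laterally_complete S"
  unfolding laterally_complete_def
proof (intro allI impI, elim conjE)
  fix B assume B: "B \<subseteq> S" "\<forall>a\<in>B. 0 \<le> a" "\<forall>x\<in>B. \<forall>y\<in>B. x \<noteq> y \<longrightarrow> x \<perp> y"
  obtain A where A: "A \<subseteq> carrier E" "B = k ` A" using B(1) by (auto simp: subset_image_iff)
  show "\<exists>b\<in>S. \<forall>a\<in>B. a \<le> b"
  proof (cases "A = {}")
    case True
    then show ?thesis using A ideal_0[OF ideal] by auto
  next
    case False
    have "\<forall>x\<in>A. \<forall>y\<in>A. x \<noteq> y \<longrightarrow> disjoint_elts E x y"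
    proof (intro ballI impI)
      fix x y assume xy: "x \<in> A" "y \<in> A" "x \<noteq> y"
      then have "k x \<perp> k y" using B(3) A k_eq[of x y] by (auto simp: subset_iff)
      then show "disjoint_elts E x y" using disjoint_k xy A(1) by blast
    qed
    then obtain s where "is_lub (ord_of E) s A"
      using assms A(1) False unfolding universally_complete_def by blast
    then have "s \<in> carrier E" "lub (k ` A) (k s)" using is_lub_k[OF A(1) False] by auto
    then show ?thesis using A(2) lub_ge by blast
  qed
qed

lemma universally_completeI:
  assumes l: "laterally_complete S" shows "universally_complete E"
  unfolding universally_complete_def
proof (intro conjI dedekind allI impI, elim conjE)
  fix A assume A: "A \<subseteq> carrier E" "A \<noteq> {}" and dis: "\<forall>x\<in>A. \<forall>y\<in>A. x \<noteq> y \<longrightarrow> disjoint_elts E x y"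
  have kS: "k x \<in> S" if "x \<in> A" for x using that A by blast
  \<comment> \<open>Members of \<open>A\<close> may have any sign; their positive parts are still
    disjoint and dominate them.\<close>
  have "\<exists>b\<in>S. \<forall>a\<in>pprt ` k ` A. a \<le> b"
  proof (rule l[unfolded laterally_complete_def, rule_format], intro conjI ballI impI)
    show "pprt ` k ` A \<subseteq> S" using ideal_pprt[OF ideal] kS by auto
    show "0 \<le> a" if "a \<in> pprt ` k ` A" for a using that by auto
    fix u v assume "u \<in> pprt ` k ` A" "v \<in> pprt ` k ` A" "u \<noteq> v"
    then obtain x y where xy: "x \<in> A" "y \<in> A" "u = pprt (k x)" "v = pprt (k y)" "x \<noteq> y" by auto
    then have "k x \<perp> k y" using dis disjoint_k A(1) by blast
    then show "u \<perp> v" using xy perp_pprt perp_sym by metis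
  qed
  then obtain b where b: "b \<in> S" "\<And>x. x \<in> A \<Longrightarrow> pprt (k x) \<le> b" by auto
  have "\<forall>a\<in>k ` A. a \<le> b"
  proof
    fix a assume "a \<in> k ` A"
    then obtain x where x: "x \<in> A" "a = k x" by blast
    have "a \<le> pprt a" by (simp add: pprt_def)
    then show "a \<le> b" using b(2)[OF x(1)] x(2) order_trans by blast
  qed
  then obtain s where "lub_in S (k ` A) s"
    using ideal_complete_set[OF ideal] b(1) A kS unfolding complete_set_def by (metis image_is_empty image_subsetI)
  then show "\<exists>s. is_lub (ord_of E) s A"
    using lub_transfer[OF A(1), of "k' s"] by (auto simp: lub_in_def k'_closed kk')
qed

end

section \<open>Construction of the completion\<close>

text \<open>In a Dedekind complete type, the band generated by \<open>F\<close>. It serves as the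
  universal completion of \<open>E\<close> inside the much larger completion of the product.\<close>

definition double_perp :: "'u::vector_lattice set \<Rightarrow> 'u set"
  where "double_perp F = {u. \<forall>w. (\<forall>x\<in>F. w \<perp> x) \<longrightarrow> w \<perp> u}"

lemma double_perp_ideal: "order_ideal (double_perp F)"
  unfolding order_ideal_def double_perp_def
  by (auto intro: perp_add perp_scaleR perp_solid)

lemma double_perp_subset: "F \<subseteq> double_perp F"
  by (auto simp: double_perp_def)

lemma double_perp_lub:
  assumes "A \<subseteq> double_perp F" "A \<noteq> {}" "lub A s" shows "s \<in> double_perp F"
proof -
  have "w \<perp> s" if w: "\<forall>x\<in>F. w \<perp> x" for w
    by (rule lub_perp_any[OF assms(3,2)]) (use assms(1) w in \<open>auto simp: double_perp_def\<close>)
  then show ?thesis by (simp add: double_perp_def)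
qed

text \<open>An element of the double complement that is disjoint from all of \<open>F\<close> is
  disjoint from itself. A positive nonzero one therefore meets some \<open>x\<close> in
  \<open>F\<close>, and the infimum lies in \<open>F\<close>.\<close>

lemma double_perp_dense:
  assumes F: "order_ideal F" shows "order_dense_in F (double_perp F)"
  unfolding order_dense_in_def
proof (intro ballI impI)
  fix u assume u: "u \<in> double_perp F" "0 < u"
  have "\<not> (\<forall>x\<in>F. u \<perp> x)"
  proof
    assume "\<forall>x\<in>F. u \<perp> x"
    then have "u \<perp> u" using u(1) unfolding double_perp_def by blast
    then show False using u(2) by simp
  qed
  then obtain x where x: "x \<in> F" "\<not> u \<perp> x" by blast
  have "0 \<le> inf u \<bar>x\<bar>" using u(2) by simp
  moreover have "inf u \<bar>x\<bar> \<noteq> 0" using x(2) u(2) by (simp add: perp_def abs_of_pos)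
  moreover have "inf u \<bar>x\<bar> \<in> F"
    using u(2) by (intro ideal_le[OF F ideal_abs[OF F x(1)]]) auto
  ultimately show "\<exists>g\<in>F. 0 < g \<and> g \<le> u" by (intro bexI[of _ "inf u \<bar>x\<bar>"]) (auto simp: order_less_le)
qed

lemma double_perp_laterally_complete:
  fixes F :: "'u::dc_vector_lattice set"
  assumes "laterally_complete (UNIV :: 'u set)" shows "laterally_complete (double_perp F)"
  unfolding laterally_complete_def
proof (intro allI impI, elim conjE)
  fix A assume A: "A \<subseteq> double_perp F" "\<forall>a\<in>A. 0 \<le> a" "\<forall>x\<in>A. \<forall>y\<in>A. x \<noteq> y \<longrightarrow> x \<perp> y"
  then obtain b where b: "\<forall>a\<in>A. a \<le> b" using assms unfolding laterally_complete_def by blast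
  show "\<exists>b\<in>double_perp F. \<forall>a\<in>A. a \<le> b"
  proof (cases "A = {}")
    case True then show ?thesis using ideal_0[OF double_perp_ideal] by blast
  next
    case False
    then have "\<exists>s. lub A s" using b by (intro lub_exists[of A b]) auto
    then obtain s where s: "lub A s" ..
    then show ?thesis using double_perp_lub[OF A(1) False s] lub_ge[OF s] by blast
  qed
qed

locale conditional_base =
  fixes F :: "'u::dc_vector_lattice set" and e :: 'u and T :: "'u \<Rightarrow> 'u"
  assumes cond: "conditional_on F e T" and lat: "laterally_complete (UNIV :: 'u set)"
begin

lemma F: "order_ideal F" and eF: "weak_unit_in F e" and TF: "T ` F \<subseteq> F" and T: "positive_on F T"
  and Tn: "normal_on F T" and TT: "x \<in> F \<Longrightarrow> T (T x) = T x" and Te: "T e = e"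
  and strict: "x \<in> F \<Longrightarrow> 0 < x \<Longrightarrow> 0 < T x"
  using cond unfolding conditional_on_def by blast+

abbreviation "B \<equiv> double_perp F"

text \<open>The bound may lie anywhere in the type: when the supremum of the \<open>T x\<close>
  exists, it lies in the band \<open>B\<close>, because every \<open>T x\<close> is in
  \<open>F\<close>.\<close>

definition Et :: "'u set"
  where "Et = {u \<in> B. \<exists>b. \<forall>x\<in>below F \<bar>u\<bar>. T x \<le> b}"

lemma Et_ideal: "order_ideal Et"
  unfolding order_ideal_def
proof (intro conjI ballI allI impI)
  have "T x \<le> T 0" if "x \<in> below F \<bar>0\<bar>" for x
    using that by (auto simp: below_def dest: antisym)
  then show "0 \<in> Et" using ideal_0[OF double_perp_ideal] by (auto simp: Et_def)
next
  fix u v assume "u \<in> Et" "v \<in> Et"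
  then obtain b c where u: "u \<in> B" "\<And>x. x \<in> below F \<bar>u\<bar> \<Longrightarrow> T x \<le> b"
    and v: "v \<in> B" "\<And>x. x \<in> below F \<bar>v\<bar> \<Longrightarrow> T x \<le> c" by (auto simp: Et_def)
  have "T x \<le> b + c" if x: "x \<in> below F \<bar>u + v\<bar>" for x
  proof -
    have xF: "x \<in> F" "0 \<le> x" "x \<le> \<bar>u\<bar> + \<bar>v\<bar>"
      using x abs_triangle_ineq[of u v] by (auto simp: below_def intro: order_trans)
    \<comment> \<open>Riesz decomposition of \<open>x\<close> into a part below
      \<open>\<bar>u\<bar>\<close> and a rest below \<open>\<bar>v\<bar>\<close>.\<close>
    let ?y = "inf x \<bar>u\<bar>"
    have y0: "0 \<le> ?y" using xF by simp
    have yF: "?y \<in> F" by (rule ideal_le[OF F xF(1) y0]) simp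
    have eq: "x - ?y = pprt (x - \<bar>u\<bar>)" by (simp only: diff_inf_eq_sup add_sup_distrib_left pprt_def) (simp add: sup_commute)
    have "x - \<bar>u\<bar> \<le> \<bar>v\<bar>" using xF(3) by (simp add: diff_le_eq add.commute)
    then have "pprt (x - \<bar>u\<bar>) \<le> pprt \<bar>v\<bar>" by (rule pprt_mono)
    then have "x - ?y \<le> \<bar>v\<bar>" unfolding eq by simp
    moreover have "x - ?y \<in> F" using ideal_diff[OF F xF(1) yF] .
    moreover have "0 \<le> x - ?y" by simp
    ultimately have "T (x - ?y) \<le> c" by (intro v(2)) (simp add: below_def)
    moreover have "T ?y \<le> b" using yF y0 by (intro u(2)) (simp add: below_def)
    moreover have "T x = T ?y + T (x - ?y)"
      using positive_onD(1)[OF T yF \<open>x - ?y \<in> F\<close>] by simp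
    ultimately show ?thesis by (simp add: add_mono)
  qed
  then show "u + v \<in> Et" using ideal_add[OF double_perp_ideal u(1) v(1)] by (auto simp: Et_def)
next
  fix c u assume "u \<in> Et"
  then obtain b where u: "u \<in> B" "\<And>x. x \<in> below F \<bar>u\<bar> \<Longrightarrow> T x \<le> b" by (auto simp: Et_def)
  have "T x \<le> (\<bar>c\<bar> + 1) *\<^sub>R b" if x: "x \<in> below F \<bar>c *\<^sub>R u\<bar>" for x
  proof -
    \<comment> \<open>Adding one gives a scalar that is invertible also for
      \<open>c = 0\<close>.\<close>
    let ?d = "\<bar>c\<bar> + 1"
    have d: "0 < ?d" by simp
    have xF: "x \<in> F" "0 \<le> x" "x \<le> \<bar>c\<bar> *\<^sub>R \<bar>u\<bar>" using x by (auto simp: below_def abs_scaleR)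
    have "\<bar>c\<bar> *\<^sub>R \<bar>u\<bar> \<le> ?d *\<^sub>R \<bar>u\<bar>" by (rule scaleR_le_self) auto
    with xF(3) have "x \<le> ?d *\<^sub>R \<bar>u\<bar>" by (rule order_trans)
    then have "inverse ?d *\<^sub>R x \<le> inverse ?d *\<^sub>R ?d *\<^sub>R \<bar>u\<bar>" by (rule scaleR_left_mono) simp
    moreover have "inverse ?d *\<^sub>R ?d *\<^sub>R \<bar>u\<bar> = \<bar>u\<bar>" using d by simp
    ultimately have "inverse ?d *\<^sub>R x \<le> \<bar>u\<bar>" by simp
    then have "T (inverse ?d *\<^sub>R x) \<le> b"
      using ideal_scaleR[OF F xF(1)] nonneg_scaleR[OF xF(2), of "inverse ?d"] by (intro u(2)) (simp add: below_def)
    then have "?d *\<^sub>R inverse ?d *\<^sub>R T x \<le> ?d *\<^sub>R b"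
      unfolding positive_onD(2)[OF T xF(1)] by (rule scaleR_left_mono) simp
    moreover have "?d *\<^sub>R inverse ?d *\<^sub>R T x = T x" using d by simp
    ultimately show ?thesis by simp
  qed
  then show "c *\<^sub>R u \<in> Et" using ideal_scaleR[OF double_perp_ideal u(1)] by (auto simp: Et_def)
next
  fix u v assume v: "v \<in> Et" and le: "\<bar>u\<bar> \<le> \<bar>v\<bar>"
  have "below F \<bar>u\<bar> \<subseteq> below F \<bar>v\<bar>" using le by (auto simp: below_def)
  then show "u \<in> Et" using v ideal_solid[OF double_perp_ideal _ le] by (auto simp: Et_def)
qed

lemma F_Et: "F \<subseteq> Et"
proof
  fix x assume x: "x \<in> F"
  have "T y \<le> T \<bar>x\<bar>" if "y \<in> below F \<bar>x\<bar>" for y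
    using that ideal_abs[OF F x] by (intro positive_on_mono[OF F T]) (auto simp: below_def)
  then show "x \<in> Et" using x double_perp_subset by (auto simp: Et_def)
qed

lemma F_dense: "order_dense_in F Et"
  using double_perp_dense[OF F] by (auto simp: order_dense_in_def Et_def)

sublocale positive_extension F Et T
proof
  show "\<exists>b. \<forall>x\<in>below F v. T x \<le> b" if "v \<in> Et" "0 \<le> v" for v
    using that by (auto simp: Et_def)
qed (use F Et_ideal F_Et T in auto)

lemma extl_normal_on: "normal_on Et extl"
  by (rule extl_normal[OF Tn])

text \<open>The truncations \<open>inf x a\<close> lie in \<open>F\<close> and increase to
  \<open>x\<close>, so order continuity of \<open>T\<close> on \<open>F\<close> suffices, with
  \<open>T (inf x a) \<le> ext a\<close>. It provides the bounds that membership in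
  \<open>Et\<close> asks for.\<close>

lemma lub_inf_dir:
  assumes A: "A \<subseteq> Et" "dir A" "\<And>a. a \<in> A \<Longrightarrow> 0 \<le> a" and x: "x \<in> F" "0 \<le> x" and l: "lub (inf x ` A) x"
    and b: "\<And>a. a \<in> A \<Longrightarrow> ext a \<le> b"
  shows "T x \<le> b"
proof -
  have inF: "inf x a \<in> F" if "a \<in> A" for a
    using A(3)[OF that] x(2) by (intro ideal_le[OF F x(1)]) auto
  have "lub (T ` inf x ` A) (T x)"
  proof (rule normal_onD[OF Tn _ _ _ x(1) l])
    show "inf x ` A \<subseteq> F" using inF by auto
    show "dir (inf x ` A)" using A(2) by (rule dir_image_mono) (auto intro: le_infI2)
    show "0 \<le> a" if "a \<in> inf x ` A" for a using that A(3) x(2) by auto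
  qed
  then show ?thesis
  proof (rule lub_le)
    fix z assume "z \<in> T ` inf x ` A"
    then obtain a where a: "a \<in> A" "z = T (inf x a)" by auto
    have "z \<le> ext a" unfolding a(2) using a(1) A(1,3) x inF by (intro ext_ge) auto
    also have "\<dots> \<le> b" using b a(1) by blast
    finally show "z \<le> b" .
  qed
qed

text \<open>The bound that membership requires is \<open>ext v\<close> itself: an element
  \<open>y\<close> of \<open>F\<close> below \<open>ext v\<close> is exhausted by its truncations at
  the elements \<open>T x\<close>, and idempotence gives
  \<open>T (T x) = T x \<le> ext v\<close>.\<close>

lemma ext_Et:
  assumes v: "v \<in> Et" "0 \<le> v" shows "ext v \<in> Et"
proof -
  have l: "lub (T ` below F v) (ext v)" by (rule ext_lub[OF v])
  have sub: "T ` below F v \<subseteq> F" using TF by (auto simp: below_def)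
  have ne: "T ` below F v \<noteq> {}" using zero_below[OF v(2)] by blast
  have eB: "ext v \<in> B" by (rule double_perp_lub[OF _ ne l]) (use sub double_perp_subset in blast)
  have d: "dir (T ` below F v)"
    by (rule dir_image_mono[OF dir_below[OF ideal_0[OF F] v(2) ideal_sup[OF F]]])
      (auto simp: below_def intro: positive_on_mono[OF F T])
  have "T y \<le> ext v" if y: "y \<in> below F \<bar>ext v\<bar>" for y
  proof -
    have y': "y \<in> F" "0 \<le> y" "y \<le> ext v" using y ext_nonneg[OF v] by (auto simp: below_def)
    have "lub (inf y ` T ` below F v) (inf y (ext v))" by (rule lub_inf[OF l])
    then have l': "lub (inf y ` T ` below F v) y" using y'(3) by (simp add: inf_absorb1)
    show ?thesis
    proof (rule lub_inf_dir[OF _ d _ y'(1,2) l'])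
      show "T ` below F v \<subseteq> Et" using sub F_Et by blast
      show pos: "0 \<le> a" if a: "a \<in> T ` below F v" for a
      proof -
        obtain x where "x \<in> F" "0 \<le> x" "a = T x" using a by (auto simp: below_def)
        then show ?thesis using positive_onD(3)[OF T, of x] by simp
      qed
      fix a assume a: "a \<in> T ` below F v"
      then obtain x where x: "x \<in> F" "a = T x" by (auto simp: below_def)
      then have "a \<in> F" "T a = a" using TT[of x] TF by auto
      then have "ext a = a" using ext_eq pos[OF a] by simp
      then show "ext a \<le> ext v" using lub_ge[OF l a] by simp
    qed
  qed
  then show ?thesis using eB by (auto simp: Et_def)
qed

lemma extl_Et: "extl ` Et \<subseteq> Et"
  using ext_Et ideal_pprt[OF Et_ideal] ideal_minus[OF Et_ideal]
  by (auto simp: extl_def intro!: ideal_diff[OF Et_ideal])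

text \<open>Idempotence carries over from \<open>F\<close> by uniqueness of order continuous
  extensions. Strict positivity holds because every \<open>x > 0\<close> dominates some
  \<open>y > 0\<close> of \<open>F\<close>, and \<open>T y\<close> lies below
  \<open>extl x\<close>.\<close>

lemma conditional_Et: "conditional_on Et e extl"
  unfolding conditional_on_def
proof (intro conjI ballI impI)
  have dB: "order_dense_in F Et" by (rule F_dense)
  show "weak_unit_in Et e" by (rule weak_unit_dense[OF F Et_ideal F_Et dB eF])
  show "extl e = e" using extl_eq[of e] eF Te by (simp add: weak_unit_in_def)
  fix x assume x: "x \<in> Et"
  show "extl (extl x) = extl x"
  proof (rule positive_normal_unique[OF Et_ideal F F_Et F_dense _ _ extl_positive_on extl_normal_on _ x])
    show "positive_on Et (\<lambda>x. extl (extl x))"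
      by (rule positive_on_compose[OF extl_positive_on extl_Et extl_positive_on])
    show "normal_on Et (\<lambda>x. extl (extl x))"
      by (rule normal_on_compose[OF Et_ideal extl_positive_on extl_normal_on extl_Et extl_normal_on])
    show "extl (extl y) = extl y" if "y \<in> F" for y
    proof -
      have "T y \<in> F" using TF that by blast
      then show ?thesis using extl_eq that TT by simp
    qed
  qed
  assume "0 < x"
  then obtain y where y: "y \<in> F" "0 < y" "y \<le> x" using F_dense x unfolding order_dense_in_def by blast
  have "0 < T y" using strict y by blast
  also have "T y \<le> ext x" using x y by (intro ext_ge) auto
  finally show "0 < extl x" using x \<open>0 < x\<close> by (simp add: extl_pos)
qed (rule Et_ideal extl_Et extl_positive_on extl_normal_on)+

lemma complete_Et: "complete_in Et extl B"
  unfolding complete_in_def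
proof (intro allI impI, elim conjE bexE)
  fix A b assume A: "A \<subseteq> Et" "dir A" "\<forall>a\<in>A. 0 \<le> a" and b: "b \<in> B" "\<forall>a\<in>A. extl a \<le> b"
  have ne: "A \<noteq> {}" using A(2) by (simp add: dir_def)
  have AB: "A \<subseteq> B" using A(1) by (auto simp: Et_def)
  have pos: "0 \<le> a" if "a \<in> A" for a using A(3) that by blast
  have bd: "ext a \<le> b" if "a \<in> A" for a
    using b(2) A(1) that extl_pos[of a] pos[OF that] by (auto simp: subset_iff)
  have "\<exists>c\<in>B. \<forall>a\<in>A. a \<le> c"
  proof (rule laterally_complete_bounded[OF double_perp_ideal double_perp_laterally_complete[OF lat] _ AB ne pos])
    show "weak_unit_in B e"
      by (rule weak_unit_dense[OF F double_perp_ideal double_perp_subset double_perp_dense[OF F] eF])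
    fix g assume g: "g \<in> B" "0 \<le> g"
      "\<And>n c. (\<And>a. a \<in> A \<Longrightarrow> inf a (real n *\<^sub>R e) \<le> c) \<Longrightarrow> real n *\<^sub>R g \<le> c"
    show "g = 0"
    proof (rule ccontr)
      assume "g \<noteq> 0"
      then have "0 < g" using g(2) by simp
      then obtain f where f: "f \<in> F" "0 < f" "f \<le> g"
        using double_perp_dense[OF F] g(1) unfolding order_dense_in_def by blast
      have "real n *\<^sub>R T f \<le> b" for n
      proof -
        let ?x = "real n *\<^sub>R f"
        have x: "?x \<in> F" "0 \<le> ?x" using f ideal_scaleR[OF F] nonneg_scaleR[of f "real n"] by auto
        have "\<exists>s. lub ((\<lambda>a. inf a (real n *\<^sub>R e)) ` A) s"
          using ne by (intro lub_exists[of _ "real n *\<^sub>R e"]) auto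
        then obtain s where s: "lub ((\<lambda>a. inf a (real n *\<^sub>R e)) ` A) s" ..
        have "?x \<le> real n *\<^sub>R g" using f(3) by (intro scaleR_left_mono) auto
        also have "\<dots> \<le> s" using lub_ge[OF s] by (intro g(3)) blast
        finally have xs: "inf ?x s = ?x" by (rule inf_absorb1)
        \<comment> \<open>As \<open>n f\<close> lies below \<open>s\<close>, it is the supremum of
          its infima with the truncated members of \<open>A\<close>, hence also of its infima with
          the members themselves.\<close>
        have l: "lub (inf ?x ` A) ?x"
        proof (rule lubI)
          fix c assume c: "\<And>a. a \<in> inf ?x ` A \<Longrightarrow> a \<le> c"
          have "inf ?x s \<le> c"
          proof (rule lub_le[OF lub_inf[OF s]])
            fix u assume "u \<in> inf ?x ` (\<lambda>a. inf a (real n *\<^sub>R e)) ` A"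
            then obtain a where a: "a \<in> A" "u = inf ?x (inf a (real n *\<^sub>R e))" by blast
            have "u \<le> inf ?x a" unfolding a(2) by (rule inf_mono) auto
            also have "\<dots> \<le> c" using a(1) by (intro c) blast
            finally show "u \<le> c" .
          qed
          then show "?x \<le> c" using xs by simp
        qed auto
        have "T ?x \<le> b" by (rule lub_inf_dir[OF A(1,2) pos x l bd])
        then show ?thesis using positive_onD(2)[OF T f(1)] by simp
      qed
      moreover have "0 < T f" using strict f by blast
      ultimately have "T f = 0" by (intro archimedean[of "T f" b]) auto
      then show False using \<open>0 < T f\<close> by simp
    qed
  qed
  then obtain c where c: "\<forall>a\<in>A. a \<le> c" by blast
  have "\<exists>s. lub A s" using c ne by (intro lub_exists[of A c]) auto
  then obtain s where s: "lub A s" ..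
  \<comment> \<open>The bound \<open>b\<close> of the extended values on \<open>A\<close> bounds
    \<open>T\<close> below \<open>s\<close> as well, so \<open>s\<close> belongs to
    \<open>Et\<close> and not merely to the band \<open>B\<close>.\<close>
  have "T x \<le> b" if x: "x \<in> below F \<bar>s\<bar>" for x
  proof -
    have "0 \<le> s" using s A(2) pos by (rule lub_dir_nonneg)
    then have x': "x \<in> F" "0 \<le> x" "x \<le> s" using x by (auto simp: below_def)
    have "lub (inf x ` A) (inf x s)" by (rule lub_inf[OF s])
    then have l: "lub (inf x ` A) x" using x'(3) by (simp add: inf_absorb1)
    show ?thesis by (rule lub_inf_dir[OF A(1,2) pos x'(1,2) l bd])
  qed
  moreover have "s \<in> B" by (rule double_perp_lub[OF AB ne s])
  ultimately show "\<exists>s\<in>Et. lub A s" using s by (auto simp: Et_def)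
qed

end

section \<open>Passing between carriers and types\<close>

context completion_pair
begin

lemma extl_inverse2: "v \<in> S2 \<Longrightarrow> A.extl (B.extl v) = v"
proof -
  interpret C: completion_pair F2 S2 W2 e2 T2 F1 S1 W1 e1 T1 \<chi> \<psi>
    by (intro completion_pair.intro A.completion_map_axioms B.completion_map_axioms)
  show "v \<in> S2 \<Longrightarrow> A.extl (B.extl v) = v" by (rule C.extl_inverse)
qed

lemma extl_bij: "bij_betw A.extl S1 S2"
  by (rule bij_betw_byWitness[of _ B.extl]) (use extl_inverse extl_inverse2 A.extl_range B.extl_range in auto)

text \<open>The extension and its inverse are both monotone, so an upper bound in the target can be
  compared after pulling it back.\<close>

lemma extl_sup:
  assumes u: "u \<in> S1" and v: "v \<in> S1" shows "A.extl (sup u v) = sup (A.extl u) (A.extl v)"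
proof (rule antisym)
  note pA = A.extl_positive_on and pB = B.extl_positive_on
  have s: "sup u v \<in> S1" by (rule ideal_sup[OF A.S1 u v])
  have uv: "A.extl u \<in> S2" "A.extl v \<in> S2" using A.extl_range u v by auto
  let ?s = "sup (A.extl u) (A.extl v)"
  have sS: "?s \<in> S2" by (rule ideal_sup[OF A.S2 uv])
  have "u \<le> B.extl ?s" using positive_on_mono[OF A.S2 pB uv(1) sS] extl_inverse[OF u] by simp
  moreover have "v \<le> B.extl ?s" using positive_on_mono[OF A.S2 pB uv(2) sS] extl_inverse[OF v] by simp
  ultimately have "A.extl (sup u v) \<le> A.extl (B.extl ?s)"
    using B.extl_range sS by (intro positive_on_mono[OF A.S1 pA s]) auto
  then show "A.extl (sup u v) \<le> ?s" using extl_inverse2[OF sS] by simp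
  show "?s \<le> A.extl (sup u v)"
    using positive_on_mono[OF A.S1 pA u s] positive_on_mono[OF A.S1 pA v s] by simp
qed

lemma extl_inf:
  assumes u: "u \<in> S1" and v: "v \<in> S1" shows "A.extl (inf u v) = inf (A.extl u) (A.extl v)"
proof -
  have neg: "A.extl (- w) = - A.extl w" if "w \<in> S1" for w
    using positive_onD(2)[OF A.extl_positive_on that, of "-1"] by simp
  have "A.extl (- sup (- u) (- v)) = - sup (- A.extl u) (- A.extl v)"
    using u v ideal_minus[OF A.S1] ideal_sup[OF A.S1] by (simp add: neg extl_sup)
  then show ?thesis by (simp only: inf_eq_neg_sup[symmetric])
qed

end

lemma riesz_le_iff:
  assumes F: "riesz_space F" and x: "x \<in> carrier F" and y: "y \<in> carrier F"
  shows "x \<preceq>\<^bsub>F\<^esub> y \<longleftrightarrow> \<zero>\<^bsub>F\<^esub> \<preceq>\<^bsub>F\<^esub> y \<oplus>\<^bsub>F\<^esub> (-1) \<odot>\<^bsub>F\<^esub> x"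
proof -
  let ?m = "(-1) \<odot>\<^bsub>F\<^esub> x"
  have m: "?m \<in> carrier F" by (rule riesz_smult[OF F x])
  have ym: "y \<oplus>\<^bsub>F\<^esub> ?m \<in> carrier F" by (rule riesz_add[OF F y m])
  show ?thesis
  proof
    assume "x \<preceq>\<^bsub>F\<^esub> y"
    then have "?m \<oplus>\<^bsub>F\<^esub> x \<preceq>\<^bsub>F\<^esub> ?m \<oplus>\<^bsub>F\<^esub> y" by (rule riesz_add_mono[OF F x y m])
    then show "\<zero>\<^bsub>F\<^esub> \<preceq>\<^bsub>F\<^esub> y \<oplus>\<^bsub>F\<^esub> ?m"
      by (simp only: riesz_left_inv[OF F x] riesz_add_comm[OF F m y])
  next
    assume "\<zero>\<^bsub>F\<^esub> \<preceq>\<^bsub>F\<^esub> y \<oplus>\<^bsub>F\<^esub> ?m"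
    then have "x \<oplus>\<^bsub>F\<^esub> \<zero>\<^bsub>F\<^esub> \<preceq>\<^bsub>F\<^esub> x \<oplus>\<^bsub>F\<^esub> (y \<oplus>\<^bsub>F\<^esub> ?m)" by (rule riesz_add_mono[OF F riesz_zero[OF F] ym x])
    moreover have "x \<oplus>\<^bsub>F\<^esub> \<zero>\<^bsub>F\<^esub> = x"
      by (simp only: riesz_add_comm[OF F x riesz_zero[OF F]] riesz_zero_add[OF F x])
    moreover have "x \<oplus>\<^bsub>F\<^esub> (y \<oplus>\<^bsub>F\<^esub> ?m) = y"
      by (simp only: riesz_add_comm[OF F x ym] riesz_add_assoc[OF F y m x] riesz_left_inv[OF F x]
        riesz_add_comm[OF F y riesz_zero[OF F]] riesz_zero_add[OF F y])
    ultimately show "x \<preceq>\<^bsub>F\<^esub> y" by simp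
  qed
qed

text \<open>The image consists of the elements of the product that vanish in every component other
  than \<open>E\<close>, and this set is solid.\<close>

lemma rep_single:
  assumes E: "dedekind_complete E" shows "rep_ideal E (single E)"
proof -
  have R: "riesz_space E" by (rule dc_riesz[OF E])
  have sm0: "a \<odot>\<^bsub>F\<^esub> \<zero>\<^bsub>F\<^esub> = \<zero>\<^bsub>F\<^esub>" if "dedekind_complete F" for a and F :: "'a riesz"
    using cmp_scaleR[OF that, of a 0] cmp_zero[OF that] by simp
  have add0: "\<zero>\<^bsub>F\<^esub> \<oplus>\<^bsub>F\<^esub> \<zero>\<^bsub>F\<^esub> = \<zero>\<^bsub>F\<^esub>" if "dedekind_complete F" for F :: "'a riesz"
    using cmp_add[OF that, of 0 0] cmp_zero[OF that] by simp
  have neg: "cmp (- f) F = (-1) \<odot>\<^bsub>F\<^esub> cmp f F" if "dedekind_complete F" for F :: "'a riesz" and f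
    using cmp_scaleR[OF that, of "-1" f] by simp
  have mem: "f \<in> single E ` carrier E \<longleftrightarrow> (\<forall>F. dedekind_complete F \<longrightarrow> F \<noteq> E \<longrightarrow> cmp f F = \<zero>\<^bsub>F\<^esub>)" for f
  proof
    assume "\<forall>F. dedekind_complete F \<longrightarrow> F \<noteq> E \<longrightarrow> cmp f F = \<zero>\<^bsub>F\<^esub>"
    then have "f = single E (cmp f E)"
      by (intro dprod_eqI) (auto simp: cmp_single cmp_closed E)
    then show "f \<in> single E ` carrier E" using cmp_closed[OF E] by blast
  qed (auto simp: cmp_single)
  have ideal: "order_ideal (single E ` carrier E)"
    unfolding order_ideal_def
  proof (intro conjI ballI allI impI)
    show "0 \<in> single E ` carrier E" by (simp add: mem cmp_zero)
    fix x y assume "x \<in> single E ` carrier E" "y \<in> single E ` carrier E"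
    then show "x + y \<in> single E ` carrier E" unfolding mem by (simp add: cmp_add add0)
  next
    fix c x assume "x \<in> single E ` carrier E"
    then show "c *\<^sub>R x \<in> single E ` carrier E" unfolding mem by (simp add: cmp_scaleR sm0)
  next
    fix x y assume y: "y \<in> single E ` carrier E" and le: "\<bar>x\<bar> \<le> \<bar>y\<bar>"
    show "x \<in> single E ` carrier E"
      unfolding mem
    proof (intro allI impI)
      fix F assume F: "dedekind_complete F" "F \<noteq> E"
      note RF = dc_riesz[OF F(1)]
      have z: "\<zero>\<^bsub>F\<^esub> \<in> carrier F" by (rule riesz_zero[OF RF])
      have y0: "cmp y F = \<zero>\<^bsub>F\<^esub>" using y F unfolding mem by blast
      have "\<zero>\<^bsub>F\<^esub> \<squnion>\<^bsub>ord_of F\<^esub> \<zero>\<^bsub>F\<^esub> = \<zero>\<^bsub>F\<^esub>"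
        using riesz_join_le[OF RF z z z] riesz_join_left[OF RF z z] riesz_join[OF RF z z] riesz_refl[OF RF z]
        by (intro riesz_antisym[OF RF]) (use z in blast)+
      then have ay: "cmp \<bar>y\<bar> F = \<zero>\<^bsub>F\<^esub>"
        by (simp add: abs_lattice cmp_sup[OF F(1)] neg[OF F(1)] y0 sm0[OF F(1)])
      have "x \<le> \<bar>y\<bar>" "- \<bar>y\<bar> \<le> x" using le abs_le_D1 abs_le_D2 minus_le_iff by (blast, metis abs_le_D2 minus_le_iff le)
      then have "cmp x F \<preceq>\<^bsub>F\<^esub> \<zero>\<^bsub>F\<^esub>" "\<zero>\<^bsub>F\<^esub> \<preceq>\<^bsub>F\<^esub> cmp x F"
        using F(1) ay neg[OF F(1), of "\<bar>y\<bar>"] sm0[OF F(1)] by (auto simp: less_eq_dprod_def)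
      then show "cmp x F = \<zero>\<^bsub>F\<^esub>" by (intro riesz_antisym[OF RF cmp_closed[OF F(1)] z])
    qed
  qed
  show ?thesis
  proof
    fix x y a assume x: "x \<in> carrier E" and y: "y \<in> carrier E"
    show "single E (x \<oplus>\<^bsub>E\<^esub> y) = single E x + single E y"
      using x y by (intro dprod_eqI) (auto simp: cmp_single cmp_add riesz_add[OF R] add0)
    show "single E (a \<odot>\<^bsub>E\<^esub> x) = a *\<^sub>R single E x"
      using x by (intro dprod_eqI) (auto simp: cmp_single cmp_scaleR riesz_smult[OF R] sm0)
    show "x \<preceq>\<^bsub>E\<^esub> y \<longleftrightarrow> single E x \<le> single E y"
      using x y E by (auto simp: less_eq_dprod_def cmp_single riesz_refl riesz_zero dc_riesz)
  next
    show "inj_on (single E) (carrier E)"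
      by (rule inj_onI) (metis cmp_single[OF _ E])
    show "single E \<zero>\<^bsub>E\<^esub> = 0"
      by (rule dprod_eqI) (auto simp: cmp_single riesz_zero[OF R] cmp_zero)
  qed (auto intro: riesz_zero[OF R] riesz_add[OF R] riesz_smult[OF R] ideal ideal_riesz_sub)
qed

text \<open>Linearity and bipositivity give an order embedding, since comparing two elements means
  testing the sign of their difference; injectivity follows by antisymmetry.\<close>

lemma rep_compose:
  assumes U: "rep U k" and E: "riesz_space E" and lin: "linear_map E U j" and bip: "bipositive E U j"
    and sub: "riesz_subspace U (j ` carrier E)"
  shows "rep E (\<lambda>x. k (j x))"
proof -
  interpret U: rep U k by (rule U)
  have j: "j x \<in> carrier U" if "x \<in> carrier E" for x using lin that by (auto simp: linear_map_def)
  have jadd: "j (x \<oplus>\<^bsub>E\<^esub> y) = j x \<oplus>\<^bsub>U\<^esub> j y" if "x \<in> carrier E" "y \<in> carrier E" for x y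
    using lin that by (auto simp: linear_map_def)
  have jsm: "j (a \<odot>\<^bsub>E\<^esub> x) = a \<odot>\<^bsub>U\<^esub> j x" if "x \<in> carrier E" for a x
    using lin that by (auto simp: linear_map_def)
  have kadd: "k (j (x \<oplus>\<^bsub>E\<^esub> y)) = k (j x) + k (j y)" if "x \<in> carrier E" "y \<in> carrier E" for x y
    using that by (simp add: jadd U.k_add j)
  have ksm: "k (j (a \<odot>\<^bsub>E\<^esub> x)) = a *\<^sub>R k (j x)" if "x \<in> carrier E" for a x
    using that by (simp add: jsm U.k_smult j)
  have le: "x \<preceq>\<^bsub>E\<^esub> y \<longleftrightarrow> k (j x) \<le> k (j y)" if x: "x \<in> carrier E" and y: "y \<in> carrier E" for x y
  proof -
    let ?d = "y \<oplus>\<^bsub>E\<^esub> (-1) \<odot>\<^bsub>E\<^esub> x"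
    have m: "(-1) \<odot>\<^bsub>E\<^esub> x \<in> carrier E" by (rule riesz_smult[OF E x])
    have d: "?d \<in> carrier E" by (rule riesz_add[OF E y m])
    have "x \<preceq>\<^bsub>E\<^esub> y \<longleftrightarrow> \<zero>\<^bsub>U\<^esub> \<preceq>\<^bsub>U\<^esub> j ?d"
      using riesz_le_iff[OF E x y] bip d by (simp add: bipositive_def)
    also have "\<dots> \<longleftrightarrow> 0 \<le> k (j ?d)" by (simp add: U.k_le U.zero_closed j d U.k_zero)
    also have "k (j ?d) = k (j y) - k (j x)" using kadd[OF y m] ksm[OF x, of "-1"] by simp
    finally show ?thesis by simp
  qed
  show ?thesis
  proof
    show "inj_on (\<lambda>x. k (j x)) (carrier E)"
      by (rule inj_onI, rule riesz_antisym[OF E]) (simp_all add: le)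
    show "k (j \<zero>\<^bsub>E\<^esub>) = 0"
      using kadd[of "\<zero>\<^bsub>E\<^esub>" "\<zero>\<^bsub>E\<^esub>"] riesz_zero[OF E] riesz_zero_add[OF E] by simp
    show "riesz_sub ((\<lambda>x. k (j x)) ` carrier E)"
      using U.riesz_subspace_k[of "j ` carrier E"] sub j by (auto simp: image_image)
  qed (simp_all add: riesz_zero[OF E] riesz_add[OF E] riesz_smult[OF E] kadd ksm le)
qed

lemma rep_idealI:
  fixes k :: "'a \<Rightarrow> 'u::dc_vector_lattice"
  assumes E: "rep E k" "dedekind_complete E" and W: "order_ideal W" "k ` carrier E \<subseteq> W" "order_dense_in (k ` carrier E) W"
  shows "rep_ideal E k"
proof -
  interpret rep E k by (rule E)
  note r = riesz_subD[OF k_img]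
  have "order_ideal S"
  proof (rule order_dense_complete_ideal[OF r(1,2,4,7) W])
    fix A b assume "A \<subseteq> S" "A \<noteq> {}" "b \<in> S" "\<And>a. a \<in> A \<Longrightarrow> a \<le> b"
    then have "\<exists>s. lub_in S A s" using dedekind_k E(2) unfolding complete_set_def by blast
    then show "\<exists>s\<in>S. (\<forall>a\<in>A. a \<le> s) \<and> (\<forall>c\<in>S. (\<forall>a\<in>A. a \<le> c) \<longrightarrow> s \<le> c)"
      unfolding lub_in_def by blast
  qed
  then show ?thesis by (intro rep_ideal.intro E rep_ideal_axioms.intro)
qed

text \<open>Transport of structure along an injection \<open>g\<close>. It brings a space
  constructed in an auxiliary type back to the type that the statement prescribes.\<close>

definition record_of :: "'u::vector_lattice set \<Rightarrow> ('u \<Rightarrow> 'p) \<Rightarrow> 'p riesz"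
  where "record_of S g = \<lparr>carrier = g ` S, monoid.mult = (\<lambda>_ _. g 0), one = g 0, zero = g 0,
    add = (\<lambda>x y. g (inv_into S g x + inv_into S g y)),
    smult = (\<lambda>a x. g (a *\<^sub>R inv_into S g x)), rle = (\<lambda>x y. inv_into S g x \<le> inv_into S g y)\<rparr>"

lemma rep_record_of:
  assumes g: "inj_on g S" and S: "riesz_sub S"
  shows "rep (record_of S g) (inv_into S g)" and "inv_into S g ` carrier (record_of S g) = S"
proof -
  have inv: "inv_into S g (g u) = u" if "u \<in> S" for u using g that by (rule inv_into_f_f)
  note r = riesz_subD[OF S]
  show img: "inv_into S g ` carrier (record_of S g) = S"
    by (auto simp: record_of_def inv image_image)
  show "rep (record_of S g) (inv_into S g)"
  proof
    show "inj_on (inv_into S g) (carrier (record_of S g))"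
      by (simp add: record_of_def inj_on_inv_into)
  qed (auto simp: img S, auto simp: record_of_def inv r)
qed

lemma rep_map:
  assumes "rep E k" "rep E' k'" and i: "\<And>x. x \<in> carrier E \<Longrightarrow> i x \<in> carrier E'"
    and ki: "\<And>x. x \<in> carrier E \<Longrightarrow> k' (i x) = k x"
  shows "linear_map E E' i \<and> bipositive E E' i"
proof -
  interpret A: rep E k by fact
  interpret B: rep E' k' by fact
  have "i (x \<oplus>\<^bsub>E\<^esub> y) = i x \<oplus>\<^bsub>E'\<^esub> i y" if "x \<in> carrier E" "y \<in> carrier E" for x y
    using that by (subst B.k_eq[symmetric]) (simp_all add: i ki A.add_closed A.k_add B.add_closed B.k_add)
  moreover have "i (a \<odot>\<^bsub>E\<^esub> x) = a \<odot>\<^bsub>E'\<^esub> i x" if "x \<in> carrier E" for a x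
    using that by (subst B.k_eq[symmetric]) (simp_all add: i ki A.smult_closed A.k_smult B.smult_closed B.k_smult)
  moreover have "\<zero>\<^bsub>E'\<^esub> \<preceq>\<^bsub>E'\<^esub> i x \<longleftrightarrow> \<zero>\<^bsub>E\<^esub> \<preceq>\<^bsub>E\<^esub> x" if "x \<in> carrier E" for x
    using that by (simp add: A.k_le B.k_le i ki A.zero_closed B.zero_closed A.k_zero B.k_zero)
  ultimately show ?thesis using i by (simp add: linear_map_def bipositive_def)
qed

section \<open>Existence and uniqueness\<close>

text \<open>The universal completion \<open>U\<close> of \<open>E1\<close> becomes a factor of the
  product, and \<open>E1\<close> and \<open>E\<close> are placed inside it along \<open>j\<close>
  and \<open>i1\<close>; \<open>W\<close> is the image of \<open>U\<close>. The images of
  \<open>E1\<close> and \<open>E\<close> are ideals because both spaces are Dedekind complete and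
  order dense in the space that contains them.\<close>

lemma completion_rep:
  fixes E :: "'a riesz" and E1 :: "'b riesz"
  assumes E: "dedekind_complete E" and c: "T_universal_completion E e T E1 e1 T1 i1"
  obtains W and k :: "'b \<Rightarrow> 'b set dprod"
  where "rep_ideal E1 k" "rep_ideal E (\<lambda>x. k (i1 x))" "order_ideal W" "laterally_complete W"
    "k ` carrier E1 \<subseteq> W" "order_dense_in (k ` carrier E1) W"
    "order_dense_in ((\<lambda>x. k (i1 x)) ` carrier E) (k ` carrier E1)"
    "conditional_on (k ` carrier E1) (k e1) (rep.induced E1 k T1)"
    "complete_in (k ` carrier E1) (rep.induced E1 k T1) W"
proof -
  note c' = c[unfolded T_universal_completion_def]
  have ct: "conditional_riesz_triple E1 e1 T1" using c' by blast
  then have E1: "dedekind_complete E1" by (simp add: conditional_riesz_triple_def)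
  have "T_universally_complete E1 T1" using c' by blast
  then obtain U :: "'b set riesz" and j where U: "universal_completion E1 U j"
    and sup': "\<forall>A. A \<subseteq> carrier E1 \<and> A \<noteq> {} \<and> directed_up E1 A \<and> Upper (ord_of U) (j ` T1 ` A) \<noteq> {} \<longrightarrow>
      (\<exists>s. is_lub (ord_of E1) s A)"
    unfolding T_universally_complete_def by (elim exE conjE)
  have sup: "\<exists>s. is_lub (ord_of E1) s A" if "A \<subseteq> carrier E1" "A \<noteq> {}" "directed_up E1 A"
      "Upper (ord_of U) (j ` T1 ` A) \<noteq> {}" for A
    using sup' that by simp
  note U' = U[unfolded universal_completion_def]
  have uc: "universally_complete U" using U' by blast
  interpret U: rep_ideal U "single U" by (rule rep_single) (use uc in \<open>simp add: universally_complete_def\<close>)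
  let ?k = "\<lambda>x. single U (j x)" and ?W = "single U ` carrier U"
  have jc: "j ` carrier E1 \<subseteq> carrier U" using U' by (auto simp: linear_map_def)
  have sub: "?k ` carrier E1 \<subseteq> ?W" using jc by auto
  have "order_dense_in (single U ` j ` carrier E1) ?W" using U.order_dense_k[OF jc] U' by blast
  then have dense: "order_dense_in (?k ` carrier E1) ?W" by (simp add: image_image)
  have r1: "rep E1 ?k" using rep_compose[OF U.rep_axioms] U' by blast
  interpret K: rep_ideal E1 ?k by (rule rep_idealI[OF r1 E1 U.ideal sub dense])
  have ic: "i1 ` carrier E \<subseteq> carrier E1" using c' by (auto simp: linear_map_def)
  have "order_dense_in (?k ` i1 ` carrier E) (?k ` carrier E1)" using K.order_dense_k[OF ic] c' by blast
  then have dF: "order_dense_in ((\<lambda>x. ?k (i1 x)) ` carrier E) (?k ` carrier E1)" by (simp add: image_image)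
  have rE: "rep E (\<lambda>x. ?k (i1 x))" using rep_compose[OF r1 dc_riesz[OF E], of i1] c' by blast
  have rE': "rep_ideal E (\<lambda>x. ?k (i1 x))"
    by (rule rep_idealI[OF rE E K.ideal _ dF]) (use ic in auto)
  have cd: "e1 \<in> carrier E1 \<and> T1 \<in> carrier E1 \<rightarrow> carrier E1 \<and> conditional_on K.S (?k e1) (K.induced T1)"
    by (rule K.conditional_tripleD[OF ct])
  have "complete_in K.S (K.induced T1) ?W"
    unfolding complete_in_def
  proof (intro allI impI, elim conjE bexE)
    fix A b assume A: "A \<subseteq> K.S" "dir A" and b: "b \<in> ?W" "\<forall>a\<in>A. K.induced T1 a \<le> b"
    obtain A' where A': "A' \<subseteq> carrier E1" "A = ?k ` A'" using A(1) by (auto simp: subset_image_iff)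
    have ne: "A' \<noteq> {}" using A(2) A' by (auto simp: dir_def)
    obtain b' where b': "b' \<in> carrier U" "b = single U b'" using b(1) by blast
    have jT: "j ` T1 ` A' \<subseteq> carrier U" using jc cd A'(1) by auto
    have "j (T1 a) \<preceq>\<^bsub>U\<^esub> b'" if a: "a \<in> A'" for a
    proof -
      have "a \<in> carrier E1" "j (T1 a) \<in> carrier U" using a A'(1) jT by auto
      moreover have "K.induced T1 (?k a) \<le> b" using b(2) A' a by blast
      ultimately show ?thesis using b' by (simp add: K.induced_k U.k_le)
    qed
    then have "Upper (ord_of U) (j ` T1 ` A') \<noteq> {}"
      unfolding Upper_nonempty_iff[OF jT] using b'(1) by auto
    moreover have "directed_up E1 A'" using K.directed_up_k[OF A'(1) ne] A(2) A'(2) by simp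
    ultimately obtain s where "is_lub (ord_of E1) s A'" using sup[OF A'(1) ne] by blast
    then have "s \<in> carrier E1" "lub (?k ` A') (?k s)" using K.is_lub_k[OF A'(1) ne] by auto
    then show "\<exists>s\<in>K.S. lub A s" using A'(2) by blast
  qed
  then show thesis
    using that[OF K.rep_ideal_axioms rE' U.ideal U.laterally_completeD[OF uc] sub dense dF] cd by blast
qed

text \<open>Applied to the two copies of \<open>E\<close> in different completions, where it shows
  that the identification between them is positive.\<close>

lemma positive_transfer:
  assumes "rep E k" "rep E l" shows "positive_on (k ` carrier E) (\<lambda>u. l (inv_into (carrier E) k u))"
proof -
  interpret K: rep E k by fact
  interpret L: rep E l by fact
  show ?thesis
    unfolding positive_on_def
  proof (intro conjI ballI allI impI)
    fix u v assume "u \<in> K.S" "v \<in> K.S"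
    then obtain x y where "x \<in> carrier E" "y \<in> carrier E" "u = k x" "v = k y" by blast
    then show "l (K.k' (u + v)) = l (K.k' u) + l (K.k' v)"
      by (simp add: K.k_add[symmetric] K.k'k K.add_closed L.k_add)
  next
    fix u c assume "u \<in> K.S"
    then obtain x where "x \<in> carrier E" "u = k x" by blast
    then show "l (K.k' (c *\<^sub>R u)) = c *\<^sub>R l (K.k' u)"
      by (simp add: K.k_smult[symmetric] K.k'k K.smult_closed L.k_smult)
  next
    fix u assume "u \<in> K.S" "0 \<le> u"
    then obtain x where x: "x \<in> carrier E" "u = k x" by blast
    then show "0 \<le> l (K.k' u)"
      using \<open>0 \<le> u\<close> K.pos_cone_k[of x] L.pos_cone_k[of x] by (simp add: K.k'k)
  qed
qed

lemma completion_map_rep: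
  fixes E :: "'a riesz" and k1 :: "'b \<Rightarrow> 'v::dc_vector_lattice" and k2 :: "'c \<Rightarrow> 'w::dc_vector_lattice"
  assumes c1: "T_universal_completion E e T E1 e1 T1 i1" and c2: "T_universal_completion E e T E2 e2 T2 i2"
    and TE: "T \<in> carrier E \<rightarrow> carrier E"
    and r1: "rep_ideal E1 k1" "rep_ideal E (\<lambda>x. k1 (i1 x))"
      "order_dense_in ((\<lambda>x. k1 (i1 x)) ` carrier E) (k1 ` carrier E1)"
      "conditional_on (k1 ` carrier E1) (k1 e1) (rep.induced E1 k1 T1)"
    and r2: "rep_ideal E2 k2" "rep_ideal E (\<lambda>x. k2 (i2 x))" "order_ideal W" "laterally_complete W"
    "k2 ` carrier E2 \<subseteq> W" "order_dense_in (k2 ` carrier E2) W"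
    "order_dense_in ((\<lambda>x. k2 (i2 x)) ` carrier E) (k2 ` carrier E2)"
    "conditional_on (k2 ` carrier E2) (k2 e2) (rep.induced E2 k2 T2)"
    "complete_in (k2 ` carrier E2) (rep.induced E2 k2 T2) W"
  shows "completion_map ((\<lambda>x. k1 (i1 x)) ` carrier E) (k1 ` carrier E1) (k1 e1) (rep.induced E1 k1 T1)
    ((\<lambda>x. k2 (i2 x)) ` carrier E) (k2 ` carrier E2) W (k2 e2) (rep.induced E2 k2 T2)
    (\<lambda>u. k2 (i2 (inv_into (carrier E) (\<lambda>x. k1 (i1 x)) u))) (\<lambda>u. k1 (i1 (inv_into (carrier E) (\<lambda>x. k2 (i2 x)) u)))"
proof -
  interpret K1: rep_ideal E1 k1 by fact
  interpret K2: rep_ideal E2 k2 by fact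
  interpret F1: rep_ideal E "\<lambda>x. k1 (i1 x)" by fact
  interpret F2: rep_ideal E "\<lambda>x. k2 (i2 x)" by fact
  note c1' = c1[unfolded T_universal_completion_def] and c2' = c2[unfolded T_universal_completion_def]
  have i: "i1 x \<in> carrier E1" "i2 x \<in> carrier E2" if "x \<in> carrier E" for x
    using c1' c2' that by (auto simp: linear_map_def)
  have Ti: "T1 (i1 x) = i1 (T x)" "T2 (i2 x) = i2 (T x)" "T x \<in> carrier E" if "x \<in> carrier E" for x
    using c1' c2' that TE by auto
  have pos12: "positive_on F1.S (\<lambda>u. k2 (i2 (F1.k' u)))"
    by (rule positive_transfer[OF F1.rep_axioms F2.rep_axioms])
  have pos21: "positive_on F2.S (\<lambda>u. k1 (i1 (F2.k' u)))"
    by (rule positive_transfer[OF F2.rep_axioms F1.rep_axioms])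
  show ?thesis
  proof (intro completion_map.intro r1(3,4) r2 F1.ideal F2.ideal pos12 pos21)
    show "F1.S \<subseteq> K1.S" "F2.S \<subseteq> K2.S" using i by auto
    show "K1.induced T1 ` F1.S \<subseteq> F1.S"
      using Ti i by (auto simp: K1.induced_k)
    show "(\<lambda>u. k2 (i2 (F1.k' u))) ` F1.S \<subseteq> F2.S" by (auto simp: F1.k'k)
    show "(\<lambda>u. k1 (i1 (F2.k' u))) ` F2.S \<subseteq> F1.S" by (auto simp: F2.k'k)
    show "k1 (i1 (F2.k' (k2 (i2 (F1.k' x))))) = x" if "x \<in> F1.S" for x
      using that by (auto simp: F1.k'k F2.k'k)
    show "k2 (i2 (F1.k' (k1 (i1 (F2.k' x))))) = x" if "x \<in> F2.S" for x
      using that by (auto simp: F1.k'k F2.k'k)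
    show "K2.induced T2 (k2 (i2 (F1.k' x))) = k2 (i2 (F1.k' (K1.induced T1 x)))" if "x \<in> F1.S" for x
      using that by (auto simp: F1.k'k K1.induced_k K2.induced_k i Ti)
  qed
qed

lemma completion_unique:
  fixes E :: "'a riesz" and E1 :: "'b riesz" and E2 :: "'c riesz"
  assumes triple: "conditional_riesz_triple E e T"
    and c1: "T_universal_completion E e T E1 e1 T1 i1" and c2: "T_universal_completion E e T E2 e2 T2 i2"
  shows "\<exists>\<Phi>. riesz_iso E1 E2 \<Phi> \<and> (\<forall>x\<in>carrier E. \<Phi> (i1 x) = i2 x) \<and> (\<forall>y\<in>carrier E1. \<Phi> (T1 y) = T2 (\<Phi> y))"
proof -
  have E: "dedekind_complete E" and TE: "T \<in> carrier E \<rightarrow> carrier E"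
    using triple by (auto simp: conditional_riesz_triple_def linear_map_def)
  obtain W1 and k1 :: "'b \<Rightarrow> 'b set dprod" where r1: "rep_ideal E1 k1" "rep_ideal E (\<lambda>x. k1 (i1 x))"
    "order_ideal W1" "laterally_complete W1" "k1 ` carrier E1 \<subseteq> W1" "order_dense_in (k1 ` carrier E1) W1"
    "order_dense_in ((\<lambda>x. k1 (i1 x)) ` carrier E) (k1 ` carrier E1)"
    "conditional_on (k1 ` carrier E1) (k1 e1) (rep.induced E1 k1 T1)"
    "complete_in (k1 ` carrier E1) (rep.induced E1 k1 T1) W1"
    by (rule completion_rep[OF E c1])
  obtain W2 and k2 :: "'c \<Rightarrow> 'c set dprod" where r2: "rep_ideal E2 k2" "rep_ideal E (\<lambda>x. k2 (i2 x))"
    "order_ideal W2" "laterally_complete W2" "k2 ` carrier E2 \<subseteq> W2" "order_dense_in (k2 ` carrier E2) W2"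
    "order_dense_in ((\<lambda>x. k2 (i2 x)) ` carrier E) (k2 ` carrier E2)"
    "conditional_on (k2 ` carrier E2) (k2 e2) (rep.induced E2 k2 T2)"
    "complete_in (k2 ` carrier E2) (rep.induced E2 k2 T2) W2"
    by (rule completion_rep[OF E c2])
  interpret K1: rep_ideal E1 k1 by (rule r1)
  interpret K2: rep_ideal E2 k2 by (rule r2)
  interpret F1: rep_ideal E "\<lambda>x. k1 (i1 x)" by (rule r1)
  interpret P: completion_pair "(\<lambda>x. k1 (i1 x)) ` carrier E" K1.S W1 "k1 e1" "K1.induced T1"
    "(\<lambda>x. k2 (i2 x)) ` carrier E" K2.S W2 "k2 e2" "K2.induced T2"
    "\<lambda>u. k2 (i2 (inv_into (carrier E) (\<lambda>x. k1 (i1 x)) u))" "\<lambda>u. k1 (i1 (inv_into (carrier E) (\<lambda>x. k2 (i2 x)) u))"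
    by (intro completion_pair.intro completion_map_rep[OF c1 c2 TE r1(1,2,7,8) r2]
      completion_map_rep[OF c2 c1 TE r2(1,2,7,8) r1])
  \<comment> \<open>The extension of the identification of the two copies of \<open>E\<close>, read
    in the carriers.\<close>
  define \<Phi> where "\<Phi> y = K2.k' (P.A.extl (k1 y))" for y
  have range: "P.A.extl (k1 y) \<in> K2.S" if "y \<in> carrier E1" for y using P.A.extl_range that by blast
  have \<Phi>: "\<Phi> y \<in> carrier E2" "k2 (\<Phi> y) = P.A.extl (k1 y)" if "y \<in> carrier E1" for y
    using K2.k'_closed[OF range[OF that]] K2.kk'[OF range[OF that]] by (simp_all add: \<Phi>_def)
  have T1: "T1 y \<in> carrier E1" if "y \<in> carrier E1" for y
    using c1 that unfolding T_universal_completion_def conditional_riesz_triple_def linear_map_def by blast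
  have T2: "T2 y \<in> carrier E2" if "y \<in> carrier E2" for y
    using c2 that unfolding T_universal_completion_def conditional_riesz_triple_def linear_map_def by blast
  have i1: "i1 x \<in> carrier E1" and i2: "i2 x \<in> carrier E2" if "x \<in> carrier E" for x
    using c1 c2 that unfolding T_universal_completion_def linear_map_def by blast+
  have lat: "lattice (ord_of E1)" "lattice (ord_of E2)"
    using K1.riesz K2.riesz by (auto simp: riesz_space_def)
  have c: "carrier (ord_of F) = carrier F" for F :: "'z riesz" by (simp add: ord_of_def)
  have "riesz_iso E1 E2 \<Phi>"
    unfolding riesz_iso_def
  proof (intro conjI)
    show "linear_map E1 E2 \<Phi>"
      unfolding linear_map_def
    proof (intro conjI ballI allI)
      fix x y a assume x: "x \<in> carrier E1" and y: "y \<in> carrier E1"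
      show "\<Phi> (x \<oplus>\<^bsub>E1\<^esub> y) = \<Phi> x \<oplus>\<^bsub>E2\<^esub> \<Phi> y"
        using x y positive_onD(1)[OF P.A.extl_positive_on, of "k1 x" "k1 y"]
        by (subst K2.k_eq[symmetric]) (simp_all add: \<Phi> K1.add_closed K1.k_add K2.add_closed K2.k_add)
    next
      fix x a assume x: "x \<in> carrier E1"
      show "\<Phi> (a \<odot>\<^bsub>E1\<^esub> x) = a \<odot>\<^bsub>E2\<^esub> \<Phi> x"
        using x positive_onD(2)[OF P.A.extl_positive_on, of "k1 x" a]
        by (subst K2.k_eq[symmetric]) (simp_all add: \<Phi> K1.smult_closed K1.k_smult K2.smult_closed K2.k_smult)
    qed (use \<Phi> in auto)
    have b1: "bij_betw k1 (carrier E1) K1.S" using K1.k_inj by (simp add: bij_betw_def)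
    have b2: "bij_betw K2.k' K2.S (carrier E2)" using K2.k_inj by (intro bij_betw_inv_into) (simp add: bij_betw_def)
    show "bij_betw \<Phi> (carrier E1) (carrier E2)"
    proof -
      have "\<Phi> = K2.k' \<circ> (P.A.extl \<circ> k1)" by (rule ext) (simp add: \<Phi>_def)
      then show ?thesis using bij_betw_trans[OF bij_betw_trans[OF b1 P.extl_bij] b2] by simp
    qed
    show "join_pres (ord_of E1) (ord_of E2) \<Phi>"
      unfolding join_pres_def c
    proof (intro conjI lat ballI)
      fix x y assume "x \<in> carrier E1" "y \<in> carrier E1"
      then show "\<Phi> (x \<squnion>\<^bsub>ord_of E1\<^esub> y) = \<Phi> x \<squnion>\<^bsub>ord_of E2\<^esub> \<Phi> y"
        by (subst K2.k_eq[symmetric]) (simp_all add: \<Phi> K1.join_k K2.join_k P.extl_sup)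
    qed
    show "meet_pres (ord_of E1) (ord_of E2) \<Phi>"
      unfolding meet_pres_def c
    proof (intro conjI lat ballI)
      fix x y assume "x \<in> carrier E1" "y \<in> carrier E1"
      then show "\<Phi> (x \<sqinter>\<^bsub>ord_of E1\<^esub> y) = \<Phi> x \<sqinter>\<^bsub>ord_of E2\<^esub> \<Phi> y"
        by (subst K2.k_eq[symmetric]) (simp_all add: \<Phi> K1.meet_k K2.meet_k P.extl_inf)
    qed
  qed
  moreover have "\<Phi> (i1 x) = i2 x" if x: "x \<in> carrier E" for x
  proof -
    have "P.A.extl (k1 (i1 x)) = k2 (i2 x)" using P.A.extl_eq[of "k1 (i1 x)"] x by (simp add: F1.k'k)
    then show ?thesis using x by (simp add: \<Phi>_def K2.k'k i2)
  qed
  moreover have "\<Phi> (T1 y) = T2 (\<Phi> y)" if y: "y \<in> carrier E1" for y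
  proof -
    have "k2 (\<Phi> (T1 y)) = K2.induced T2 (k2 (\<Phi> y))"
      using P.A.extl_T[of "k1 y"] y by (simp add: \<Phi> T1 K1.induced_k)
    then show ?thesis using y by (simp add: K2.induced_k \<Phi>(1) K2.k_eq T1 T2)
  qed
  ultimately show ?thesis by blast
qed

lemma completion_exists:
  fixes E :: "'a riesz"
  assumes triple: "conditional_riesz_triple E e T"
  shows "\<exists>(E' :: 'a set riesz) e' T' i. T_universal_completion E e T E' e' T' i"
proof -
  have E: "dedekind_complete E" using triple by (simp add: conditional_riesz_triple_def)
  interpret Q: rep_ideal E "single E" by (rule rep_single[OF E])
  \<comment> \<open>Two embeddings in succession: \<open>E\<close> as one factor of the product of
    all Dedekind complete spaces over its type, then into the universal completion of that
    product.\<close>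
  define k where "k x = emb (single E x)" for x
  have kS: "k ` carrier E = emb ` Q.S" by (simp add: k_def image_image)
  \<comment> \<open>An element below some \<open>emb y\<close> is embedded because
    \<open>range emb\<close> is an ideal, and its preimage lies below \<open>y\<close>, hence in the
    ideal \<open>Q.S\<close>.\<close>
  have kid: "order_ideal (k ` carrier E)"
    unfolding kS order_ideal_def
  proof (intro conjI ballI allI impI)
    show "0 \<in> emb ` Q.S" using ideal_0[OF Q.ideal] emb_0 by (metis imageI)
    fix u v assume "u \<in> emb ` Q.S" "v \<in> emb ` Q.S"
    then obtain x y where xy: "x \<in> Q.S" "y \<in> Q.S" "u = emb x" "v = emb y" by blast
    then show "u + v \<in> emb ` Q.S" using ideal_add[OF Q.ideal xy(1,2)] emb_add by (metis imageI)
  next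
    fix c u assume "u \<in> emb ` Q.S"
    then obtain x where x: "x \<in> Q.S" "u = emb x" by blast
    then show "c *\<^sub>R u \<in> emb ` Q.S" using ideal_scaleR[OF Q.ideal x(1)] emb_scaleR by (metis imageI)
  next
    fix u v assume v: "v \<in> emb ` Q.S" and le: "\<bar>u\<bar> \<le> \<bar>v\<bar>"
    obtain y where y: "y \<in> Q.S" "v = emb y" using v by blast
    then have "u \<in> range emb" using le by (intro ideal_solid[OF range_emb_ideal rangeI[of emb y]]) simp
    then obtain x where x: "u = emb x" by blast
    have "\<bar>x\<bar> \<le> \<bar>y\<bar>" using le by (simp only: x y emb_abs[symmetric] emb_le_iff)
    then show "u \<in> emb ` Q.S" using ideal_solid[OF Q.ideal y(1)] x by blast
  qed
  interpret K: rep_ideal E k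
  proof
    show "inj_on k (carrier E)"
      by (rule inj_onI) (simp add: k_def emb_eq_iff Q.k_eq)
  qed (auto simp: k_def Q.zero_closed Q.k_zero emb_0 Q.add_closed Q.k_add emb_add Q.smult_closed Q.k_smult
      emb_scaleR Q.k_le emb_le_iff ideal_riesz_sub[OF kid[unfolded k_def]] kid[unfolded k_def])
  have cd: "e \<in> carrier E \<and> T \<in> carrier E \<rightarrow> carrier E \<and> conditional_on K.S (k e) (K.induced T)"
    by (rule K.conditional_tripleD[OF triple])
  have eE: "e \<in> carrier E" using cd by blast
  interpret C: conditional_base K.S "k e" "K.induced T"
    by (rule conditional_base.intro[OF conjunct2[OF conjunct2[OF cd]] uc_laterally_complete])
  text \<open>An element of the completion is encoded by the elements of \<open>E\<close> between its negative and positive part.\<close>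
  define g where "g u = {x \<in> carrier E. - pprt (- u) \<le> k x \<and> k x \<le> pprt u}" for u
  have np: "- pprt w \<le> 0" for w :: "'a dprod uc" by simp
  have belowP: "below K.S (pprt u) = k ` {x \<in> g u. 0 \<le> k x}" for u
  proof (intro Set.set_eqI iffI)
    fix v assume "v \<in> below K.S (pprt u)"
    then obtain x where x: "x \<in> carrier E" "v = k x" "0 \<le> k x" "k x \<le> pprt u" by (auto simp: below_def)
    then have "x \<in> g u" using order_trans[OF np x(3)] by (simp add: g_def)
    then show "v \<in> k ` {x \<in> g u. 0 \<le> k x}" using x by blast
  qed (auto simp: below_def g_def)
  have belowN: "below K.S (pprt (- u)) = (\<lambda>x. - k x) ` {x \<in> g u. k x \<le> 0}" for u
  proof (intro Set.set_eqI iffI)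
    fix v assume "v \<in> below K.S (pprt (- u))"
    then have v: "v \<in> K.S" "0 \<le> v" "v \<le> pprt (- u)" by (simp_all add: below_def)
    have "- v \<in> K.S" by (rule ideal_minus[OF K.ideal v(1)])
    then obtain x where x: "x \<in> carrier E" and kx: "k x = - v" by (metis imageE)
    have kx0: "k x \<le> 0" using v(2) by (simp add: kx)
    have "- pprt (- u) \<le> k x" using v(3) by (simp add: kx)
    then have "x \<in> g u" using x order_trans[OF kx0 zero_le_pprt] by (simp add: g_def)
    moreover have "v = - k x" by (simp add: kx)
    ultimately show "v \<in> (\<lambda>x. - k x) ` {x \<in> g u. k x \<le> 0}" using kx0 by blast
  next
    fix v assume "v \<in> (\<lambda>x. - k x) ` {x \<in> g u. k x \<le> 0}"
    then obtain x where x: "x \<in> carrier E" "- pprt (- u) \<le> k x" "k x \<le> 0" "v = - k x"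
      by (auto simp: g_def)
    have "v \<in> K.S" unfolding x(4) by (rule ideal_minus[OF K.ideal imageI[OF x(1)]])
    moreover have "- k x \<le> pprt (- u)" using x(2) by (simp only: minus_le_iff)
    ultimately show "v \<in> below K.S (pprt (- u))" using x(3) by (simp add: below_def x(4))
  qed
  note Bi = double_perp_ideal[of K.S]
  have lubB: "lub (below K.S v) v" if "v \<in> C.B" "0 \<le> v" for v
    by (rule order_dense_lub[OF ideal_0[OF K.ideal] ideal_add[OF K.ideal] Bi double_perp_dense[OF K.ideal] that])
  \<comment> \<open>By density the positive and the negative part of \<open>u\<close> are the
    suprema of sets that can be read off from \<open>g u\<close>.\<close>
  have g_inj: "inj_on g C.B"
  proof (rule inj_onI)
    fix u v assume u: "u \<in> C.B" and v: "v \<in> C.B" and gg: "g u = g v"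
    have "below K.S (pprt u) = below K.S (pprt v)" by (simp only: belowP gg)
    then have "lub (below K.S (pprt u)) (pprt v)" using lubB[OF ideal_pprt[OF Bi v] zero_le_pprt] by simp
    with lubB[OF ideal_pprt[OF Bi u] zero_le_pprt] have "pprt u = pprt v" by (rule lub_unique)
    moreover have "below K.S (pprt (- u)) = below K.S (pprt (- v))" by (simp only: belowN gg)
    then have "lub (below K.S (pprt (- u))) (pprt (- v))"
      using lubB[OF ideal_pprt[OF Bi ideal_minus[OF Bi v]] zero_le_pprt] by simp
    with lubB[OF ideal_pprt[OF Bi ideal_minus[OF Bi u]] zero_le_pprt] have "pprt (- u) = pprt (- v)"
      by (rule lub_unique)
    ultimately show "u = v" using pprt_diff by metis
  qed
  have EtB: "C.Et \<subseteq> C.B" by (auto simp: C.Et_def)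
  have g_inj': "inj_on g C.Et" using g_inj EtB by (rule inj_on_subset)
  define E' where "E' = record_of C.Et g"
  define k' where "k' = inv_into C.Et g"
  have k'g: "k' (g u) = u" if "u \<in> C.Et" for u unfolding k'_def using g_inj' that by (rule inv_into_f_f)
  have rE': "rep E' k'" and im': "k' ` carrier E' = C.Et"
    unfolding E'_def k'_def by (rule rep_record_of[OF g_inj' ideal_riesz_sub[OF C.Et_ideal]])+
  interpret K': rep_ideal E' k'
    by (intro rep_ideal.intro rE' rep_ideal_axioms.intro) (simp add: im' C.Et_ideal)
  have cE': "carrier E' = g ` C.Et" by (simp add: E'_def record_of_def)
  define T' where "T' x = g (C.extl (k' x))" for x
  define i where "i x = g (k x)" for x
  have kEt: "k x \<in> C.Et" if "x \<in> carrier E" for x using C.F_Et that by blast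
  have T'c: "T' \<in> carrier E' \<rightarrow> carrier E'"
  proof
    fix x assume "x \<in> carrier E'"
    then have "k' x \<in> C.Et" using im' by blast
    then show "T' x \<in> carrier E'" unfolding cE' T'_def using C.extl_Et by blast
  qed
  have ind: "C.extl u = K'.induced T' u" if "u \<in> C.Et" for u
  proof -
    have "K'.induced T' (k' (g u)) = k' (T' (g u))" using that cE' by (intro K'.induced_k) blast
    then show ?thesis using that C.extl_Et by (simp add: T'_def k'g image_subset_iff)
  qed
  have i: "i x \<in> carrier E'" and ki: "k' (i x) = k x" if "x \<in> carrier E" for x
    using kEt[OF that] k'g by (simp_all add: i_def cE')
  have cond': "conditional_riesz_triple E' (i e) T'"
  proof (rule K'.conditional_tripleI[OF i[OF eE] T'c])
    show "conditional_on K'.S (k' (i e)) (K'.induced T')"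
      unfolding im' ki[OF eE] by (rule conditional_on_cong[OF ind C.conditional_Et])
  qed
  \<comment> \<open>The universal completion of a space over \<open>'a set\<close> has to live over
    \<open>'a set set\<close>; one more singleton around \<open>g u\<close> provides this.\<close>
  define U where "U = record_of C.B (\<lambda>u. {g u})"
  define kU where "kU = inv_into C.B (\<lambda>u. {g u})"
  have gU: "inj_on (\<lambda>u. {g u}) C.B" using g_inj by (auto simp: inj_on_def)
  have rU: "rep U kU" and imU: "kU ` carrier U = C.B"
    unfolding U_def kU_def by (rule rep_record_of[OF gU ideal_riesz_sub[OF Bi]])+
  interpret KU: rep_ideal U kU
    by (intro rep_ideal.intro rU rep_ideal_axioms.intro) (simp add: imU Bi)
  have cU: "carrier U = (\<lambda>u. {g u}) ` C.B" by (simp add: U_def record_of_def)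
  have kUg: "kU {g u} = u" if "u \<in> C.B" for u unfolding kU_def using gU that by (rule inv_into_f_f)
  define j where "j x = {g (k' x)}" for x
  have jc: "j x \<in> carrier U" and kj: "kU (j x) = k' x" if "x \<in> carrier E'" for x
  proof -
    have "k' x \<in> C.B" using im' that EtB by blast
    then show "j x \<in> carrier U" "kU (j x) = k' x" by (auto simp: j_def cU kUg)
  qed
  have jsub: "j ` carrier E' \<subseteq> carrier U" using jc by blast
  have kjE: "kU ` j ` carrier E' = C.Et" unfolding im'[symmetric] image_image using kj by (intro image_cong) auto
  have uc: "universal_completion E' U j"
    unfolding universal_completion_def
  proof (intro conjI)
    show "riesz_space E'" by (rule K'.riesz)
    show "universally_complete U"
      by (rule KU.universally_completeI) (simp add: imU double_perp_laterally_complete[OF uc_laterally_complete])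
    have "linear_map E' U j \<and> bipositive E' U j" by (rule rep_map[OF rE' rU jc kj])
    then show "linear_map E' U j" "bipositive E' U j" by auto
    show "riesz_subspace U (j ` carrier E')"
      unfolding KU.riesz_subspace_k[OF jsub] kjE by (rule ideal_riesz_sub[OF C.Et_ideal])
    have "order_dense_in C.Et C.B"
      using double_perp_dense[OF K.ideal] subsetD[OF C.F_Et] unfolding order_dense_in_def by meson
    then show "order_dense U (j ` carrier E')" unfolding KU.order_dense_k[OF jsub] kjE imU .
  qed
  have Tuc: "T_universally_complete E' T'"
    unfolding T_universally_complete_def
  proof (rule exI[of _ U], rule exI[of _ j], rule conjI[OF uc], intro allI impI, elim conjE)
    fix A assume A: "A \<subseteq> carrier E'" "A \<noteq> {}" "directed_up E' A" "Upper (ord_of U) (j ` T' ` A) \<noteq> {}"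
    have "T' ` A \<subseteq> carrier E'" using A(1) T'c by auto
    then have sub: "j ` T' ` A \<subseteq> carrier U" using jc by auto
    from A(4)[unfolded Upper_nonempty_iff[OF sub]] obtain b
      where b0: "b \<in> carrier U" "\<forall>a\<in>j ` T' ` A. a \<preceq>\<^bsub>U\<^esub> b" by (rule bexE)
    then have b: "b \<in> carrier U" "\<And>x. x \<in> A \<Longrightarrow> j (T' x) \<preceq>\<^bsub>U\<^esub> b" by simp_all
    have bd: "C.extl (k' x) \<le> kU b" if x: "x \<in> A" for x
    proof -
      have x': "x \<in> carrier E'" "T' x \<in> carrier E'" using x A(1) T'c by auto
      have "kU (j (T' x)) \<le> kU b" using b(2)[OF x] KU.k_le[OF jc[OF x'(2)] b(1)] by simp
      moreover have "k' (T' x) = C.extl (k' x)"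
        using ind[of "k' x"] imageI[OF x'(1), of k'] unfolding im' by (simp add: K'.induced_k x'(1))
      ultimately show ?thesis using kj[OF x'(2)] by simp
    qed
    obtain a0 where a0: "a0 \<in> A" using A(2) by blast
    let ?u0 = "k' a0"
    \<comment> \<open>Completeness of \<open>Et\<close> is known for positive families, while
      \<open>A\<close> is arbitrary. By directedness \<open>A\<close> has the same upper bounds as
      its part above \<open>?u0\<close>, and that part is translated to start at 0.\<close>
    let ?D = "(\<lambda>x. k' x - ?u0) ` {x \<in> A. ?u0 \<le> k' x}"
    have kA: "k' x \<in> C.Et" if "x \<in> A" for x
    proof -
      have "k' x \<in> K'.S" using that A(1) by blast
      then show ?thesis by (simp only: im')
    qed
    have "dir (k' ` A)" using K'.directed_up_k[OF A(1,2)] A(3) by simp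
    then have dirA: "\<exists>z\<in>A. k' x \<le> k' z \<and> k' y \<le> k' z" if "x \<in> A" "y \<in> A" for x y
      using that unfolding dir_def by blast
    have "\<exists>s\<in>C.Et. lub ?D s"
    proof (rule C.complete_Et[unfolded complete_in_def, rule_format], intro conjI)
      show "?D \<subseteq> C.Et" using kA a0 ideal_diff[OF C.Et_ideal] by auto
      show "dir ?D"
        unfolding dir_def
      proof (intro conjI ballI)
        show "?D \<noteq> {}" using a0 by auto
        fix p q assume "p \<in> ?D" "q \<in> ?D"
        then obtain x y where xy: "x \<in> A" "y \<in> A" "?u0 \<le> k' x" "p = k' x - ?u0" "q = k' y - ?u0" by blast
        obtain z where z: "z \<in> A" "k' x \<le> k' z" "k' y \<le> k' z" using dirA[OF xy(1,2)] by blast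
        have "?u0 \<le> k' z" using xy(3) z(2) by (rule order_trans)
        then show "\<exists>r\<in>?D. p \<le> r \<and> q \<le> r"
          using z xy by (intro bexI[of _ "k' z - ?u0"]) auto
      qed
      show "\<forall>a\<in>?D. 0 \<le> a" by auto
      show "\<exists>c\<in>C.B. \<forall>a\<in>?D. C.extl a \<le> c"
      proof (intro bexI ballI)
        \<comment> \<open>The bound of the extended values on \<open>A\<close>, translated along
          with the family.\<close>
        show "kU b - C.extl ?u0 \<in> C.B"
          using b(1) imU C.extl_Et kA[OF a0] EtB by (intro ideal_diff[OF Bi]) auto
        fix a assume "a \<in> ?D"
        then obtain x where x: "x \<in> A" "a = k' x - ?u0" by blast
        have "C.extl a = C.extl (k' x) - C.extl ?u0"
          unfolding x(2) by (rule positive_on_diff[OF C.Et_ideal C.extl_positive_on kA[OF x(1)] kA[OF a0]])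
        then show "C.extl a \<le> kU b - C.extl ?u0" using bd[OF x(1)] by simp
      qed
    qed
    then obtain s where s: "s \<in> C.Et" "lub ?D s" by blast
    have sE: "s + ?u0 \<in> C.Et" using s(1) kA[OF a0] ideal_add[OF C.Et_ideal] by blast
    have "lub (k' ` A) (s + ?u0)"
    proof (rule lubI)
      fix p assume "p \<in> k' ` A"
      then obtain x where x: "x \<in> A" "p = k' x" by blast
      obtain z where z: "z \<in> A" "k' x \<le> k' z" "?u0 \<le> k' z" using dirA[OF x(1) a0] by blast
      have "k' z - ?u0 \<le> s" using z by (intro lub_ge[OF s(2)]) blast
      then have "k' z \<le> s + ?u0" by (simp only: diff_le_eq)
      then show "p \<le> s + ?u0" using x z(2) by simp
    next
      fix c assume c: "\<And>p. p \<in> k' ` A \<Longrightarrow> p \<le> c"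
      have "s \<le> c - ?u0" by (rule lub_le[OF s(2)]) (use c in auto)
      then show "s + ?u0 \<le> c" by (simp only: le_diff_eq)
    qed
    moreover have "k' (g (s + ?u0)) = s + ?u0" "g (s + ?u0) \<in> carrier E'" using k'g sE cE' by auto
    ultimately have "is_lub (ord_of E') (g (s + ?u0)) A" using K'.is_lub_k[OF A(1,2)] by simp
    then show "\<exists>s. is_lub (ord_of E') s A" by blast
  qed
  have isub: "i ` carrier E \<subseteq> carrier E'" using i by blast
  have iK: "k' ` i ` carrier E = K.S" unfolding image_image using ki by (intro image_cong) auto
  have "T_universal_completion E e T E' (i e) T' i"
    unfolding T_universal_completion_def
  proof (intro conjI cond' Tuc refl ballI)
    have "linear_map E E' i \<and> bipositive E E' i" by (rule rep_map[OF K.rep_axioms rE' i ki])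
    then show "linear_map E E' i" "bipositive E E' i" by auto
    show "riesz_subspace E' (i ` carrier E)"
      unfolding K'.riesz_subspace_k[OF isub] iK by (rule ideal_riesz_sub[OF K.ideal])
    show "order_dense E' (i ` carrier E)"
      unfolding K'.order_dense_k[OF isub] iK im' by (rule C.F_dense)
    fix x assume x: "x \<in> carrier E"
    have "C.extl (k x) = k (T x)" using C.extl_eq[of "k x"] x by (simp add: K.induced_k)
    then show "T' (i x) = i (T x)" using ki[OF x] by (simp add: T'_def i_def)
  qed
  then show ?thesis by blast
qed

theorem theorem3p2:
  fixes E :: "'a riesz" and e :: 'a and T :: "'a \<Rightarrow> 'a"
  assumes "conditional_riesz_triple E e T"
  shows "(\<exists>(E' :: 'a set riesz) e' T' i. T_universal_completion E e T E' e' T' i) \<and>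
    (\<forall>(E\<^sub>1 :: 'b riesz) e\<^sub>1 T\<^sub>1 i\<^sub>1 (E\<^sub>2 :: 'c riesz) e\<^sub>2 T\<^sub>2 i\<^sub>2.
      T_universal_completion E e T E\<^sub>1 e\<^sub>1 T\<^sub>1 i\<^sub>1 \<and> T_universal_completion E e T E\<^sub>2 e\<^sub>2 T\<^sub>2 i\<^sub>2 \<longrightarrow>
      (\<exists>\<Phi>. riesz_iso E\<^sub>1 E\<^sub>2 \<Phi> \<and>
        (\<forall>x\<in>carrier E. \<Phi> (i\<^sub>1 x) = i\<^sub>2 x) \<and>
        (\<forall>x\<in>carrier E. T\<^sub>1 (i\<^sub>1 x) = i\<^sub>1 (T x)) \<and>
        (\<forall>x\<in>carrier E. T\<^sub>2 (i\<^sub>2 x) = i\<^sub>2 (T x)) \<and>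
        (\<forall>y\<in>carrier E\<^sub>1. \<Phi> (T\<^sub>1 y) = T\<^sub>2 (\<Phi> y))))"
proof (intro conjI completion_exists[OF assms] allI impI, elim conjE)
  fix E\<^sub>1 :: "'b riesz" and e\<^sub>1 T\<^sub>1 i\<^sub>1 and E\<^sub>2 :: "'c riesz" and e\<^sub>2 T\<^sub>2 i\<^sub>2
  assume c1: "T_universal_completion E e T E\<^sub>1 e\<^sub>1 T\<^sub>1 i\<^sub>1"
    and c2: "T_universal_completion E e T E\<^sub>2 e\<^sub>2 T\<^sub>2 i\<^sub>2"
  have "\<forall>x\<in>carrier E. T\<^sub>1 (i\<^sub>1 x) = i\<^sub>1 (T x)" "\<forall>x\<in>carrier E. T\<^sub>2 (i\<^sub>2 x) = i\<^sub>2 (T x)"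
    using c1 c2 by (simp_all add: T_universal_completion_def)
  with completion_unique[OF assms c1 c2] show "\<exists>\<Phi>. riesz_iso E\<^sub>1 E\<^sub>2 \<Phi> \<and>
      (\<forall>x\<in>carrier E. \<Phi> (i\<^sub>1 x) = i\<^sub>2 x) \<and>
      (\<forall>x\<in>carrier E. T\<^sub>1 (i\<^sub>1 x) = i\<^sub>1 (T x)) \<and>
      (\<forall>x\<in>carrier E. T\<^sub>2 (i\<^sub>2 x) = i\<^sub>2 (T x)) \<and>
      (\<forall>y\<in>carrier E\<^sub>1. \<Phi> (T\<^sub>1 y) = T\<^sub>2 (\<Phi> y))"
    by simp
qed

end
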